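(* Let $A$ and $B$ be $C^{*}$-algebras and let $\varphi:A \to B$ be a completely positive contractive order zero map. (1) If $\tau$ is a positive tracial functional on $B$, then the composition $\tau \circ \varphi$ is a positive tracial functional on $A$. (2) If $\tau$ is a 2-quasitrace on $B$, then the composition $\tau \circ \varphi$ is a 2-quasitrace on $A$.
   Context: Two elements $a,b$ of a $C^{*}$-algebra are orthogonal, written $a \perp b$, if $ab=ba=a^{*}b=ab^{*}=0$. A completely positive map $\varphi:A\to B$ between $C^{*}$-algebras has order zero if, for all $a,b\in A_{+}$, $a\perp b$ implies $\varphi(a)\perp\varphi(b)$. A positive tracial functional on $B$ is a positive linear functional $\tau:B\to\mathbb{C}$ with $\tau(xy)=\tau(yx)$ for all $x,y\in B$. A quasitrace on a $C^{*}$-algebra $B$ is a function $\tau:B\to\mathbb{C}$ such that $\tau(x^{*}x)=\tau(xx^{*})\ge 0$ for all $x\in B$, $\tau(a+ib)=\tau(a)+i\tau(b)$ for all self-adjoint $a,b\in B$, and $\tau$ is linear on every commutative $C^{*}$-subalgebra of $B$. It is a 2-quasitrace if moreover it extends to $M_{2}(B)$, i.e. there is a quasitrace $\tau_2$ on $M_{2}(B)$ with $\tau_2(x\otimes e_{11})=\tau(x)$ for all $x\in B$. *)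

theory Defs
  imports "HOL-Analysis.Analysis"
begin

class complex_star_algebra = ring +
  fixes scaleC :: "complex \<Rightarrow> 'a \<Rightarrow> 'a" (infixr \<open>*\<^sub>C\<close> 75)
    and star :: "'a \<Rightarrow> 'a"
  assumes scaleC_add_right: "c *\<^sub>C (x + y) = c *\<^sub>C x + c *\<^sub>C y"
    and scaleC_add_left: "(c + d) *\<^sub>C x = c *\<^sub>C x + d *\<^sub>C x"
    and scaleC_scaleC: "c *\<^sub>C d *\<^sub>C x = (c * d) *\<^sub>C x"
    and scaleC_one: "1 *\<^sub>C x = x"
    and mult_scaleC_left: "(c *\<^sub>C x) * y = c *\<^sub>C (x * y)"
    and mult_scaleC_right: "x * (c *\<^sub>C y) = c *\<^sub>C (x * y)"
    and star_add: "star (x + y) = star x + star y"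
    and star_scaleC: "star (c *\<^sub>C x) = cnj c *\<^sub>C star x"
    and star_mult: "star (x * y) = star y * star x"
    and star_star: "star (star x) = x"

text \<open>C*-algebras are not assumed to be unital, and the zero algebra is allowed.\<close>

class cstar_algebra = complex_star_algebra + real_normed_algebra + banach +
  assumes scaleR_scaleC: "r *\<^sub>R x = complex_of_real r *\<^sub>C x"
    and norm_scaleC: "norm (c *\<^sub>C x) = cmod c * norm x"
    and cstar_identity: "norm (star x * x) = (norm x)\<^sup>2"

definition positive_element :: "'a::complex_star_algebra \<Rightarrow> bool" where
  "positive_element a \<longleftrightarrow> (\<exists>x. a = star x * x)"

definition self_adjoint :: "'a::complex_star_algebra \<Rightarrow> bool" where
  "self_adjoint a \<longleftrightarrow> star a = a"

definition cstar_orthogonal :: "'a::complex_star_algebra \<Rightarrow> 'a \<Rightarrow> bool" where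
  "cstar_orthogonal a b \<longleftrightarrow> a * b = 0 \<and> b * a = 0 \<and> star a * b = 0 \<and> a * star b = 0"


subsection \<open>Completely positive maps of order zero\<close>

text \<open>Here an element of \<open>M\<^sub>n(A)\<close> is a family \<open>x i j\<close> of which only the entries with
  \<open>i, j < n\<close> matter. The right-hand side is the \<open>(i, j)\<close> entry of \<open>y\<^sup>* y\<close>.\<close>

definition matrix_positive :: "nat \<Rightarrow> (nat \<Rightarrow> nat \<Rightarrow> 'a::complex_star_algebra) \<Rightarrow> bool" where
  "matrix_positive n x \<longleftrightarrow>
     (\<exists>y. \<forall>i<n. \<forall>j<n. x i j = (\<Sum>k<n. star (y k i) * y k j))"

definition completely_positive ::
    "('a::complex_star_algebra \<Rightarrow> 'b::complex_star_algebra) \<Rightarrow> bool" where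
  "completely_positive \<phi> \<longleftrightarrow>
     Vector_Spaces.linear (*\<^sub>C) (*\<^sub>C) \<phi> \<and>
     (\<forall>n x. matrix_positive n x \<longrightarrow> matrix_positive n (\<lambda>i j. \<phi> (x i j)))"

definition contractive :: "('a::cstar_algebra \<Rightarrow> 'b::cstar_algebra) \<Rightarrow> bool" where
  "contractive \<phi> \<longleftrightarrow> (\<forall>x. norm (\<phi> x) \<le> norm x)"

definition order_zero ::
    "('a::complex_star_algebra \<Rightarrow> 'b::complex_star_algebra) \<Rightarrow> bool" where
  "order_zero \<phi> \<longleftrightarrow>
     (\<forall>a b. positive_element a \<longrightarrow> positive_element b \<longrightarrow> cstar_orthogonal a b \<longrightarrow>
        cstar_orthogonal (\<phi> a) (\<phi> b))"


subsection \<open>Traces and quasitraces\<close>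

definition positive_tracial_functional :: "('a::complex_star_algebra \<Rightarrow> complex) \<Rightarrow> bool" where
  "positive_tracial_functional \<tau> \<longleftrightarrow>
     Vector_Spaces.linear (*\<^sub>C) (*) \<tau> \<and>
     (\<forall>a. positive_element a \<longrightarrow> \<tau> a \<in> \<real>\<^sub>\<ge>\<^sub>0) \<and>
     (\<forall>x y. \<tau> (x * y) = \<tau> (y * x))"

text \<open>The C*-norm is passed explicitly, so that the two notions below also apply to matrix
  algebras over a C*-algebra, whose norm is defined further down.\<close>

definition cstar_subalgebra ::
    "('a::complex_star_algebra \<Rightarrow> real) \<Rightarrow> 'a set \<Rightarrow> bool" where
  "cstar_subalgebra N C \<longleftrightarrow>
     0 \<in> C \<and> (\<forall>x\<in>C. \<forall>y\<in>C. x + y \<in> C) \<and> (\<forall>c. \<forall>x\<in>C. c *\<^sub>C x \<in> C) \<and>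
     (\<forall>x\<in>C. \<forall>y\<in>C. x * y \<in> C) \<and> (\<forall>x\<in>C. star x \<in> C) \<and>
     (\<forall>l. (\<forall>e>0. \<exists>x\<in>C. N (x - l) < e) \<longrightarrow> l \<in> C)"

definition quasitrace ::
    "('a::complex_star_algebra \<Rightarrow> real) \<Rightarrow> ('a \<Rightarrow> complex) \<Rightarrow> bool" where
  "quasitrace N \<tau> \<longleftrightarrow>
     (\<forall>x. \<tau> (star x * x) = \<tau> (x * star x) \<and> \<tau> (star x * x) \<in> \<real>\<^sub>\<ge>\<^sub>0) \<and>
     (\<forall>a b. self_adjoint a \<longrightarrow> self_adjoint b \<longrightarrow> \<tau> (a + \<i> *\<^sub>C b) = \<tau> a + \<i> * \<tau> b) \<and>
     (\<forall>C. cstar_subalgebra N C \<longrightarrow> (\<forall>x\<in>C. \<forall>y\<in>C. x * y = y * x) \<longrightarrow>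
        (\<forall>x\<in>C. \<forall>y\<in>C. \<tau> (x + y) = \<tau> x + \<tau> y) \<and>
        (\<forall>c. \<forall>x\<in>C. \<tau> (c *\<^sub>C x) = c * \<tau> x))"


subsection \<open>Matrix algebras\<close>

text \<open>A type of its own, since multiplication on \<open>'a ^ 'n ^ 'n\<close> is componentwise in the
  library.\<close>

typedef ('a, 'n) square_matrix = "UNIV :: ('n \<Rightarrow> 'n \<Rightarrow> 'a) set"
  morphisms entry Matrix
  by simp

setup_lifting type_definition_square_matrix

instantiation square_matrix :: (complex_star_algebra, finite) complex_star_algebra
begin

lift_definition zero_square_matrix :: "('a, 'b) square_matrix" is "\<lambda>i j. 0" .

lift_definition plus_square_matrix ::
    "('a, 'b) square_matrix \<Rightarrow> ('a, 'b) square_matrix \<Rightarrow> ('a, 'b) square_matrix"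
  is "\<lambda>x y i j. x i j + y i j" .

lift_definition minus_square_matrix ::
    "('a, 'b) square_matrix \<Rightarrow> ('a, 'b) square_matrix \<Rightarrow> ('a, 'b) square_matrix"
  is "\<lambda>x y i j. x i j - y i j" .

lift_definition uminus_square_matrix :: "('a, 'b) square_matrix \<Rightarrow> ('a, 'b) square_matrix"
  is "\<lambda>x i j. - x i j" .

lift_definition times_square_matrix ::
    "('a, 'b) square_matrix \<Rightarrow> ('a, 'b) square_matrix \<Rightarrow> ('a, 'b) square_matrix"
  is "\<lambda>x y i j. \<Sum>k\<in>UNIV. x i k * y k j" .

lift_definition scaleC_square_matrix ::
    "complex \<Rightarrow> ('a, 'b) square_matrix \<Rightarrow> ('a, 'b) square_matrix"
  is "\<lambda>c x i j. c *\<^sub>C x i j" .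

lift_definition star_square_matrix :: "('a, 'b) square_matrix \<Rightarrow> ('a, 'b) square_matrix"
  is "\<lambda>x i j. star (x j i)" .

instance
proof
  have scaleC_sum: "c *\<^sub>C (\<Sum>k\<in>I. f k) = (\<Sum>k\<in>I. c *\<^sub>C f k)"
    for c and f :: "'b \<Rightarrow> 'a" and I
  proof -
    interpret additive "(*\<^sub>C) c :: 'a \<Rightarrow> 'a"
      by unfold_locales (rule scaleC_add_right)
    show ?thesis by (rule sum)
  qed
  have star_sum: "star (\<Sum>k\<in>I. f k) = (\<Sum>k\<in>I. star (f k))" for f :: "'b \<Rightarrow> 'a" and I
  proof -
    interpret additive "star :: 'a \<Rightarrow> 'a"
      by unfold_locales (rule star_add)
    show ?thesis by (rule sum)
  qed
  fix x y z :: "('a, 'b) square_matrix" and c d :: complex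
  show "x + y + z = x + (y + z)" by transfer (simp add: add.assoc)
  show "x + y = y + x" by transfer (simp add: add.commute)
  show "0 + x = x" by transfer simp
  show "- x + x = 0" by transfer simp
  show "x - y = x + - y" by transfer simp
  show "x * y * z = x * (y * z)"
  proof (transfer, intro ext)
    fix x y z :: "'b \<Rightarrow> 'b \<Rightarrow> 'a" and i j
    have "(\<Sum>k\<in>UNIV. (\<Sum>l\<in>UNIV. x i l * y l k) * z k j) =
        (\<Sum>k\<in>UNIV. \<Sum>l\<in>UNIV. x i l * (y l k * z k j))"
      by (simp add: sum_distrib_right mult.assoc)
    also have "\<dots> = (\<Sum>l\<in>UNIV. \<Sum>k\<in>UNIV. x i l * (y l k * z k j))"
      by (rule sum.swap)
    also have "\<dots> = (\<Sum>l\<in>UNIV. x i l * (\<Sum>k\<in>UNIV. y l k * z k j))"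
      by (simp add: sum_distrib_left)
    finally show "(\<Sum>k\<in>UNIV. (\<Sum>l\<in>UNIV. x i l * y l k) * z k j) =
        (\<Sum>l\<in>UNIV. x i l * (\<Sum>k\<in>UNIV. y l k * z k j))" .
  qed
  show "(x + y) * z = x * z + y * z"
    by transfer (simp add: distrib_right sum.distrib)
  show "x * (y + z) = x * y + x * z"
    by transfer (simp add: distrib_left sum.distrib)
  show "c *\<^sub>C (x + y) = c *\<^sub>C x + c *\<^sub>C y" by transfer (simp add: scaleC_add_right)
  show "(c + d) *\<^sub>C x = c *\<^sub>C x + d *\<^sub>C x" by transfer (simp add: scaleC_add_left)
  show "c *\<^sub>C d *\<^sub>C x = (c * d) *\<^sub>C x" by transfer (simp add: scaleC_scaleC)
  show "1 *\<^sub>C x = x" by transfer (simp add: scaleC_one)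
  show "(c *\<^sub>C x) * y = c *\<^sub>C (x * y)"
    by transfer (simp add: mult_scaleC_left scaleC_sum)
  show "x * (c *\<^sub>C y) = c *\<^sub>C (x * y)"
    by transfer (simp add: mult_scaleC_right scaleC_sum)
  show "star (x + y) = star x + star y" by transfer (simp add: star_add)
  show "star (c *\<^sub>C x) = cnj c *\<^sub>C star x" by transfer (simp add: star_scaleC)
  show "star (x * y) = star y * star x" by transfer (simp add: star_mult star_sum)
  show "star (star x) = x" by transfer (simp add: star_star)
qed

end

text \<open>The C*-norm of \<open>M\<^sub>n(A)\<close> is the operator norm for the action of \<open>M\<^sub>n(A)\<close> on the Hilbert
  module \<open>A\<^sup>n\<close>, whose inner product is \<open>\<langle>v, w\<rangle> = \<Sum>i. v\<^sub>i\<^sup>* w\<^sub>i\<close>.\<close>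

definition hilbert_module_norm :: "('n::finite \<Rightarrow> 'a::cstar_algebra) \<Rightarrow> real" where
  "hilbert_module_norm v = sqrt (norm (\<Sum>i\<in>UNIV. star (v i) * v i))"

definition matrix_norm :: "('a::cstar_algebra, 'n::finite) square_matrix \<Rightarrow> real" where
  "matrix_norm x = (SUP v\<in>{v. hilbert_module_norm v \<le> 1}.
     hilbert_module_norm (\<lambda>i. \<Sum>j\<in>UNIV. entry x i j * v j))"

text \<open>The element \<open>x \<otimes> e\<^sub>1\<^sub>1\<close> of \<open>M\<^sub>2(A)\<close>; the elements of the index type \<open>2\<close> are \<open>1\<close> and \<open>2\<close>.\<close>

definition tensor_e11 :: "'a::cstar_algebra \<Rightarrow> ('a, 2) square_matrix" where
  "tensor_e11 x = Matrix (\<lambda>i j. if i = 1 \<and> j = 1 then x else 0)"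

definition two_quasitrace :: "('a::cstar_algebra \<Rightarrow> complex) \<Rightarrow> bool" where
  "two_quasitrace \<tau> \<longleftrightarrow>
     quasitrace norm \<tau> \<and>
     (\<exists>\<tau>\<^sub>2 :: ('a, 2) square_matrix \<Rightarrow> complex.
        quasitrace matrix_norm \<tau>\<^sub>2 \<and> (\<forall>x. \<tau>\<^sub>2 (tensor_e11 x) = \<tau> x))"

end

theory Submission
  imports Defs "HOL-Complex_Analysis.Cauchy_Integral_Formula"
begin

text \<open>
  The key fact is that a completely positive contractive order zero map satisfies
  \<open>\<phi>(xy) \<phi>(z) = \<phi>(x) \<phi>(yz)\<close>, which replaces the structure theorem \<open>\<phi> = h \<pi>\<close> (there, both sides are
  \<open>h\<^sup>2 \<pi>(xyz)\<close>) and avoids biduals and multiplier algebras. If \<open>xz = 0\<close>, then \<open>x\<^sup>*x\<close> and \<open>zz\<^sup>*\<close> are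
  orthogonal, and complete positivity upgrades \<open>\<phi>(x\<^sup>*x) \<phi>(zz\<^sup>*) = 0\<close> to \<open>\<phi>(yx) \<phi>(zy') = 0\<close>; cutting
  a self-adjoint \<open>b\<close> into tents by functional calculus then moves \<open>b\<close> from one factor to the other.

  The identity is inherited by the entrywise extension to matrices. It shows that \<open>\<phi>\<close> maps
  commutative \<open>C\<close>*-algebras to commuting sets. With \<open>\<bar>x\<bar> = (x\<^sup>*x)\<^bsup>1/2\<^esup>\<close>, it also shows that the elements
  \<open>\<phi>(x\<bar>x\<bar>) r\<^sub>n(\<phi>(x\<^sup>*x))\<close>, for continuous \<open>r\<^sub>n(t)\<close> approximating \<open>t\<^bsup>-1/2\<^esup>\<close>, converge to some \<open>v\<close>
  with \<open>v\<^sup>*v = \<phi>(x\<^sup>*x)\<close> and \<open>vv\<^sup>* = \<phi>(xx\<^sup>*)\<close>, which is \<open>h\<^bsup>1/2\<^esup> \<pi>(x)\<close> in terms of the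
  structure theorem.
\<close>

section \<open>C*-norms and unitization\<close>

text \<open>Every estimate for a function of a self-adjoint contraction \<open>b\<close> goes back
  to a unitary: \<open>b\<close> is the real part of b + i sqrt(1 - b^2), and polynomials of a
  unitary are bounded by their supremum on the circle. The resulting calculus sees all of [-1,1]
  instead of the spectrum of \<open>b\<close>, so positivity can only be exploited by writing an
  element as a square. The algebras may lack a unit, so functions of \<open>b\<close> live in the
  unitization and reach \<phi> only after multiplication by an element of the ideal.

  The tents work because, at mesh 1/n, n times the defect of moving \<open>b\<close> from one factor
  to the other is a sum over neighbouring tents, and such sums are bounded independently of n.

  The factor |x| corrects the power of h. The trace property needs a \<open>v\<close> whose
  \<open>star v * v\<close> is h \<pi>(star x * x), whereas \<phi>(x) itself would give h^2
  \<pi>(star x * x). The element h \<pi>(x |x|) has modulus h \<pi>(star x * x); dividing by the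
  square root of this modulus leaves h^(1/2) \<pi>(x).\<close>

lemma scaleC_zero_right [simp]: "c *\<^sub>C (0::'a::complex_star_algebra) = 0"
  using scaleC_add_right[of c "0::'a" 0] by simp

lemma scaleC_zero_left [simp]: "0 *\<^sub>C (x::'a::complex_star_algebra) = 0"
  using scaleC_add_left[of 0 0 x] by simp

lemma scaleC_minus_left [simp]: "(- c) *\<^sub>C (x::'a::complex_star_algebra) = - (c *\<^sub>C x)"
  using scaleC_add_left[of c "- c" x] by (simp add: eq_neg_iff_add_eq_0 add.commute)

lemma scaleC_minus_right [simp]: "c *\<^sub>C (- x) = - (c *\<^sub>C (x::'a::complex_star_algebra))"
  using scaleC_add_right[of c x "- x"] by (simp add: eq_neg_iff_add_eq_0 add.commute)

lemma scaleC_diff_right: "c *\<^sub>C (x - y) = c *\<^sub>C x - c *\<^sub>C (y::'a::complex_star_algebra)"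
  using scaleC_add_right[of c x "- y"] by simp

lemma star_zero [simp]: "star (0::'a::complex_star_algebra) = 0"
  using star_add[of "0::'a" 0] by simp

lemma star_minus [simp]: "star (- x) = - star (x::'a::complex_star_algebra)"
  using star_add[of x "- x"] by (simp add: eq_neg_iff_add_eq_0 add.commute)

lemma star_diff: "star (x - y) = star x - star (y::'a::complex_star_algebra)"
  using star_add[of x "- y"] by simp

lemma star_sum: "star (\<Sum>i\<in>I. f i) = (\<Sum>i\<in>I. star (f i :: 'a::complex_star_algebra))"
  by (induction I rule: infinite_finite_induct) (simp_all add: star_add)

lemma scaleC_sum: "c *\<^sub>C (\<Sum>i\<in>I. f i) = (\<Sum>i\<in>I. c *\<^sub>C (f i :: 'a::complex_star_algebra))"
  by (induction I rule: infinite_finite_induct) (simp_all add: scaleC_add_right)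

declare star_star [simp] scaleC_one [simp]

lemma star_scaleR: "star (r *\<^sub>R x) = r *\<^sub>R star (x::'a::cstar_algebra)"
  by (simp add: scaleR_scaleC star_scaleC)

text \<open>The inequality and submultiplicativity yield N x <= N (s x), the involution makes this
  an equality, and the reverse inequality follows. \<open>N\<close>, \<open>s\<close> and
  \<open>m\<close> are parameters because the lemma is applied to the unitization and to matrices
  while their C*-algebra instances are still being set up.\<close>

lemma cstar_identity_if:
  fixes N :: "'a \<Rightarrow> real" and s :: "'a \<Rightarrow> 'a" and m :: "'a \<Rightarrow> 'a \<Rightarrow> 'a"
  assumes nonneg: "\<And>x. 0 \<le> N x"
    and mult: "\<And>x y. N (m x y) \<le> N x * N y"
    and le: "\<And>x. (N x)\<^sup>2 \<le> N (m (s x) x)"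
    and involution: "\<And>x. s (s x) = x"
  shows "N (m (s x) x) = (N x)\<^sup>2"
proof -
  have le_s: "N x \<le> N (s x)" for x
  proof (cases "N x = 0")
    case False
    have "N x * N x \<le> N (s x) * N x"
      using le[of x] mult[of "s x" x] by (simp add: power2_eq_square)
    then show ?thesis
      using False nonneg[of x] by (simp add: mult_le_cancel_right)
  qed (simp add: nonneg)
  have "N (s x) = N x"
    using le_s[of x] le_s[of "s x"] by (simp add: involution)
  then show ?thesis
    using le[of x] mult[of "s x" x] by (simp add: power2_eq_square)
qed

lemma norm_star [simp]: "norm (star x) = norm (x::'a::cstar_algebra)"
proof -
  have le_star: "norm x \<le> norm (star x)" for x :: 'a
  proof (cases "x = 0")
    case False
    have "norm x * norm x \<le> norm (star x) * norm x"
      using norm_mult_ineq[of "star x" x] by (simp add: cstar_identity power2_eq_square)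
    then show ?thesis
      using False by (simp add: mult_le_cancel_right)
  qed simp
  show ?thesis
    using le_star[of x] le_star[of "star x"] by simp
qed

lemma norm_mult_star: "norm (x * star x) = (norm (x::'a::cstar_algebra))\<^sup>2"
  using cstar_identity[of "star x"] by simp

lemma bounded_linear_star: "bounded_linear (star :: 'a::cstar_algebra \<Rightarrow> 'a)"
  by (rule bounded_linear_intro[of _ 1]) (simp_all add: star_add star_scaleR)

lemmas tendsto_star [tendsto_intros] = bounded_linear.tendsto[OF bounded_linear_star]

lemma bounded_linear_scaleC: "bounded_linear ((*\<^sub>C) c :: 'a::cstar_algebra \<Rightarrow> 'a)"
  by (rule bounded_linear_intro[of _ "cmod c"])
    (simp_all add: scaleC_add_right scaleR_scaleC scaleC_scaleC norm_scaleC mult.commute)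

section \<open>Adjoining a unit\<close>

class unital_cstar_algebra = cstar_algebra + real_normed_algebra_1

datatype 'a unitization = Unitization (elt: 'a) (scl: complex)

definition left_action :: "'a::cstar_algebra unitization \<Rightarrow> 'a \<Rightarrow> 'a" where
  "left_action x = (\<lambda>y. elt x * y + scl x *\<^sub>C y)"

lemma bounded_linear_left_action: "bounded_linear (left_action x)"
  unfolding left_action_def
  by (intro bounded_linear_add bounded_linear_mult_right bounded_linear_scaleC)

instantiation unitization :: (cstar_algebra) "{complex_star_algebra, real_normed_algebra_1}"
begin

definition "0 = Unitization 0 0"
definition "1 = Unitization 0 1"
definition "x + y = Unitization (elt x + elt y) (scl x + scl y)"
definition "x - y = Unitization (elt x - elt y) (scl x - scl y)"
definition "- x = Unitization (- elt x) (- scl x)"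
definition "x * y = Unitization (elt x * elt y + scl x *\<^sub>C elt y + scl y *\<^sub>C elt x) (scl x * scl y)"
definition "c *\<^sub>C x = Unitization (c *\<^sub>C elt x) (c * scl x)"
definition scaleR_unitization :: "real \<Rightarrow> 'a unitization \<Rightarrow> 'a unitization"
  where "scaleR_unitization r x = complex_of_real r *\<^sub>C x"
definition "star x = Unitization (star (elt x)) (cnj (scl x))"
text \<open>The operator norm of \<open>left_action x\<close> alone is not a norm if the given algebra has a unit.\<close>
definition norm_unitization :: "'a unitization \<Rightarrow> real"
  where "norm_unitization x = max (onorm (left_action x)) (cmod (scl x))"
definition sgn_unitization :: "'a unitization \<Rightarrow> 'a unitization"
  where "sgn_unitization x = inverse (norm x) *\<^sub>R x"
definition dist_unitization :: "'a unitization \<Rightarrow> 'a unitization \<Rightarrow> real"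
  where "dist_unitization x y = norm (x - y)"
definition uniformity_unitization :: "('a unitization \<times> 'a unitization) filter"
  where "uniformity_unitization = (INF e\<in>{0<..}. principal {(x, y). dist x y < e})"
definition open_unitization :: "'a unitization set \<Rightarrow> bool"
  where "open_unitization U = (\<forall>x\<in>U. eventually (\<lambda>(x', y). x' = x \<longrightarrow> y \<in> U) uniformity)"

lemma unitization_sels [simp]:
  "elt (0 :: 'a unitization) = 0" "scl (0 :: 'a unitization) = 0"
  "elt (1 :: 'a unitization) = 0" "scl (1 :: 'a unitization) = 1"
  "elt (x + y) = elt x + elt y" "scl (x + y) = scl x + scl y"
  "elt (x - y) = elt x - elt y" "scl (x - y) = scl x - scl y"
  "elt (- x) = - elt x" "scl (- x) = - scl x"
  "elt (x * y) = elt x * elt y + scl x *\<^sub>C elt y + scl y *\<^sub>C elt x" "scl (x * y) = scl x * scl y"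
  "elt (c *\<^sub>C x) = c *\<^sub>C elt x" "scl (c *\<^sub>C x) = c * scl x"
  "elt (r *\<^sub>R x) = r *\<^sub>R elt x" "scl (r *\<^sub>R x) = of_real r * scl x"
  "elt (star x) = star (elt x)" "scl (star x) = cnj (scl x)"
  for x y :: "'a unitization"
  by (simp_all add: zero_unitization_def one_unitization_def plus_unitization_def
      minus_unitization_def uminus_unitization_def times_unitization_def scaleC_unitization_def
      scaleR_unitization_def star_unitization_def scaleR_scaleC)

lemma left_action_mult: "left_action (x * y) = left_action x \<circ> left_action y"
  by (rule ext)
    (simp add: left_action_def algebra_simps scaleC_add_right scaleC_scaleC mult_scaleC_left
      mult_scaleC_right)

lemma left_action_add: "left_action (x + y) = (\<lambda>z. left_action x z + left_action y z)"
  by (rule ext) (simp add: left_action_def algebra_simps scaleC_add_left)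

lemma left_action_scaleC: "left_action (c *\<^sub>C x) = (\<lambda>z. c *\<^sub>C left_action x z)"
  by (rule ext) (simp add: left_action_def scaleC_add_right scaleC_scaleC mult_scaleC_left)

lemma norm_left_action_le: "norm (left_action x z) \<le> onorm (left_action x) * norm z"
  by (rule onorm[OF bounded_linear_left_action])

text \<open>The original algebra is an ideal, so its own C*-identity applies to
  \<open>left_action x z\<close>: the square of its norm is the norm of
  \<open>star z * left_action (star x * x) z\<close>.\<close>

lemma onorm_left_action_square_le:
  "(onorm (left_action x))\<^sup>2 \<le> onorm (left_action (star x * x))"
proof -
  let ?M = "onorm (left_action (star x * x))"
  have star_action: "star (left_action x z) * left_action x z = star z * left_action (star x * x) z"
    for z
    by (simp add: left_action_def algebra_simps star_add star_mult star_scaleC mult_scaleC_left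
        mult_scaleC_right scaleC_add_right scaleC_scaleC)
  have "norm (left_action x z) \<le> sqrt ?M * norm z" for z
  proof -
    have "(norm (left_action x z))\<^sup>2 = norm (star z * left_action (star x * x) z)"
      by (simp flip: star_action add: cstar_identity)
    also have "\<dots> \<le> norm z * (?M * norm z)"
      by (rule order_trans[OF norm_mult_ineq])
        (simp add: mult_left_mono norm_left_action_le)
    also have "\<dots> = (sqrt ?M * norm z)\<^sup>2"
      using onorm_pos_le[OF bounded_linear_left_action, of "star x * x"]
      by (simp add: power_mult_distrib power2_eq_square[of "norm z"])
    finally show ?thesis
      by (rule power2_le_imp_le) (simp add: onorm_pos_le[OF bounded_linear_left_action])
  qed
  then have "onorm (left_action x) \<le> sqrt ?M"
    by (intro onorm_bound) (simp_all add: onorm_pos_le[OF bounded_linear_left_action])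
  then show ?thesis
    by (metis bounded_linear_left_action onorm_pos_le power_mono real_sqrt_pow2)
qed

lemma onorm_left_action_mult_le:
  "onorm (left_action (x * y)) \<le> onorm (left_action x) * onorm (left_action y)"
  unfolding left_action_mult
  by (intro onorm_compose bounded_linear_left_action)

text \<open>Testing the operator on \<open>star (elt x)\<close> recovers the norm of
  \<open>elt x\<close> up to the scalar part. Hence the unitization norm is equivalent to the sum
  norm on the two coordinates, which later gives definiteness and completeness.\<close>

lemma norm_elt_le: "norm (elt x) \<le> onorm (left_action x) + cmod (scl x)"
proof (cases "elt x = 0")
  case False
  have "norm (elt x) * norm (elt x) = norm (elt x * star (elt x))"
    by (simp add: norm_mult_star power2_eq_square)
  also have "elt x * star (elt x) = left_action x (star (elt x)) - scl x *\<^sub>C star (elt x)"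
    by (simp add: left_action_def)
  also have "norm \<dots> \<le> onorm (left_action x) * norm (elt x) + cmod (scl x) * norm (elt x)"
    using norm_left_action_le[of x "star (elt x)"]
    by (intro order_trans[OF norm_triangle_ineq4]) (simp add: norm_scaleC)
  finally show ?thesis
    using False by (simp flip: distrib_right)
qed (simp add: onorm_pos_le[OF bounded_linear_left_action])

lemma onorm_left_action_le: "onorm (left_action x) \<le> norm (elt x) + cmod (scl x)"
proof (rule onorm_bound)
  fix z
  have "norm (elt x * z) \<le> norm (elt x) * norm z"
    by (rule norm_mult_ineq)
  then show "norm (left_action x z) \<le> (norm (elt x) + cmod (scl x)) * norm z"
    unfolding left_action_def
    by (intro order_trans[OF norm_triangle_ineq]) (simp add: norm_scaleC algebra_simps)
qed simp

lemma norm_unitization_cmp: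
  "norm (elt x) \<le> 2 * norm (x :: 'a unitization)" "cmod (scl x) \<le> norm (x :: 'a unitization)"
  "norm (x :: 'a unitization) \<le> norm (elt x) + cmod (scl x)"
  using norm_elt_le[of x] onorm_left_action_le[of x] by (auto simp: norm_unitization_def)

lemma norm_scaleC_unitization: "norm (c *\<^sub>C x) = cmod c * norm x"
  for x :: "'a unitization"
proof -
  have "onorm (left_action (c *\<^sub>C x)) = cmod c * onorm (left_action x)"
  proof (cases "c = 0")
    case True
    then show ?thesis
      by (simp add: left_action_scaleC onorm_zero)
  next
    case False
    have le: "onorm (left_action (c *\<^sub>C x)) \<le> cmod c * onorm (left_action x)"
      for c and x :: "'a unitization"
      unfolding left_action_scaleC
    proof (rule onorm_bound)
      show "norm (c *\<^sub>C left_action x z) \<le> cmod c * onorm (left_action x) * norm z" for z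
        using mult_left_mono[OF norm_left_action_le, of "cmod c" x z]
        by (simp add: cstar_algebra_class.norm_scaleC mult.assoc)
    qed (simp add: onorm_pos_le[OF bounded_linear_left_action])
    have "inverse c *\<^sub>C c *\<^sub>C x = x"
      using False by (intro unitization.expand) (simp add: scaleC_scaleC)
    then have "onorm (left_action x) \<le> inverse (cmod c) * onorm (left_action (c *\<^sub>C x))"
      using le[of "inverse c" "c *\<^sub>C x"] by (simp add: norm_inverse)
    then show ?thesis
      using le[of c x] False by (simp add: field_simps)
  qed
  then show ?thesis
    by (simp add: norm_unitization_def norm_mult max_mult_distrib_left)
qed

instance
proof
  fix x y z :: "'a unitization" and c d :: complex and r s :: real
  note simps = scaleC_add_left scaleC_add_right scaleC_scaleC mult_scaleC_left mult_scaleC_right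
    star_add star_scaleC star_mult algebra_simps
  show "x + y + z = x + (y + z)" "x + y = y + x" "0 + x = x" "- x + x = 0" "x - y = x + - y"
    "x * y * z = x * (y * z)" "(x + y) * z = x * z + y * z" "x * (y + z) = x * y + x * z"
    "1 * x = x" "x * 1 = x" "c *\<^sub>C (x + y) = c *\<^sub>C x + c *\<^sub>C y" "(c + d) *\<^sub>C x = c *\<^sub>C x + d *\<^sub>C x"
    "c *\<^sub>C d *\<^sub>C x = (c * d) *\<^sub>C x" "1 *\<^sub>C x = x" "(c *\<^sub>C x) * y = c *\<^sub>C (x * y)"
    "x * (c *\<^sub>C y) = c *\<^sub>C (x * y)" "star (x + y) = star x + star y"
    "star (c *\<^sub>C x) = cnj c *\<^sub>C star x" "star (x * y) = star y * star x" "star (star x) = x"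
    "r *\<^sub>R (x + y) = r *\<^sub>R x + r *\<^sub>R y"
    "(r + s) *\<^sub>R x = r *\<^sub>R x + s *\<^sub>R x" "r *\<^sub>R s *\<^sub>R x = (r * s) *\<^sub>R x" "1 *\<^sub>R x = x"
    "r *\<^sub>R x * y = r *\<^sub>R (x * y)" "x * r *\<^sub>R y = r *\<^sub>R (x * y)"
    by (rule unitization.expand; simp add: simps scaleR_scaleC)+
  show "(0 :: 'a unitization) \<noteq> 1"
    by (metis unitization_sels(2,4) zero_neq_one)
  show "dist x y = norm (x - y)" "sgn x = inverse (norm x) *\<^sub>R x"
    "uniformity = (INF e\<in>{0<..}. principal {(x, y :: 'a unitization). dist x y < e})"
    by (simp_all add: dist_unitization_def sgn_unitization_def uniformity_unitization_def)
  show "open U = (\<forall>x\<in>U. eventually (\<lambda>(x', y). x' = x \<longrightarrow> y \<in> U) uniformity)"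
    for U :: "'a unitization set"
    by (rule open_unitization_def)
  show "norm x = 0 \<longleftrightarrow> x = 0"
  proof
    assume "norm x = 0"
    then show "x = 0"
      using norm_unitization_cmp(1,2)[of x] by (intro unitization.expand) simp
  next
    assume "x = 0"
    then show "norm x = 0"
      using norm_unitization_cmp(2,3)[of x] by simp
  qed
  show "norm (x + y) \<le> norm x + norm y"
  proof -
    have "onorm (left_action (x + y)) \<le> onorm (left_action x) + onorm (left_action y)"
      unfolding left_action_add
      by (intro onorm_triangle bounded_linear_left_action)
    then show ?thesis
      using norm_triangle_ineq[of "scl x" "scl y"] by (auto simp: norm_unitization_def)
  qed
  show "norm (r *\<^sub>R x) = \<bar>r\<bar> * norm x"
    by (simp add: scaleR_unitization_def norm_scaleC_unitization)
  show submult: "norm (x * y) \<le> norm x * norm y" for x y :: "'a unitization"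
  proof -
    have "onorm (left_action x) * onorm (left_action y) \<le> norm x * norm y"
      and "cmod (scl x) * cmod (scl y) \<le> norm x * norm y"
      using onorm_pos_le[OF bounded_linear_left_action, of x]
        onorm_pos_le[OF bounded_linear_left_action, of y]
      by (auto simp: norm_unitization_def intro!: mult_mono)
    then show ?thesis
      using onorm_left_action_mult_le[of x y]
      by (subst norm_unitization_def) (simp add: norm_mult)
  qed
  show "norm (1 :: 'a unitization) = 1"
  proof -
    have "left_action 1 = (\<lambda>z :: 'a. z)"
      by (simp add: left_action_def)
    then show ?thesis
      using onorm_id_le[where 'a='a] by (simp add: norm_unitization_def)
  qed
qed

end

instance unitization :: (cstar_algebra) unital_cstar_algebra
proof
  fix x y :: "'a unitization" and c :: complex and r :: real
  show "r *\<^sub>R x = complex_of_real r *\<^sub>C x"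
    by (simp add: scaleR_unitization_def)
  show "norm (c *\<^sub>C x) = cmod c * norm x"
    by (rule norm_scaleC_unitization)
  show "norm (star x * x) = (norm x)\<^sup>2"
  proof (rule cstar_identity_if[of "norm :: 'a unitization \<Rightarrow> real" "(*)" star])
    show "(norm x)\<^sup>2 \<le> norm (star x * x)" for x :: "'a unitization"
      using onorm_left_action_square_le[of x]
      by (auto simp: norm_unitization_def max_def norm_mult power2_eq_square)
    show "0 \<le> norm x" for x :: "'a unitization"
      by (simp add: norm_unitization_def le_max_iff_disj)
  qed (simp_all add: norm_mult_ineq unitization.expand)
  show "convergent X" if "Cauchy X" for X :: "nat \<Rightarrow> 'a unitization"
  proof -
    have "bounded_linear (elt :: 'a unitization \<Rightarrow> 'a)"
      using norm_unitization_cmp(1)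
      by (intro bounded_linear_intro[of _ 2]) (simp_all add: mult.commute)
    from bounded_linear.Cauchy[OF this that]
    obtain l where l: "(\<lambda>n. elt (X n)) \<longlonglongrightarrow> l"
      unfolding Cauchy_convergent_iff convergent_def ..
    have "bounded_linear (scl :: 'a unitization \<Rightarrow> complex)"
      using norm_unitization_cmp(2)
      by (intro bounded_linear_intro[of _ 1]) (simp_all add: scaleR_conv_of_real[where 'a=complex])
    from bounded_linear.Cauchy[OF this \<open>Cauchy X\<close>]
    obtain c where c: "(\<lambda>n. scl (X n)) \<longlonglongrightarrow> c"
      unfolding Cauchy_convergent_iff convergent_def ..
    have lim: "(\<lambda>n. norm (elt (X n) - l) + cmod (scl (X n) - c)) \<longlonglongrightarrow> 0"
      using tendsto_add[OF LIM_zero[OF l, THEN tendsto_norm_zero] LIM_zero[OF c, THEN tendsto_norm_zero]]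
      by simp
    have "X \<longlonglongrightarrow> Unitization l c"
    proof (rule metric_tendsto_imp_tendsto[OF lim])
      show "\<forall>\<^sub>F n in sequentially. dist (X n) (Unitization l c)
          \<le> dist (norm (elt (X n) - l) + cmod (scl (X n) - c)) 0"
        using norm_unitization_cmp(3)[of "X n - Unitization l c" for n]
        by (auto simp: dist_unitization_def intro!: always_eventually)
    qed
    then show ?thesis
      by (rule convergentI)
  qed
qed

definition unit_embed :: "'a::cstar_algebra \<Rightarrow> 'a unitization" where
  "unit_embed x = Unitization x 0"

lemma unit_embed_sels [simp]: "elt (unit_embed x) = x" "scl (unit_embed x) = 0"
  by (simp_all add: unit_embed_def)

lemma unit_embed_elt: "scl x = 0 \<Longrightarrow> unit_embed (elt x) = x"
  by (rule unitization.expand) simp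

lemma unit_embed_inject [simp]: "unit_embed x = unit_embed y \<longleftrightarrow> x = y"
  by (simp add: unit_embed_def)

lemma unit_embed_hom:
  "unit_embed 0 = 0" "unit_embed (x + y) = unit_embed x + unit_embed y"
  "unit_embed (x - y) = unit_embed x - unit_embed y" "unit_embed (- x) = - unit_embed x"
  "unit_embed (x * y) = unit_embed x * unit_embed y"
  "unit_embed (star x) = star (unit_embed x)"
  "unit_embed (c *\<^sub>C x) = c *\<^sub>C unit_embed x" "unit_embed (r *\<^sub>R x) = r *\<^sub>R unit_embed x"
  by (rule unitization.expand; simp)+

lemma norm_unit_embed [simp]: "norm (unit_embed x) = norm x"
proof (rule antisym)
  show "norm (unit_embed x) \<le> norm x"
    using norm_unitization_cmp(3)[of "unit_embed x"] by simp
  show "norm x \<le> norm (unit_embed x)"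
    using norm_elt_le[of "unit_embed x"] by (simp add: norm_unitization_def)
qed

section \<open>Continuous functional calculus\<close>

definition peval :: "complex poly \<Rightarrow> 'a::unital_cstar_algebra \<Rightarrow> 'a" where
  "peval p a = (\<Sum>i\<le>degree p. coeff p i *\<^sub>C a ^ i)"

lemma peval_eq_sum: "degree p \<le> n \<Longrightarrow> peval p a = (\<Sum>i\<le>n. coeff p i *\<^sub>C a ^ i)"
  unfolding peval_def by (rule sum.mono_neutral_left) (auto simp: coeff_eq_0)

lemma peval_pCons: "peval (pCons c p) a = c *\<^sub>C 1 + a * peval p a"
proof -
  have "peval (pCons c p) a = (\<Sum>i\<le>Suc (degree p). coeff (pCons c p) i *\<^sub>C a ^ i)"
    by (rule peval_eq_sum) (rule degree_pCons_le)
  also have "\<dots> = c *\<^sub>C 1 + (\<Sum>i\<le>degree p. coeff p i *\<^sub>C (a * a ^ i))"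
    by (subst sum.atMost_Suc_shift) simp
  finally show ?thesis
    by (simp add: peval_def sum_distrib_left mult_scaleC_right)
qed

lemma peval_0 [simp]: "peval 0 a = 0"
  by (simp add: peval_def)

lemma peval_1 [simp]: "peval 1 a = 1"
  by (simp add: peval_def)

lemma peval_add: "peval (p + q) a = peval p a + peval q a"
proof -
  define n where "n = max (degree p) (degree q)"
  have "degree (p + q) \<le> n" "degree p \<le> n" "degree q \<le> n"
    by (simp_all add: n_def degree_add_le_max)
  then show ?thesis
    by (simp add: peval_eq_sum[of _ n] scaleC_add_left sum.distrib)
qed

lemma peval_smult: "peval (smult c p) a = c *\<^sub>C peval p a"
  by (simp add: peval_eq_sum[of "smult c p" "degree p"] peval_def scaleC_sum scaleC_scaleC
      degree_smult_le)

lemma peval_mult: "peval (p * q) a = peval p a * peval q a"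
  by (induction p) (simp_all add: peval_pCons peval_add peval_smult mult_scaleC_left algebra_simps)

lemma peval_power: "peval (p ^ n) a = peval p a ^ n"
  by (induction n) (simp_all add: peval_mult)

lemma peval_commute:
  assumes "y * a = a * y"
  shows "y * peval p a = peval p a * y"
proof (induction p)
  case (pCons c p)
  have "y * (a * peval p a) = a * peval p a * y"
    by (metis assms pCons.IH mult.assoc)
  then show ?case
    by (simp add: peval_pCons distrib_left distrib_right mult_scaleC_left mult_scaleC_right)
qed simp

text \<open>The Cauchy estimate for the k-th Taylor coefficient at 0 with radius 1.\<close>

lemma coeff_bound:
  fixes p :: "complex poly"
  assumes "\<And>z. cmod z = 1 \<Longrightarrow> cmod (poly p z) \<le> B"
  shows "cmod (coeff p k) \<le> B"
proof -
  have deriv: "(deriv ^^ k) (poly p) = poly ((pderiv ^^ k) p)"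
  proof (induction k)
    case (Suc k)
    have "deriv (poly q) = poly (pderiv q)" for q :: "complex poly"
      by (rule ext, rule DERIV_imp_deriv, rule poly_DERIV)
    with Suc show ?case
      by simp
  qed simp
  have "cmod ((deriv ^^ k) (poly p) 0) \<le> fact k * B / 1 ^ k"
    by (rule Cauchy_inequality) (use assms in \<open>auto intro!: holomorphic_intros continuous_intros\<close>)
  moreover have "(deriv ^^ k) (poly p) 0 = fact k * coeff p k"
    unfolding deriv poly_0_coeff_0 coeff_higher_pderiv by (simp add: pochhammer_fact)
  ultimately show ?thesis
    by (simp add: norm_mult)
qed

lemma norm_square_normal:
  fixes a :: "'a::cstar_algebra"
  assumes "star a * a = a * star a"
  shows "norm (a * a) = (norm a)\<^sup>2"
proof -
  have "star (a * a) * (a * a) = star (star a * a) * (star a * a)"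
    unfolding star_mult star_star using assms by (metis mult.assoc)
  then have "(norm (a * a))\<^sup>2 = ((norm a)\<^sup>2)\<^sup>2"
    by (metis cstar_identity)
  then show ?thesis
    by (rule power2_eq_imp_eq) simp_all
qed

text \<open>Powers of two suffice, since the C*-identity controls squares; this takes the place of
  the spectral radius formula.\<close>

lemma norm_power_normal:
  fixes a :: "'a::unital_cstar_algebra"
  assumes "star a * a = a * star a"
  shows "norm (a ^ 2 ^ k) = norm a ^ 2 ^ k"
  using assms
proof (induction k arbitrary: a)
  case (Suc k)
  have "star (a * a) * (a * a) = (a * a) * star (a * a)"
    unfolding star_mult using Suc.prems by (metis mult.assoc)
  from Suc.IH[OF this] have "norm ((a * a) ^ 2 ^ k) = (norm a)\<^sup>2 ^ 2 ^ k"
    by (simp only: norm_square_normal[OF Suc.prems])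
  moreover have "a ^ 2 ^ Suc k = (a * a) ^ 2 ^ k"
    by (simp add: power_mult power2_eq_square)
  ultimately show ?case
    by (simp add: power_mult)
qed simp

text \<open>If x = (1 + r) B with r > 0, the left side outgrows the factor that is linear in
  2^k.\<close>

lemma le_of_power_le:
  fixes x B d :: real
  assumes "0 \<le> B" and le: "\<And>k. x ^ 2 ^ k \<le> (d * 2 ^ k + 1) * B ^ 2 ^ k"
  shows "x \<le> B"
proof (rule ccontr)
  assume "\<not> x \<le> B"
  then have "B < x"
    by simp
  show False
  proof (cases "B = 0")
    case True
    then show False
      using le[of 0] \<open>B < x\<close> by simp
  next
    case False
    define r where "r = x / B - 1"
    have "0 < B" "0 < r"
      using False assms(1) \<open>B < x\<close> by (auto simp: r_def field_simps)
    have x: "x = (1 + r) * B"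
      using \<open>0 < B\<close> by (simp add: r_def)
    have bound: "2 ^ k * r\<^sup>2 \<le> 2 * \<bar>d\<bar> + 1" for k :: nat
    proof -
      define M :: real where "M = 2 ^ k"
      have "1 \<le> M"
        by (simp add: M_def)
      \<comment> \<open>Bernoulli alone is linear in M = 2^k and would not contradict the linear
        factor; squaring it makes the growth quadratic, which is why the hypothesis is used at
        \<open>Suc k\<close>.\<close>
      have "M * r \<le> (1 + r) ^ 2 ^ k"
        using Bernoulli_inequality[of r "2 ^ k"] \<open>0 < r\<close> by (simp add: M_def)
      then have "(M * r)\<^sup>2 \<le> ((1 + r) ^ 2 ^ k)\<^sup>2"
        using \<open>0 < r\<close> \<open>1 \<le> M\<close> by (intro power_mono) auto
      also have "\<dots> = (1 + r) ^ 2 ^ Suc k"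
        by (metis power_Suc2 power_mult)
      also have "\<dots> \<le> d * (2 * M) + 1"
        using le[of "Suc k"] \<open>0 < B\<close> unfolding x M_def by (simp add: power_mult_distrib)
      also have "\<dots> \<le> (2 * \<bar>d\<bar> + 1) * M"
      proof -
        have "d * M \<le> \<bar>d\<bar> * M"
          using \<open>1 \<le> M\<close> by (intro mult_right_mono) auto
        moreover have "d * (2 * M) = 2 * (d * M)" "(2 * \<bar>d\<bar> + 1) * M = 2 * (\<bar>d\<bar> * M) + M"
          by (simp_all add: algebra_simps)
        ultimately show ?thesis
          using \<open>1 \<le> M\<close> by linarith
      qed
      finally have "M * (M * r\<^sup>2) \<le> M * (2 * \<bar>d\<bar> + 1)"
        by (simp add: power2_eq_square algebra_simps)
      then show ?thesis
        using \<open>1 \<le> M\<close> by (simp add: M_def)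
    qed
    obtain k :: nat where "(2 * \<bar>d\<bar> + 1) / r\<^sup>2 < 2 ^ k"
      using real_arch_pow[of 2] by auto
    then show False
      using bound[of k] \<open>0 < r\<close> by (simp add: field_simps)
  qed
qed

lemma norm_unitary:
  fixes u :: "'a::unital_cstar_algebra"
  assumes "star u * u = 1"
  shows "norm u = 1"
proof -
  have "(norm u)\<^sup>2 = 1\<^sup>2"
    using cstar_identity[of u] assms by simp
  then show ?thesis
    by (rule power2_eq_imp_eq) simp_all
qed

text \<open>The coefficients of \<open>p\<close> give \<open>\<parallel>p(u)\<parallel> \<le> (deg p + 1) sup |p|\<close>; applied to the powers
  \<open>p\<^bsup>N\<^esup>\<close> this improves to the sharp bound, since \<open>\<parallel>p(u)\<^bsup>N\<^esup>\<parallel> = \<parallel>p(u)\<parallel>\<^bsup>N\<^esup>\<close> for \<open>N = 2\<^bsup>k\<^esup>\<close>.\<close>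

lemma norm_peval_unitary_le:
  fixes u :: "'a::unital_cstar_algebra"
  assumes u: "star u * u = 1" "u * star u = 1"
    and B: "\<And>z. cmod z = 1 \<Longrightarrow> cmod (poly p z) \<le> B"
  shows "norm (peval p u) \<le> B"
proof (rule le_of_power_le)
  show "0 \<le> B"
    using order_trans[OF norm_ge_zero B[of 1]] by simp
  fix k :: nat
  have crude: "norm (peval q u) \<le> (real (degree q) + 1) * C"
    if "\<And>z. cmod z = 1 \<Longrightarrow> cmod (poly q z) \<le> C" for q and C :: real
  proof -
    have "norm (coeff q i *\<^sub>C u ^ i) \<le> C" for i
      using mult_mono[OF coeff_bound[of q C i] norm_power_ineq[of u i]] that
        order_trans[OF norm_ge_zero that[of 1]]
      by (simp add: norm_scaleC norm_unitary[OF u(1)])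
    then show ?thesis
      unfolding peval_def
      by (intro order_trans[OF sum_norm_bound[where K = C]]) (auto simp: algebra_simps)
  qed
  have "star (peval p u) * u = u * star (peval p u)"
    using peval_commute[of "star u" u p] u by (metis star_mult star_star)
  then have "star (peval p u) * peval p u = peval p u * star (peval p u)"
    by (rule peval_commute)
  then have "norm (peval p u) ^ 2 ^ k = norm (peval (p ^ 2 ^ k) u)"
    by (simp add: norm_power_normal peval_power)
  also have "\<dots> \<le> (real (degree (p ^ 2 ^ k)) + 1) * B ^ 2 ^ k"
    by (rule crude) (simp add: poly_power norm_power B power_mono)
  also have "\<dots> \<le> (real (degree p) * 2 ^ k + 1) * B ^ 2 ^ k"
  proof (rule mult_right_mono)
    have "real (degree (p ^ 2 ^ k)) \<le> real (degree p * 2 ^ k)"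
      using degree_power_le by (rule of_nat_mono)
    then show "real (degree (p ^ 2 ^ k)) + 1 \<le> real (degree p) * 2 ^ k + 1"
      by simp
  qed (simp add: \<open>0 \<le> B\<close>)
  finally show "norm (peval p u) ^ 2 ^ k \<le> (real (degree p) * 2 ^ k + 1) * B ^ 2 ^ k" .
qed

text \<open>The equation (1 - y)^2 = 1 - t says y = (t + y^2) / 2, whose right side is a contraction
  with constant \<open>norm t\<close> on the ball of radius \<open>norm t\<close>. Being
  self-adjoint and commuting with the commutant of t are closed conditions preserved by the
  iteration, so they are built into \<open>S\<close> and inherited by the fixed point.\<close>

lemma sqrt_one_minus:
  fixes t :: "'a::unital_cstar_algebra"
  assumes "star t = t" and "norm t < 1"
  obtains c where "star c = c" "c * c = 1 - t" "\<And>y. y * t = t * y \<Longrightarrow> y * c = c * y"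
proof -
  define S where "S = {y. norm y \<le> norm t \<and> star y = y \<and> (\<forall>z. z * t = t * z \<longrightarrow> z * y = y * z)}"
  define f where "f y = (1 / 2 :: real) *\<^sub>R (t + y * y)" for y
  have "closed S"
    unfolding S_def
    by (intro closed_Collect_conj closed_Collect_le closed_Collect_all closed_Collect_imp
        closed_Collect_eq continuous_intros linear_continuous_on bounded_linear_star) simp
  have "\<exists>!y\<in>S. f y = y"
  proof (rule Banach_fix)
    show "complete S"
      using \<open>closed S\<close> by (simp add: complete_eq_closed)
    show "S \<noteq> {}"
      by (auto simp: S_def intro!: exI[of _ 0])
    show "f ` S \<subseteq> S"
    proof (rule image_subsetI)
      fix y assume "y \<in> S"
      then have y: "norm y \<le> norm t" "star y = y" "\<And>z. z * t = t * z \<Longrightarrow> z * y = y * z"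
        by (auto simp: S_def)
      have "norm (y * y) \<le> norm t"
        using mult_mono[OF y(1) y(1)] assms(2) mult_left_le[of "norm t" "norm t"]
          norm_mult_ineq[of y y] by simp
      then have "norm (f y) \<le> norm t"
        using norm_triangle_ineq[of t "y * y"] by (simp add: f_def)
      moreover have "z * (y * y) = y * y * z" if "z * t = t * z" for z
        using y(3)[OF that] by (metis mult.assoc)
      ultimately show "f y \<in> S"
        using y(2) assms(1) by (auto simp: S_def f_def star_scaleR star_add star_mult algebra_simps)
    qed
    show "dist (f y) (f z) \<le> norm t * dist y z" if "y \<in> S" "z \<in> S" for y z
    proof -
      have "f y - f z = (1 / 2 :: real) *\<^sub>R (y * (y - z) + (y - z) * z)"
        by (simp add: f_def algebra_simps)
      moreover have "norm (y * (y - z) + (y - z) * z)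
          \<le> norm y * norm (y - z) + norm (y - z) * norm z"
        by (intro order_trans[OF norm_triangle_ineq] add_mono norm_mult_ineq)
      moreover have "\<dots> \<le> norm t * norm (y - z) + norm (y - z) * norm t"
        using that by (intro add_mono mult_mono) (auto simp: S_def)
      ultimately show ?thesis
        by (simp add: dist_norm)
    qed
  qed (use assms in auto)
  then obtain y where "y \<in> S" and "f y = y"
    by blast
  show ?thesis
  proof (rule that[of "1 - y"])
    have "t + y * y = 2 *\<^sub>R f y"
      by (simp add: f_def)
    then have "t + y * y = y + y"
      by (simp add: \<open>f y = y\<close> scaleR_2)
    then have "y * y = y + y - t"
      by (simp add: eq_diff_eq add.commute)
    then show "(1 - y) * (1 - y) = 1 - t"
      by (simp add: algebra_simps)
    have "star (1 :: 'a) = 1"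
      by (metis mult.right_neutral star_mult star_star)
    then show "star (1 - y) = 1 - y"
      using \<open>y \<in> S\<close> by (simp add: S_def star_diff)
    show "z * (1 - y) = (1 - y) * z" if "z * t = t * z" for z
      using \<open>y \<in> S\<close> that by (simp add: S_def algebra_simps)
  qed
qed


section \<open>Real polynomials of a self-adjoint element\<close>

lemma star_one [simp]: "star (1 :: 'a::unital_cstar_algebra) = 1"
  using star_mult[of "star 1" "1 :: 'a"] by simp

text \<open>Pairs a real polynomial function with its value at \<open>b\<close>. Rule induction
  follows the arithmetic of the expression, and the function side matches
  \<open>real_polynomial_function\<close>, in which the Weierstrass theorem is phrased.\<close>

inductive poly_calc :: "'a::unital_cstar_algebra \<Rightarrow> (real \<Rightarrow> real) \<Rightarrow> 'a \<Rightarrow> bool" for b where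
  const: "poly_calc b (\<lambda>_. r) (r *\<^sub>R 1)"
| id: "poly_calc b (\<lambda>t. t) b"
| add: "poly_calc b f x \<Longrightarrow> poly_calc b g y \<Longrightarrow> poly_calc b (\<lambda>t. f t + g t) (x + y)"
| mult: "poly_calc b f x \<Longrightarrow> poly_calc b g y \<Longrightarrow> poly_calc b (\<lambda>t. f t * g t) (x * y)"

lemma poly_calc_scale:
  assumes "poly_calc b f x"
  shows "poly_calc b (\<lambda>t. r * f t) (r *\<^sub>R x)"
  using poly_calc.mult[OF poly_calc.const assms, of r] by simp

lemma poly_calc_diff:
  assumes "poly_calc b f x" "poly_calc b g y"
  shows "poly_calc b (\<lambda>t. f t - g t) (x - y)"
  using poly_calc.add[OF assms(1) poly_calc_scale[OF assms(2), of "- 1"]] by simp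

lemma real_polynomial_function_imp_poly_calc:
  "real_polynomial_function f \<Longrightarrow> \<exists>x. poly_calc b f x"
proof (induction rule: real_polynomial_function.induct)
  case (linear f)
  have "f t = f 1 * t" for t
    using linear_scale[OF bounded_linear.linear[OF linear], of t 1] by simp
  then obtain c where "f = (\<lambda>t. c * t)"
    by blast
  then show ?case
    using poly_calc_scale[OF poly_calc.id] by blast
next
  case (const c)
  show ?case
    using poly_calc.const by (rule exI)
next
  case (add f g)
  then obtain x y where "poly_calc b f x" "poly_calc b g y"
    by blast
  then show ?case
    using poly_calc.add by (intro exI)
next
  case (mult f g)
  then obtain x y where "poly_calc b f x" "poly_calc b g y"
    by blast
  then show ?case
    using poly_calc.mult by (intro exI)
qed

lemma poly_calc_continuous_on: "poly_calc b f x \<Longrightarrow> continuous_on S f"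
  by (induction rule: poly_calc.induct) (auto intro: continuous_intros)

text \<open>Two base elements are allowed because functions of one element must later be exchanged
  for functions of another: \<open>- (star y * y)\<close> and \<open>- (y * star y)\<close> in the
  positivity proof, \<psi>(star x * x) and \<psi>(x * star x) in the trace argument.\<close>

lemma poly_calc_intertwine:
  assumes "poly_calc b f x" and "y * b = b' * y"
  obtains x' where "poly_calc b' f x'" "y * x = x' * y"
proof -
  have "\<exists>x'. poly_calc b' f x' \<and> y * x = x' * y"
    using assms
  proof (induction rule: poly_calc.induct)
    case (const r)
    then show ?case
      by (auto intro!: exI[of _ "r *\<^sub>R 1"] poly_calc.const)
  next
    case id
    then show ?case
      by (auto intro!: poly_calc.id)
  next
    case (add f x g z)
    then obtain x' z' where "poly_calc b' f x'" "y * x = x' * y" "poly_calc b' g z'" "y * z = z' * y"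
      by blast
    then show ?case
      by (auto intro!: exI[of _ "x' + z'"] poly_calc.add simp: algebra_simps)
  next
    case (mult f x g z)
    then obtain x' z' where "poly_calc b' f x'" "y * x = x' * y" "poly_calc b' g z'" "y * z = z' * y"
      by blast
    moreover from this have "y * (x * z) = x' * z' * y"
      by (metis mult.assoc)
    ultimately show ?case
      by (auto intro!: exI[of _ "x' * z'"] poly_calc.mult)
  qed
  then show ?thesis
    using that by blast
qed

lemma poly_calc_commute:
  assumes "poly_calc b f x" and "y * b = b * y"
  shows "y * x = x * y"
  using assms
proof (induction rule: poly_calc.induct)
  case (mult f x g z)
  then show ?case
    by (metis mult.assoc)
qed (simp_all add: algebra_simps)

lemma poly_calc_star:
  assumes "poly_calc b f x" and "star b = b"
  shows "star x = x"
  using assms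
proof (induction rule: poly_calc.induct)
  case (mult f x g z)
  then have "z * x = x * z"
    by (metis poly_calc_commute)
  with mult show ?case
    by (simp add: star_mult)
qed (simp_all add: star_add star_scaleR)

text \<open>On the unit circle \<open>f (Re z)\<close> is a Laurent polynomial in \<open>z\<close>; the factor \<open>z\<^sup>d\<close> clears
  its denominator.\<close>

lemma poly_calc_unitary:
  fixes u :: "'a::unital_cstar_algebra"
  assumes u: "star u * u = 1" "u * star u = 1" and b: "b = (1 / 2 :: real) *\<^sub>R (u + star u)"
    and "poly_calc b f x"
  shows "\<exists>q d. (\<forall>z. cmod z = 1 \<longrightarrow> poly q z = z ^ d * of_real (f (Re z))) \<and> peval q u = u ^ d * x"
  using assms(4)
proof (induction rule: poly_calc.induct)
  case (const r)
  show ?case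
    by (rule exI[of _ "[:of_real r:]"], rule exI[of _ 0]) (simp add: peval_pCons scaleR_scaleC)
next
  case id
  \<comment> \<open>On the circle the conjugate of z is 1/z, so 2 z Re z = z^2 + 1; this gives the
    witness \<open>[:1 / 2, 0, 1 / 2:]\<close> with exponent 1.\<close>
  have "z * of_real (Re z) = (z * z + 1) / 2" if "cmod z = 1" for z
    using that complex_norm_square[of z]
    by (simp add: complex_eq_iff field_simps flip: power2_eq_square)
      (simp add: cmod_def power2_eq_square)
  moreover have "u * b = (1 / 2 :: real) *\<^sub>R (u * u + 1)"
    using u by (simp add: b distrib_left)
  ultimately show ?case
    by (intro exI[of _ "[:1 / 2, 0, 1 / 2:]"] exI[of _ 1])
      (simp add: peval_pCons scaleR_scaleC field_simps scaleC_add_right mult_scaleC_right)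
next
  case (add f x g y)
  then obtain p d q e where
    "\<forall>z. cmod z = 1 \<longrightarrow> poly p z = z ^ d * of_real (f (Re z))" "peval p u = u ^ d * x"
    "\<forall>z. cmod z = 1 \<longrightarrow> poly q z = z ^ e * of_real (g (Re z))" "peval q u = u ^ e * y"
    by blast
  \<comment> \<open>The monomials bring both summands to the common exponent d + e.\<close>
  moreover have "peval (monom 1 n) u = u ^ n" for n
    by (induction n) (simp_all add: monom_Suc monom_0 peval_pCons)
  moreover have "u ^ e * (u ^ d * x) = u ^ (d + e) * x" "u ^ d * (u ^ e * y) = u ^ (d + e) * y"
    by (metis add.commute mult.assoc power_add)+
  ultimately have
    "peval (monom 1 e * p + monom 1 d * q) u = u ^ (d + e) * (x + y)"
    "\<forall>z. cmod z = 1 \<longrightarrow>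
      poly (monom 1 e * p + monom 1 d * q) z = z ^ (d + e) * of_real (f (Re z) + g (Re z))"
    by (simp_all add: peval_add peval_mult poly_monom power_add distrib_left)
  then show ?case
    by blast
next
  case (mult f x g y)
  then obtain p d q e where pq:
    "\<forall>z. cmod z = 1 \<longrightarrow> poly p z = z ^ d * of_real (f (Re z))" "peval p u = u ^ d * x"
    "\<forall>z. cmod z = 1 \<longrightarrow> poly q z = z ^ e * of_real (g (Re z))" "peval q u = u ^ e * y"
    by blast
  have "u ^ e * x = x * u ^ e"
  proof (rule poly_calc_commute[OF mult.hyps(1)])
    have "u * b = b * u"
      using u by (simp add: b algebra_simps)
    then show "u ^ e * b = b * u ^ e"
      by (metis power_commuting_commutes)
  qed
  have "u ^ d * x * (u ^ e * y) = u ^ d * (x * u ^ e) * y"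
    by (simp only: mult.assoc)
  also have "\<dots> = u ^ (d + e) * (x * y)"
    by (simp only: \<open>u ^ e * x = x * u ^ e\<close>[symmetric] power_add mult.assoc)
  finally have "u ^ d * x * (u ^ e * y) = u ^ (d + e) * (x * y)" .
  with pq show ?case
    by (intro exI[of _ "p * q"] exI[of _ "d + e"]) (simp add: peval_mult power_add)
qed

text \<open>With c^2 = 1 - b^2 commuting with b, u = b + i c is unitary with real part b. Then x is
  \<open>star (u ^ d) * peval q u\<close>, and the bound for unitaries applies, f being evaluated at
  Re z in [-1,1]. The root c comes from \<open>sqrt_one_minus\<close>, which asks for norm strictly
  below 1.\<close>

lemma norm_poly_calc_le_strict:
  assumes b: "star b = b" "norm b < 1" and f: "poly_calc b f x"
    and B: "\<And>t. t \<in> {-1..1} \<Longrightarrow> \<bar>f t\<bar> \<le> B"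
  shows "norm x \<le> B"
proof -
  have "norm (b * b) < 1"
    using norm_mult_ineq[of b b] mult_strict_mono'[OF b(2) b(2)] by simp
  have "star (b * b) = b * b"
    by (simp add: star_mult b)
  then obtain c where
    c: "star c = c" "c * c = 1 - b * b" "\<And>y. y * (b * b) = b * b * y \<Longrightarrow> y * c = c * y"
    by (rule sqrt_one_minus) (use \<open>norm (b * b) < 1\<close> in blast)+
  define u where "u = b + \<i> *\<^sub>C c"
  have star_u: "star u = b - \<i> *\<^sub>C c"
    by (simp add: u_def star_add star_scaleC b(1) c(1))
  have bc: "b * c = c * b"
    by (rule c(3)) (simp add: mult.assoc)
  have "star u * u = b * b + c * c" "u * star u = b * b + c * c"
    unfolding star_u unfolding u_def
    by (simp_all add: distrib_left distrib_right left_diff_distrib right_diff_distrib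
        mult_scaleC_left mult_scaleC_right scaleC_scaleC bc scaleC_add_right scaleC_diff_right)
  then have u: "star u * u = 1" "u * star u = 1"
    unfolding c(2) by simp_all
  have "u + star u = 2 *\<^sub>R b"
    unfolding star_u unfolding u_def scaleR_2 by simp
  then have b_eq: "b = (1 / 2 :: real) *\<^sub>R (u + star u)"
    by simp
  obtain q d where q: "\<And>z. cmod z = 1 \<Longrightarrow> poly q z = z ^ d * of_real (f (Re z))"
    "peval q u = u ^ d * x"
    using poly_calc_unitary[OF u b_eq f] by blast
  have "star (u ^ d) * u ^ d = 1"
  proof (induction d)
    case (Suc d)
    have "star (u ^ Suc d) * u ^ Suc d = star (u ^ d) * (star u * u) * u ^ d"
      by (simp add: star_mult mult.assoc)
    with Suc show ?case
      by (simp add: u(1))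
  qed simp
  then have "norm x \<le> norm (star (u ^ d)) * norm (u ^ d * x)"
    using norm_mult_ineq[of "star (u ^ d)" "u ^ d * x"] by (simp flip: mult.assoc)
  also have "norm (star (u ^ d)) = 1"
    using norm_unitary[OF \<open>star (u ^ d) * u ^ d = 1\<close>] by simp
  also have "norm (u ^ d * x) \<le> B"
    unfolding q(2)[symmetric]
  proof (rule norm_peval_unitary_le[OF u])
    show "cmod (poly q z) \<le> B" if "cmod z = 1" for z
      using q(1)[OF that] B[of "Re z"] abs_Re_le_cmod[of z] that
      by (simp add: norm_mult norm_power abs_le_iff)
  qed
  finally show ?thesis
    by simp
qed

text \<open>Scaling b by r < 1 and letting r tend to 1 carries the strict norm bound over to
  contractions of norm exactly 1.\<close>

lemma poly_calc_homotopy: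
  assumes "poly_calc b f x"
  obtains g where "continuous_on UNIV g" "\<And>r. poly_calc (r *\<^sub>R b) f (g r)" "g 1 = x"
proof -
  have "\<exists>g. continuous_on UNIV g \<and> (\<forall>r :: real. poly_calc (r *\<^sub>R b) f (g r)) \<and> g 1 = x"
    using assms
  proof (induction rule: poly_calc.induct)
    case (const s)
    then show ?case
      by (intro exI[of _ "\<lambda>_. s *\<^sub>R 1"]) (auto intro: poly_calc.intros)
  next
    case id
    then show ?case
      by (intro exI[of _ "\<lambda>r. r *\<^sub>R b"]) (auto intro: poly_calc.intros continuous_intros)
  next
    case (add f x g y)
    then obtain h k where "continuous_on UNIV h" "\<And>r. poly_calc (r *\<^sub>R b) f (h r)" "h 1 = x"
      "continuous_on UNIV k" "\<And>r. poly_calc (r *\<^sub>R b) g (k r)" "k 1 = y"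
      by blast
    then show ?case
      by (intro exI[of _ "\<lambda>r. h r + k r"]) (auto intro: poly_calc.intros continuous_intros)
  next
    case (mult f x g y)
    then obtain h k where "continuous_on UNIV h" "\<And>r. poly_calc (r *\<^sub>R b) f (h r)" "h 1 = x"
      "continuous_on UNIV k" "\<And>r. poly_calc (r *\<^sub>R b) g (k r)" "k 1 = y"
      by blast
    then show ?case
      by (intro exI[of _ "\<lambda>r. h r * k r"]) (auto intro: poly_calc.intros continuous_intros)
  qed
  then show ?thesis
    using that by blast
qed

lemma norm_poly_calc_le:
  assumes b: "star b = b" "norm b \<le> 1" and f: "poly_calc b f x"
    and B: "\<And>t. t \<in> {-1..1} \<Longrightarrow> \<bar>f t\<bar> \<le> B"
  shows "norm x \<le> B"
proof -
  obtain g where g: "continuous_on UNIV g" "\<And>r. poly_calc (r *\<^sub>R b) f (g r)" "g 1 = x"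
    using poly_calc_homotopy[OF f] by blast
  have "((\<lambda>r. norm (g r)) \<longlongrightarrow> norm (g 1)) (at_left 1)"
    using g(1) by (intro tendsto_norm) (simp add: continuous_on_def filterlim_at_split)
  moreover have "\<forall>\<^sub>F r in at_left 1. norm (g r) \<le> B"
    unfolding eventually_at_left_field
  proof (intro exI[of _ 0] conjI allI impI)
    fix r :: real assume r: "0 < r" "r < 1"
    have "r * norm b \<le> r * 1"
      using r b(2) by (intro mult_left_mono) auto
    moreover have "norm (r *\<^sub>R b) = r * norm b"
      using r by simp
    ultimately have "norm (r *\<^sub>R b) < 1"
      using r by linarith
    then show "norm (g r) \<le> B"
      using norm_poly_calc_le_strict[OF _ _ g(2)[of r] B] b(1) by (simp add: star_scaleR)
  qed simp
  ultimately have "norm (g 1) \<le> B"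
    by (rule tendsto_upperbound) simp
  then show ?thesis
    by (simp add: g(3))
qed

lemma poly_calc_compose:
  assumes "poly_calc x f z" and "poly_calc b p x"
  shows "poly_calc b (\<lambda>t. f (p t)) z"
  using assms by (induction rule: poly_calc.induct) (auto intro: poly_calc.intros)

section \<open>Continuous functions of a hermitian contraction\<close>

definition hermitian_contraction :: "'a::cstar_algebra \<Rightarrow> bool" where
  "hermitian_contraction b \<longleftrightarrow> star b = b \<and> norm b \<le> 1"

text \<open>The limit of polynomial values, specified by a property that covers all approximating
  polynomials at once: a uniform estimate on [-1,1] turns into the same norm estimate. Existence for
  hermitian contractions and continuous f is established inside the proof of
  \<open>cfc_dist\<close>.\<close>

definition cfc :: "'a::unital_cstar_algebra \<Rightarrow> (real \<Rightarrow> real) \<Rightarrow> 'a" where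
  "cfc b f = (SOME x. \<forall>g y e. poly_calc b g y \<longrightarrow> (\<forall>t\<in>{-1..1}. \<bar>g t - f t\<bar> \<le> e) \<longrightarrow> norm (y - x) \<le> e)"

lemma poly_calc_approx:
  assumes "continuous_on {-1..1} f" and "0 < e"
  obtains g y where "poly_calc b g y" "\<And>t. t \<in> {-1..1} \<Longrightarrow> \<bar>g t - f t\<bar> \<le> e"
proof -
  obtain g where "real_polynomial_function g" "\<And>t. t \<in> {-1..1} \<Longrightarrow> \<bar>f t - g t\<bar> < e"
    using Stone_Weierstrass_real_polynomial_function[of "{-1..1}" f e] assms by auto
  moreover obtain y where "poly_calc b g y"
    using real_polynomial_function_imp_poly_calc calculation(1) by blast
  ultimately show ?thesis
    by (intro that[of g y]) (auto simp: abs_minus_commute intro: less_imp_le)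
qed

lemma cfc_dist:
  assumes b: "hermitian_contraction b" and f: "continuous_on {-1..1} f" and "poly_calc b g y"
    and "\<And>t. t \<in> {-1..1} \<Longrightarrow> \<bar>g t - f t\<bar> \<le> e"
  shows "norm (y - cfc b f) \<le> e"
proof -
  have "\<forall>n. \<exists>h z. poly_calc b h z \<and> (\<forall>t\<in>{-1..1}. \<bar>h t - f t\<bar> \<le> inverse (real (Suc n)))"
    using poly_calc_approx[OF f, of "inverse (real (Suc n))" b for n]
    by (metis inverse_positive_iff_positive of_nat_0_less_iff zero_less_Suc)
  then obtain h z where h: "\<And>n. poly_calc b (h n) (z n)"
    "\<And>n t. t \<in> {-1..1} \<Longrightarrow> \<bar>h n t - f t\<bar> \<le> inverse (real (Suc n))"
    by metis
  \<comment> \<open>Both polynomials are near f, so \<open>norm_poly_calc_le\<close> bounds the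
    difference of their values. For w = z m this is the Cauchy property; in the limit over n it
    becomes the property that defines \<open>cfc\<close>.\<close>
  have close: "norm (w - z n) \<le> d + inverse (real (Suc n))"
    if "poly_calc b k w" and k: "\<And>t. t \<in> {-1..1} \<Longrightarrow> \<bar>k t - f t\<bar> \<le> d" for k w d n
  proof (rule norm_poly_calc_le[OF _ _ poly_calc_diff[OF that(1) h(1)]])
    show "\<bar>k t - h n t\<bar> \<le> d + inverse (real (Suc n))" if "t \<in> {-1..1}" for t
      using k[OF that] h(2)[OF that, of n] by linarith
  qed (use b in \<open>auto simp: hermitian_contraction_def\<close>)
  have "Cauchy z"
  proof (rule CauchyI)
    fix d :: real assume "0 < d"
    obtain N where N: "inverse (real (Suc N)) < d / 2"
      using reals_Archimedean[of "d / 2"] \<open>0 < d\<close> by auto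
    have "norm (z m - z n) < d" if "N \<le> m" "N \<le> n" for m n
    proof -
      have "inverse (real (Suc m)) \<le> inverse (real (Suc N))" "inverse (real (Suc n)) \<le> inverse (real (Suc N))"
        using that by (auto intro!: le_imp_inverse_le)
      then show ?thesis
        using close[OF h(1)[of m] h(2), of n] N by linarith
    qed
    then show "\<exists>N. \<forall>m\<ge>N. \<forall>n\<ge>N. norm (z m - z n) < d"
      by blast
  qed
  then obtain x where x: "z \<longlonglongrightarrow> x"
    unfolding Cauchy_convergent_iff convergent_def by blast
  have "\<forall>g y e. poly_calc b g y \<longrightarrow> (\<forall>t\<in>{-1..1}. \<bar>g t - f t\<bar> \<le> e) \<longrightarrow> norm (y - x) \<le> e"
  proof (intro allI impI)
    fix g y e assume g: "poly_calc b g y" "\<forall>t\<in>{-1..1}. \<bar>g t - f t\<bar> \<le> e"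
    have "(\<lambda>n. e + inverse (real (Suc n))) \<longlonglongrightarrow> e + 0"
      by (intro tendsto_intros LIMSEQ_inverse_real_of_nat)
    moreover have "(\<lambda>n. norm (y - z n)) \<longlonglongrightarrow> norm (y - x)"
      by (intro tendsto_intros x)
    ultimately have "norm (y - x) \<le> e + 0"
      using close[OF g(1)] g(2) by (intro LIMSEQ_le) auto
    then show "norm (y - x) \<le> e"
      by simp
  qed
  then have "\<forall>g y e. poly_calc b g y \<longrightarrow> (\<forall>t\<in>{-1..1}. \<bar>g t - f t\<bar> \<le> e) \<longrightarrow> norm (y - cfc b f) \<le> e"
    unfolding cfc_def by (rule someI)
  then show ?thesis
    using assms(3,4) by blast
qed

lemma cfc_tendsto:
  assumes "hermitian_contraction b" "continuous_on {-1..1} f" "\<And>n. poly_calc b (g n) (y n)"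
    and "\<And>n t. t \<in> {-1..1} \<Longrightarrow> \<bar>g n t - f t\<bar> \<le> e n" and "e \<longlonglongrightarrow> 0"
  shows "y \<longlonglongrightarrow> cfc b f"
proof (rule LIM_zero_cancel, rule Lim_null_comparison[OF _ assms(5)])
  show "\<forall>\<^sub>F n in sequentially. norm (y n - cfc b f) \<le> e n"
    by (intro always_eventually allI cfc_dist[OF assms(1-3)] assms(4))
qed

lemma cfc_sequence:
  assumes "hermitian_contraction b" "continuous_on {-1..1} f"
  obtains g y where "\<And>n. poly_calc b (g n) (y n)"
    "\<And>n t. t \<in> {-1..1} \<Longrightarrow> \<bar>g n t - f t\<bar> \<le> inverse (real (Suc n))" "y \<longlonglongrightarrow> cfc b f"
proof -
  have "\<forall>n. \<exists>g y. poly_calc b g y \<and> (\<forall>t\<in>{-1..1}. \<bar>g t - f t\<bar> \<le> inverse (real (Suc n)))"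
    using poly_calc_approx[OF assms(2), of "inverse (real (Suc n))" b for n]
    by (metis inverse_positive_iff_positive of_nat_0_less_iff zero_less_Suc)
  then obtain g y where g: "\<And>n. poly_calc b (g n) (y n)"
    "\<And>n t. t \<in> {-1..1} \<Longrightarrow> \<bar>g n t - f t\<bar> \<le> inverse (real (Suc n))"
    by metis
  show ?thesis
    using cfc_tendsto[OF assms g LIMSEQ_inverse_real_of_nat] that g by blast
qed

lemma cfc_poly:
  assumes "hermitian_contraction b" "poly_calc b f x"
  shows "cfc b f = x"
proof -
  have "norm (x - cfc b f) \<le> 0"
    by (rule cfc_dist[OF assms(1) poly_calc_continuous_on[OF assms(2)] assms(2)]) simp
  then show ?thesis
    by simp
qed

lemma cfc_norm_le:
  assumes "hermitian_contraction b" "continuous_on {-1..1} f"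
    and "\<And>t. t \<in> {-1..1} \<Longrightarrow> \<bar>f t\<bar> \<le> B"
  shows "norm (cfc b f) \<le> B"
proof -
  obtain g y where g: "\<And>n. poly_calc b (g n) (y n)"
    "\<And>n t. t \<in> {-1..1} \<Longrightarrow> \<bar>g n t - f t\<bar> \<le> inverse (real (Suc n))" "y \<longlonglongrightarrow> cfc b f"
    by (rule cfc_sequence[OF assms(1,2)]) blast
  have "norm (y n) \<le> B + inverse (real (Suc n))" for n
  proof (rule norm_poly_calc_le[OF _ _ g(1)])
    show "\<bar>g n t\<bar> \<le> B + inverse (real (Suc n))" if "t \<in> {-1..1}" for t
      using g(2)[OF that, of n] assms(3)[OF that] by linarith
  qed (use assms(1) in \<open>auto simp: hermitian_contraction_def\<close>)
  moreover have "(\<lambda>n. B + inverse (real (Suc n))) \<longlonglongrightarrow> B + 0"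
    by (intro tendsto_intros LIMSEQ_inverse_real_of_nat)
  ultimately have "norm (cfc b f) \<le> B + 0"
    using tendsto_norm[OF g(3)] by (intro LIMSEQ_le) auto
  then show ?thesis
    by simp
qed

lemma cfc_cong:
  assumes "hermitian_contraction b" "continuous_on {-1..1} f" "\<And>t. t \<in> {-1..1} \<Longrightarrow> f t = g t"
  shows "cfc b f = cfc b g"
proof -
  obtain h y where h: "\<And>n. poly_calc b (h n) (y n)"
    "\<And>n t. t \<in> {-1..1} \<Longrightarrow> \<bar>h n t - f t\<bar> \<le> inverse (real (Suc n))" "y \<longlonglongrightarrow> cfc b f"
    by (rule cfc_sequence[OF assms(1,2)]) blast
  have "continuous_on {-1..1} g"
    by (rule continuous_on_eq[OF assms(2,3)])
  then have "y \<longlonglongrightarrow> cfc b g"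
    using cfc_tendsto[OF assms(1) _ h(1) _ LIMSEQ_inverse_real_of_nat] h(2) assms(3) by simp
  with h(3) show ?thesis
    by (rule LIMSEQ_unique)
qed

lemma cfc_add:
  assumes "hermitian_contraction b" "continuous_on {-1..1} f" "continuous_on {-1..1} g"
  shows "cfc b (\<lambda>t. f t + g t) = cfc b f + cfc b g"
proof -
  obtain h y where h: "\<And>n. poly_calc b (h n) (y n)"
    "\<And>n t. t \<in> {-1..1} \<Longrightarrow> \<bar>h n t - f t\<bar> \<le> inverse (real (Suc n))" "y \<longlonglongrightarrow> cfc b f"
    by (rule cfc_sequence[OF assms(1,2)]) blast
  obtain k z where k: "\<And>n. poly_calc b (k n) (z n)"
    "\<And>n t. t \<in> {-1..1} \<Longrightarrow> \<bar>k n t - g t\<bar> \<le> inverse (real (Suc n))" "z \<longlonglongrightarrow> cfc b g"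
    by (rule cfc_sequence[OF assms(1,3)]) blast
  have "(\<lambda>n. y n + z n) \<longlonglongrightarrow> cfc b (\<lambda>t. f t + g t)"
  proof (rule cfc_tendsto[OF assms(1)])
    show "\<bar>h n t + k n t - (f t + g t)\<bar> \<le> 2 * inverse (real (Suc n))" if "t \<in> {-1..1}" for n t
      using h(2)[OF that, of n] k(2)[OF that, of n] by linarith
    show "(\<lambda>n. 2 * inverse (real (Suc n))) \<longlonglongrightarrow> 0"
      using tendsto_mult_left[OF LIMSEQ_inverse_real_of_nat, of 2] by simp
  qed (intro continuous_intros assms(2,3) poly_calc.add h(1) k(1))+
  then show ?thesis
    by (rule LIMSEQ_unique[OF _ tendsto_add[OF h(3) k(3)]])
qed

lemma cfc_mult:
  assumes "hermitian_contraction b" "continuous_on {-1..1} f" "continuous_on {-1..1} g"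
  shows "cfc b (\<lambda>t. f t * g t) = cfc b f * cfc b g"
proof -
  obtain h y where h: "\<And>n. poly_calc b (h n) (y n)"
    "\<And>n t. t \<in> {-1..1} \<Longrightarrow> \<bar>h n t - f t\<bar> \<le> inverse (real (Suc n))" "y \<longlonglongrightarrow> cfc b f"
    by (rule cfc_sequence[OF assms(1,2)]) blast
  obtain k z where k: "\<And>n. poly_calc b (k n) (z n)"
    "\<And>n t. t \<in> {-1..1} \<Longrightarrow> \<bar>k n t - g t\<bar> \<le> inverse (real (Suc n))" "z \<longlonglongrightarrow> cfc b g"
    by (rule cfc_sequence[OF assms(1,3)]) blast
  have "bounded (f ` {-1..1})" "bounded (g ` {-1..1})"
    by (intro compact_imp_bounded compact_continuous_image assms compact_Icc)+
  then obtain F G where F: "\<forall>t\<in>{-1..1}. \<bar>f t\<bar> \<le> F" and G: "\<forall>t\<in>{-1..1}. \<bar>g t\<bar> \<le> G"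
    unfolding bounded_iff by auto
  have "(\<lambda>n. y n * z n) \<longlonglongrightarrow> cfc b (\<lambda>t. f t * g t)"
  proof (rule cfc_tendsto[OF assms(1)])
    fix n t assume t: "t \<in> {-1..1::real}"
    have "\<bar>h n t\<bar> \<le> F + 1"
      using h(2)[OF t, of n] F[rule_format, OF t] inverse_le_1_iff[of "real (Suc n)"] by simp
    then have "\<bar>h n t * (k n t - g t)\<bar> \<le> (F + 1) * inverse (real (Suc n))"
      unfolding abs_mult by (intro mult_mono k(2)[OF t]) auto
    moreover have "\<bar>(h n t - f t) * g t\<bar> \<le> inverse (real (Suc n)) * G"
      unfolding abs_mult by (intro mult_mono h(2)[OF t] G[rule_format, OF t]) auto
    moreover have "h n t * k n t - f t * g t = h n t * (k n t - g t) + (h n t - f t) * g t"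
      by (simp add: algebra_simps)
    moreover have "(F + 1 + G) * inverse (real (Suc n))
        = (F + 1) * inverse (real (Suc n)) + inverse (real (Suc n)) * G"
      by (simp add: algebra_simps)
    ultimately show "\<bar>h n t * k n t - f t * g t\<bar> \<le> (F + 1 + G) * inverse (real (Suc n))"
      by linarith
  next
    show "(\<lambda>n. (F + 1 + G) * inverse (real (Suc n))) \<longlonglongrightarrow> 0"
      using tendsto_mult_left[OF LIMSEQ_inverse_real_of_nat, of "F + 1 + G"] by simp
  qed (intro continuous_intros assms(2,3) poly_calc.mult h(1) k(1))+
  then show ?thesis
    by (rule LIMSEQ_unique[OF _ tendsto_mult[OF h(3) k(3)]])
qed

lemma cfc_const: "hermitian_contraction b \<Longrightarrow> cfc b (\<lambda>_. r) = r *\<^sub>R 1"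
  by (rule cfc_poly[OF _ poly_calc.const])

lemma cfc_id: "hermitian_contraction b \<Longrightarrow> cfc b (\<lambda>t. t) = b"
  by (rule cfc_poly[OF _ poly_calc.id])

lemma cfc_scale:
  assumes "hermitian_contraction b" "continuous_on {-1..1} f"
  shows "cfc b (\<lambda>t. r * f t) = r *\<^sub>R cfc b f"
  using cfc_mult[OF assms(1) _ assms(2), of "\<lambda>_. r"] by (simp add: cfc_const assms(1))

lemma cfc_diff:
  assumes "hermitian_contraction b" "continuous_on {-1..1} f" "continuous_on {-1..1} g"
  shows "cfc b (\<lambda>t. f t - g t) = cfc b f - cfc b g"
proof -
  have "continuous_on {-1..1} (\<lambda>t. - 1 * g t)"
    by (intro continuous_intros assms)
  from cfc_add[OF assms(1,2) this] cfc_scale[OF assms(1,3), of "- 1"] show ?thesis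
    by simp
qed

lemma cfc_intertwine:
  assumes "hermitian_contraction b" "hermitian_contraction b'" "continuous_on {-1..1} f"
    and "y * b = b' * y"
  shows "y * cfc b f = cfc b' f * y"
proof -
  obtain g x where g: "\<And>n. poly_calc b (g n) (x n)"
    "\<And>n t. t \<in> {-1..1} \<Longrightarrow> \<bar>g n t - f t\<bar> \<le> inverse (real (Suc n))" "x \<longlonglongrightarrow> cfc b f"
    by (rule cfc_sequence[OF assms(1,3)]) blast
  have "\<exists>x'. poly_calc b' (g n) x' \<and> y * x n = x' * y" for n
    using poly_calc_intertwine[OF g(1) assms(4)] by blast
  then obtain x' where x': "\<And>n. poly_calc b' (g n) (x' n)" "\<And>n. y * x n = x' n * y"
    by metis
  have "x' \<longlonglongrightarrow> cfc b' f"
    by (rule cfc_tendsto[OF assms(2,3) x'(1) g(2) LIMSEQ_inverse_real_of_nat])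
  then have "(\<lambda>n. y * x n) \<longlonglongrightarrow> cfc b' f * y"
    unfolding x'(2) by (intro tendsto_intros)
  moreover have "(\<lambda>n. y * x n) \<longlonglongrightarrow> y * cfc b f"
    by (intro tendsto_intros g)
  ultimately show ?thesis
    using LIMSEQ_unique by blast
qed

lemma cfc_commute:
  assumes "hermitian_contraction b" "continuous_on {-1..1} f" and "y * b = b * y"
  shows "y * cfc b f = cfc b f * y"
  by (rule cfc_intertwine[OF assms(1,1,2,3)])

lemma cfc_star:
  assumes "hermitian_contraction b" "continuous_on {-1..1} f"
  shows "star (cfc b f) = cfc b f"
proof -
  obtain g x where g: "\<And>n. poly_calc b (g n) (x n)" "x \<longlonglongrightarrow> cfc b f"
    by (rule cfc_sequence[OF assms]) blast
  have "star (x n) = x n" for n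
    using poly_calc_star[OF g(1)] assms(1) by (simp add: hermitian_contraction_def)
  then have "x \<longlonglongrightarrow> star (cfc b f)"
    using tendsto_star[OF g(2)] by simp
  then show ?thesis
    using g(2) LIMSEQ_unique by blast
qed

text \<open>The calculus depends on f on all of [-1,1]. Expressing x as p(b), for instance as b^2,
  shows that only the values of f on p([-1,1]) matter; this is how positivity enters later.\<close>

lemma cfc_compose:
  assumes b: "hermitian_contraction b" and f: "continuous_on {-1..1} f" and p: "poly_calc b p x"
    and "\<And>t. t \<in> {-1..1} \<Longrightarrow> p t \<in> {-1..1}"
  shows "hermitian_contraction x" "cfc x f = cfc b (\<lambda>t. f (p t))"
proof -
  have "\<bar>p t\<bar> \<le> 1" if "t \<in> {-1..1}" for t
    using assms(4)[OF that] by auto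
  then show x: "hermitian_contraction x"
    using b poly_calc_star[OF p] norm_poly_calc_le[OF _ _ p]
    by (auto simp: hermitian_contraction_def)
  obtain g y where g: "\<And>n. poly_calc x (g n) (y n)"
    "\<And>n t. t \<in> {-1..1} \<Longrightarrow> \<bar>g n t - f t\<bar> \<le> inverse (real (Suc n))" "y \<longlonglongrightarrow> cfc x f"
    by (rule cfc_sequence[OF x f]) blast
  have "continuous_on {-1..1} (\<lambda>t. f (p t))"
    using assms(4) by (intro continuous_on_compose2[OF f] poly_calc_continuous_on[OF p]) auto
  then have "y \<longlonglongrightarrow> cfc b (\<lambda>t. f (p t))"
    using cfc_tendsto[OF b _ poly_calc_compose[OF g(1) p] g(2)[OF assms(4)] LIMSEQ_inverse_real_of_nat]
    by blast
  then show "cfc x f = cfc b (\<lambda>t. f (p t))"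
    using g(3) LIMSEQ_unique by blast
qed

text \<open>The scalar part is a character that sends b to 0, hence f(b) to f(0). In particular f(0)
  = 0 keeps f(b) inside the original algebra.\<close>

lemma scl_cfc:
  assumes "hermitian_contraction b" "continuous_on {-1..1} f" "scl b = 0"
  shows "scl (cfc b f) = of_real (f 0)"
proof -
  obtain g x where g: "\<And>n. poly_calc b (g n) (x n)"
    "\<And>n t. t \<in> {-1..1} \<Longrightarrow> \<bar>g n t - f t\<bar> \<le> inverse (real (Suc n))" "x \<longlonglongrightarrow> cfc b f"
    by (rule cfc_sequence[OF assms(1,2)]) blast
  have scl_poly: "scl y = of_real (h 0)" if "poly_calc b h y" for h y
    using that by (induction rule: poly_calc.induct) (simp_all add: assms(3))
  have "(\<lambda>n. g n 0) \<longlonglongrightarrow> f 0"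
    by (rule LIM_zero_cancel, rule Lim_null_comparison[OF _ LIMSEQ_inverse_real_of_nat])
      (use g(2)[of 0] in auto)
  then have "(\<lambda>n. scl (x n)) \<longlonglongrightarrow> of_real (f 0)"
    unfolding scl_poly[OF g(1)] by (rule tendsto_of_real)
  moreover have "(\<lambda>n. scl (x n)) \<longlonglongrightarrow> scl (cfc b f)"
  proof -
    have "(\<lambda>n. x n - cfc b f) \<longlonglongrightarrow> 0"
      using g(3) by (rule LIM_zero)
    have "(\<lambda>n. scl (x n) - scl (cfc b f)) \<longlonglongrightarrow> 0"
    proof (rule Lim_null_comparison)
      show "(\<lambda>n. norm (x n - cfc b f)) \<longlonglongrightarrow> 0"
        by (rule tendsto_norm_zero) fact
    qed (use norm_unitization_cmp(2)[of "x n - cfc b f" for n] in simp)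
    then show ?thesis
      by (rule LIM_zero_cancel)
  qed
  ultimately show ?thesis
    by (rule LIMSEQ_unique[rotated])
qed

section \<open>Positive elements\<close>

text \<open>For self-adjoint \<open>a\<close> the condition \<open>\<parallel>s - a\<parallel> \<le> s\<close> says that the spectrum of \<open>a\<close> lies in
  \<open>[0, 2s]\<close>.\<close>

definition spectral_pos :: "'a::unital_cstar_algebra \<Rightarrow> bool" where
  "spectral_pos a \<longleftrightarrow> star a = a \<and> (\<exists>s. norm (s *\<^sub>R 1 - a) \<le> s)"

lemma spectral_pos_star: "spectral_pos a \<Longrightarrow> star a = a"
  by (simp add: spectral_pos_def)

lemma spectral_pos_0 [simp]: "spectral_pos 0"
  by (auto simp: spectral_pos_def intro!: exI[of _ 0])

text \<open>The advantage of this notion of positivity: for sums it is just the triangle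
  inequality.\<close>

lemma spectral_pos_add:
  assumes "spectral_pos a" "spectral_pos b"
  shows "spectral_pos (a + b)"
proof -
  obtain s t where "norm (s *\<^sub>R 1 - a) \<le> s" "norm (t *\<^sub>R 1 - b) \<le> t"
    using assms by (auto simp: spectral_pos_def)
  moreover have "(s + t) *\<^sub>R 1 - (a + b) = (s *\<^sub>R 1 - a) + (t *\<^sub>R 1 - b)"
    by (simp add: algebra_simps)
  ultimately have "norm ((s + t) *\<^sub>R 1 - (a + b)) \<le> s + t"
    by (metis add_mono norm_triangle_le)
  then show ?thesis
    using assms by (auto simp: spectral_pos_def star_add)
qed

lemma spectral_pos_scaleR:
  assumes "spectral_pos a" "0 \<le> r"
  shows "spectral_pos (r *\<^sub>R a)"
proof -
  obtain s where "norm (s *\<^sub>R 1 - a) \<le> s"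
    using assms by (auto simp: spectral_pos_def)
  then have "r * norm (s *\<^sub>R 1 - a) \<le> r * s"
    using assms(2) by (rule mult_left_mono)
  moreover have "(r * s) *\<^sub>R 1 - r *\<^sub>R a = r *\<^sub>R (s *\<^sub>R 1 - a)"
    by (simp add: scaleR_diff_right)
  ultimately have "norm ((r * s) *\<^sub>R 1 - r *\<^sub>R a) \<le> r * s"
    using assms(2) by simp
  then show ?thesis
    using assms by (auto simp: spectral_pos_def star_scaleR)
qed

lemma spectral_pos_diff_norm: "star a = a \<Longrightarrow> norm a \<le> s \<Longrightarrow> spectral_pos (s *\<^sub>R 1 - a)"
  by (auto simp: spectral_pos_def star_diff star_scaleR intro!: exI[of _ s])

lemma spectral_pos_square:
  fixes c :: "'a::unital_cstar_algebra"
  assumes "star c = c"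
  shows "spectral_pos (c * c)"
proof (cases "c = 0")
  case False
  define b where "b = inverse (norm c) *\<^sub>R c"
  have b: "star b = b" "norm b \<le> 1"
    using False by (simp_all add: b_def star_scaleR assms)
  \<comment> \<open>Since 0 <= 1 - t^2 <= 1 on [-1,1], the value s = 1 witnesses positivity.\<close>
  have "poly_calc b (\<lambda>t. 1 - t * t) (1 *\<^sub>R 1 - b * b)"
    by (intro poly_calc_diff poly_calc.intros)
  then have "norm (1 *\<^sub>R 1 - b * b) \<le> 1"
    by (rule norm_poly_calc_le[OF b])
      (auto simp: abs_le_iff mult_le_one abs_square_le_1 simp flip: power2_eq_square)
  then have "spectral_pos (b * b)"
    using b by (auto simp: spectral_pos_def star_mult intro!: exI[of _ 1])
  then have "spectral_pos ((norm c * norm c) *\<^sub>R (b * b))"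
    by (rule spectral_pos_scaleR) simp
  moreover have c: "c = norm c *\<^sub>R b"
    using False by (simp add: b_def)
  have "c * c = (norm c *\<^sub>R b) * (norm c *\<^sub>R b)"
    by (rule arg_cong2[OF c c])
  ultimately show ?thesis
    by simp
qed simp

lemma spectral_pos_sqrt:
  assumes "spectral_pos a"
  obtains c where "spectral_pos c" "c * c = a" "\<And>y. y * a = a * y \<Longrightarrow> y * c = c * y"
proof -
  obtain s where a: "star a = a" and s: "norm (s *\<^sub>R 1 - a) \<le> s"
    using assms by (auto simp: spectral_pos_def)
  show ?thesis
  proof (cases "s = 0")
    case True
    then show ?thesis
      using s by (intro that[of 0]) auto
  next
    case False
    then have "0 < s"
      using s norm_ge_zero[of "s *\<^sub>R 1 - a"] by linarith
    define b where "b = 1 - inverse s *\<^sub>R a"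
    have "b = inverse s *\<^sub>R (s *\<^sub>R 1 - a)"
      using \<open>0 < s\<close> by (simp add: b_def scaleR_diff_right)
    then have "norm b = inverse s * norm (s *\<^sub>R 1 - a)"
      using \<open>0 < s\<close> by simp
    also have "\<dots> \<le> inverse s * s"
      using s \<open>0 < s\<close> by (intro mult_left_mono) auto
    finally have b: "hermitian_contraction b"
      using \<open>0 < s\<close> by (simp add: hermitian_contraction_def b_def star_diff star_scaleR a)
    \<comment> \<open>As a = s (1 - b), its root is a multiple of sqrt(1 - t) at b. It is taken as
      the square of the fourth root r, because squares of self-adjoint elements are already known to
      be \<open>spectral_pos\<close>.\<close>
    define r where "r = cfc b (\<lambda>t. sqrt (sqrt (1 - t)))"
    have cont: "continuous_on {-1..1} (\<lambda>t. sqrt (sqrt (1 - t)))" "continuous_on {-1..1} (\<lambda>t. sqrt (1 - t))"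
      by (intro continuous_intros)+
    have r: "r * r = cfc b (\<lambda>t. sqrt (1 - t))"
      unfolding r_def cfc_mult[OF b cont(1) cont(1), symmetric]
      by (rule cfc_cong[OF b]) (auto intro!: continuous_intros)
    have "cfc b (\<lambda>t. sqrt (1 - t)) * cfc b (\<lambda>t. sqrt (1 - t)) = cfc b (\<lambda>t. 1 - t)"
      unfolding cfc_mult[OF b cont(2) cont(2), symmetric]
      by (rule cfc_cong[OF b]) (auto intro!: continuous_intros)
    also have "\<dots> = 1 *\<^sub>R 1 - b"
      by (rule cfc_poly[OF b]) (intro poly_calc_diff poly_calc.intros)
    finally have rrrr: "(r * r) * (r * r) = inverse s *\<^sub>R a"
      by (simp add: r b_def)
    show ?thesis
    proof (rule that[of "sqrt s *\<^sub>R (r * r)"])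
      show "spectral_pos (sqrt s *\<^sub>R (r * r))"
        using \<open>0 < s\<close>
        by (intro spectral_pos_scaleR spectral_pos_square) (simp_all add: r_def cfc_star[OF b cont(1)])
      have "sqrt s *\<^sub>R (r * r) * sqrt s *\<^sub>R (r * r) = s *\<^sub>R ((r * r) * (r * r))"
        using \<open>0 < s\<close> by simp
      then show "sqrt s *\<^sub>R (r * r) * sqrt s *\<^sub>R (r * r) = a"
        using \<open>0 < s\<close> by (simp only: rrrr) simp
      show "y * sqrt s *\<^sub>R (r * r) = sqrt s *\<^sub>R (r * r) * y" if "y * a = a * y" for y
      proof -
        have "y * b = b * y"
          using that by (simp add: b_def algebra_simps)
        then have "y * (r * r) = r * r * y"
          unfolding r by (rule cfc_commute[OF b cont(2)])
        then show ?thesis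
          by simp
      qed
    qed
  qed
qed

text \<open>Writing \<open>a = c\<^sup>2\<close> and \<open>s - a = d\<^sup>2\<close> with commuting \<open>c\<close> and \<open>d\<close>, the element \<open>c + id\<close> is
  \<open>\<surd>s\<close> times a unitary.\<close>

lemma spectral_pos_norm_le:
  fixes a :: "'a::unital_cstar_algebra"
  assumes "spectral_pos a" "spectral_pos (s *\<^sub>R 1 - a)" "0 \<le> s"
  shows "norm a \<le> s"
proof -
  obtain c where c: "spectral_pos c" "c * c = a" "\<And>y. y * a = a * y \<Longrightarrow> y * c = c * y"
    by (rule spectral_pos_sqrt[OF assms(1)]) blast
  obtain d where d: "spectral_pos d" "d * d = s *\<^sub>R 1 - a"
    "\<And>y. y * (s *\<^sub>R 1 - a) = (s *\<^sub>R 1 - a) * y \<Longrightarrow> y * d = d * y"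
    by (rule spectral_pos_sqrt[OF assms(2)]) blast
  have cd: "c * d = d * c"
    by (rule d(3)) (simp add: algebra_simps flip: c(2))
  define w where "w = c + \<i> *\<^sub>C d"
  have star_w: "star w = c - \<i> *\<^sub>C d"
    using c(1) d(1) by (simp add: w_def star_add star_scaleC spectral_pos_star)
  have "star w * w = c * c + d * d"
    unfolding star_w unfolding w_def
    by (simp add: distrib_left distrib_right left_diff_distrib right_diff_distrib
        mult_scaleC_left mult_scaleC_right scaleC_scaleC cd scaleC_add_right scaleC_diff_right)
  then have "star w * w = s *\<^sub>R 1"
    unfolding c(2) d(2) by simp
  then have "(norm w)\<^sup>2 = s"
    using assms(3) cstar_identity[of w] by simp
  have "w + star w = 2 *\<^sub>R c"
    unfolding star_w unfolding w_def scaleR_2 by simp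
  then have "2 * norm c \<le> norm w + norm (star w)"
    using norm_triangle_ineq[of w "star w"] by simp
  then have "norm c \<le> norm w"
    by simp
  then have "norm c * norm c \<le> norm w * norm w"
    by (intro mult_mono) auto
  then show ?thesis
    using norm_mult_ineq[of c c] \<open>(norm w)\<^sup>2 = s\<close> by (simp add: c(2) power2_eq_square)
qed

lemma spectral_pos_mono:
  assumes "spectral_pos a" "spectral_pos (b - a)"
  shows "norm a \<le> norm b"
proof (rule spectral_pos_norm_le[OF assms(1)])
  have "b = a + (b - a)"
    by simp
  then have "star b = b"
    using assms by (metis spectral_pos_star star_add)
  then have "spectral_pos ((norm b *\<^sub>R 1 - b) + (b - a))"
    using assms(2) by (intro spectral_pos_add spectral_pos_diff_norm) auto
  then show "spectral_pos (norm b *\<^sub>R 1 - a)"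
    by simp
qed simp

lemma square_range: "t \<in> {-1..1} \<Longrightarrow> t * t \<in> {-1..1} \<and> - 1 * (t * t) \<in> {-1..1}" for t :: real
  using abs_square_le_1[of t] zero_le_square[of t]
  by (auto simp: power2_eq_square abs_le_iff simp del: zero_le_square)

text \<open>If \<open>e = yy\<^sup>*\<close> and \<open>f = - y\<^sup>*y\<close> are both positive, then \<open>y g(f) = g(-e) y\<close> for every
  continuous \<open>g\<close>; the positive part \<open>g\<close> of the identity gives \<open>y f = 0\<close>.\<close>

lemma star_mult_eq_0_if_neg:
  fixes y :: "'a::unital_cstar_algebra"
  assumes "spectral_pos (- (star y * y))"
  shows "star y * y = 0"
proof -
  define f where "f = - (star y * y)"
  \<comment> \<open>h and k are the real and imaginary parts of y. Since
    \<open>star y * y + y * star y\<close> is 2 (h^2 + k^2), the element e = f + 2 (h^2 + k^2) is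
    positive along with f.\<close>
  define h where "h = (1 / 2 :: real) *\<^sub>R (y + star y)"
  define k where "k = (1 / 2 :: complex) *\<^sub>C \<i> *\<^sub>C (star y - y)"
  have "star h = h" "star k = k"
    by (simp_all add: h_def k_def star_add star_scaleR star_scaleC star_diff scaleC_diff_right add.commute)
  then have hk: "spectral_pos (h * h)" "spectral_pos (k * k)"
    by (simp_all add: spectral_pos_square)
  define e where "e = y * star y"
  have "h * h = (1 / 4 :: complex) *\<^sub>C ((y + star y) * (y + star y))"
    by (simp add: h_def scaleR_scaleC mult_scaleC_left mult_scaleC_right scaleC_scaleC)
  moreover have "k * k = (1 / 4 :: complex) *\<^sub>C - ((star y - y) * (star y - y))"
    by (simp add: k_def mult_scaleC_left mult_scaleC_right scaleC_scaleC)
  ultimately have "h * h + k * k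
      = (1 / 4 :: complex) *\<^sub>C ((y + star y) * (y + star y) - (star y - y) * (star y - y))"
    by (simp add: scaleC_diff_right)
  also have "(y + star y) * (y + star y) - (star y - y) * (star y - y) = 2 *\<^sub>R (e - f)"
    by (simp add: e_def f_def algebra_simps scaleR_2)
  finally have "e = f + 2 *\<^sub>R (h * h + k * k)"
    by (simp add: scaleR_scaleC scaleC_scaleC)
  then have e: "spectral_pos e"
    using assms unfolding f_def[symmetric]
    by (simp add: spectral_pos_add spectral_pos_scaleR hk)
  define M where "M = norm e + norm f + 1"
  have "0 < M"
    by (simp add: M_def add_nonneg_pos)
  \<comment> \<open>\<open>cfc\<close> sees the sign of e/M and f/M only once they are written as
    squares of hermitian contractions; the roots prepare \<open>cfc_compose\<close>.\<close>
  have root: "\<exists>c. hermitian_contraction c \<and> inverse M *\<^sub>R x = c * c"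
    if x: "spectral_pos x" and "norm x \<le> M" for x
  proof -
    obtain c where c: "spectral_pos c" "c * c = inverse M *\<^sub>R x"
      using spectral_pos_sqrt[OF spectral_pos_scaleR[OF x]] \<open>0 < M\<close>
      by (metis inverse_nonnegative_iff_nonnegative less_imp_le)
    have "(norm c)\<^sup>2 = norm (c * c)"
      using cstar_identity[of c] c(1) by (simp add: spectral_pos_star)
    also have "\<dots> \<le> 1\<^sup>2"
      using \<open>norm x \<le> M\<close> \<open>0 < M\<close> by (simp add: c(2) field_simps)
    finally have "norm c \<le> 1"
      by (rule power2_le_imp_le) simp
    then show ?thesis
      using c by (auto simp: hermitian_contraction_def spectral_pos_star intro!: exI[of _ c])
  qed
  have "norm e \<le> M" "norm f \<le> M"
    by (simp_all add: M_def)
  then obtain c d where c: "hermitian_contraction c" "inverse M *\<^sub>R e = c * c"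
    and d: "hermitian_contraction d" "inverse M *\<^sub>R f = d * d"
    using root[OF e] root[of f] assms by (auto simp: f_def)
  let ?g = "\<lambda>t :: real. max 0 t"
  have g: "continuous_on S ?g" for S
    by (intro continuous_intros)
  have pd: "poly_calc d (\<lambda>t. t * t) (inverse M *\<^sub>R f)"
    unfolding d(2) by (intro poly_calc.intros)
  have pc: "poly_calc c (\<lambda>t. - 1 * (t * t)) (- (inverse M *\<^sub>R e))"
    using poly_calc_scale[OF poly_calc.mult[OF poly_calc.id poly_calc.id], of c "- 1"]
    by (simp add: c(2))
  have fc: "hermitian_contraction (inverse M *\<^sub>R f)"
    "cfc (inverse M *\<^sub>R f) ?g = cfc d (\<lambda>t. max 0 (t * t))"
    by (intro cfc_compose[OF d(1) g pd]; use square_range in blast)+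
  have ec: "hermitian_contraction (- (inverse M *\<^sub>R e))"
    "cfc (- (inverse M *\<^sub>R e)) ?g = cfc c (\<lambda>t. max 0 (- 1 * (t * t)))"
    by (intro cfc_compose[OF c(1) g pc]; use square_range in blast)+
  have "y * (inverse M *\<^sub>R f) = - (inverse M *\<^sub>R e) * y"
    by (simp add: e_def f_def mult.assoc)
  then have "y * cfc (inverse M *\<^sub>R f) ?g = cfc (- (inverse M *\<^sub>R e)) ?g * y"
    by (rule cfc_intertwine[OF fc(1) ec(1) g])
  moreover have "cfc (inverse M *\<^sub>R f) ?g = inverse M *\<^sub>R f"
    unfolding fc(2) by (rule cfc_poly[OF d(1)]) (use pd in \<open>simp add: max_def\<close>)
  moreover have "cfc (- (inverse M *\<^sub>R e)) ?g = 0"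
  proof -
    have "(\<lambda>t :: real. max 0 (- 1 * (t * t))) = (\<lambda>_. 0)"
      by (rule ext) (simp add: max_absorb1)
    then show ?thesis
      unfolding ec(2) using cfc_const[OF c(1), of 0] by simp
  qed
  ultimately have "y * f = 0"
    using \<open>0 < M\<close> by simp
  then have "star f * f = 0"
    by (simp add: f_def star_mult mult.assoc)
  then show ?thesis
    using cstar_identity[of f] by (simp add: f_def)
qed

text \<open>n and p are the negative and positive parts of a, with m = |a|. For y = x n,
  \<open>star y * y\<close> is - n^3, which is minus a square because n commutes with the root r of
  m. Hence it vanishes by \<open>star_mult_eq_0_if_neg\<close>, and n = 0.\<close>

lemma spectral_pos_star_mult:
  fixes x :: "'a::unital_cstar_algebra"
  shows "spectral_pos (star x * x)"
proof -
  define a where "a = star x * x"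
  have a: "star a = a"
    by (simp add: a_def star_mult)
  obtain m where m: "spectral_pos m" "m * m = a * a" "\<And>y. y * (a * a) = a * a * y \<Longrightarrow> y * m = m * y"
    by (rule spectral_pos_sqrt[OF spectral_pos_square[OF a]]) blast
  have am: "a * m = m * a"
    by (rule m(3)) (simp add: mult.assoc)
  define n where "n = (1 / 2 :: real) *\<^sub>R (m - a)"
  define p where "p = (1 / 2 :: real) *\<^sub>R (m + a)"
  have n: "star n = n"
    using m(1) a by (simp add: n_def star_scaleR star_diff spectral_pos_star)
  have "p * n = 0"
    by (simp add: n_def p_def algebra_simps am m(2))
  have "a = p - n" "m = p + n"
    by (simp_all add: n_def p_def flip: scaleR_add_right scaleR_diff_right add: scaleR_2[symmetric])
  then have an: "a * n = - (n * n)" and mn: "m * n = n * n"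
    using \<open>p * n = 0\<close> by (simp_all add: left_diff_distrib distrib_right)
  define y where "y = x * n"
  have "star y * y = n * (a * n)"
    by (simp add: y_def star_mult n a_def mult.assoc)
  then have yy: "star y * y = - (n * (m * n))"
    by (simp add: an mn)
  obtain r where r: "spectral_pos r" "r * r = m" "\<And>y. y * m = m * y \<Longrightarrow> y * r = r * y"
    by (rule spectral_pos_sqrt[OF m(1)]) blast
  have "n * m = m * n"
    by (simp add: n_def algebra_simps am)
  then have nr: "n * r = r * n"
    by (rule r(3))
  have "n * (m * n) = (n * r) * (r * n)"
    by (simp add: mult.assoc flip: r(2))
  also have "\<dots> = (r * n) * (r * n)"
    by (simp add: nr)
  finally have nmn: "n * (m * n) = (r * n) * (r * n)" .
  have "star (r * n) = r * n"
    using r(1) n nr by (simp add: star_mult spectral_pos_star)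
  then have "spectral_pos (- (star y * y))"
    unfolding yy nmn minus_minus by (rule spectral_pos_square)
  then have "n * (m * n) = 0"
    using star_mult_eq_0_if_neg yy by fastforce
  then have "star (n * n) * (n * n) = 0"
    by (simp add: mn star_mult n mult.assoc)
  then have "star n * n = 0"
    using cstar_identity[of "n * n"] by (simp add: n)
  then have "n = 0"
    using cstar_identity[of n] by simp
  then show ?thesis
    using m(1) by (simp add: n_def flip: a_def)
qed

lemma spectral_pos_conj:
  fixes a :: "'a::unital_cstar_algebra"
  assumes "spectral_pos a"
  shows "spectral_pos (star y * a * y)"
proof -
  obtain c where c: "spectral_pos c" "c * c = a"
    by (rule spectral_pos_sqrt[OF assms]) blast
  have "star y * a * y = star (c * y) * (c * y)"
    using c by (simp add: star_mult spectral_pos_star mult.assoc flip: c(2))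
  then show ?thesis
    by (simp add: spectral_pos_star_mult)
qed

text \<open>The scalar part of the root of \<open>unit_embed a\<close> has square 0, so the root
  already lies in the original algebra.\<close>

lemma positive_element_iff: "positive_element a \<longleftrightarrow> spectral_pos (unit_embed a)"
proof
  assume "positive_element a"
  then show "spectral_pos (unit_embed a)"
    by (auto simp: positive_element_def unit_embed_hom spectral_pos_star_mult)
next
  assume "spectral_pos (unit_embed a)"
  then obtain c where c: "spectral_pos c" "c * c = unit_embed a"
    by (rule spectral_pos_sqrt) blast
  have "scl c * scl c = 0"
    by (metis c(2) unit_embed_sels(2) unitization_sels(12))
  then have "a = star (elt c) * elt c"
    using c
    by (metis mult_eq_0_iff spectral_pos_star unit_embed_elt unit_embed_hom(5,6) unit_embed_inject)
  then show "positive_element a"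
    unfolding positive_element_def ..
qed

lemma positive_element_star_mult: "positive_element (star x * x)"
  by (auto simp: positive_element_def)

lemma positive_element_star: "positive_element a \<Longrightarrow> star a = (a :: 'a::cstar_algebra)"
  by (auto simp: positive_element_def star_mult)

lemma positive_element_add:
  "positive_element a \<Longrightarrow> positive_element b \<Longrightarrow> positive_element (a + b :: 'a::cstar_algebra)"
  by (simp add: positive_element_iff unit_embed_hom spectral_pos_add)

lemma positive_element_0 [simp]: "positive_element (0 :: 'a::cstar_algebra)"
  by (simp add: positive_element_iff unit_embed_hom)

lemma positive_element_sum:
  "(\<And>i. i \<in> I \<Longrightarrow> positive_element (f i)) \<Longrightarrow> positive_element (\<Sum>i\<in>I. f i :: 'a::cstar_algebra)"
  by (induction I rule: infinite_finite_induct) (simp_all add: positive_element_add)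

lemma positive_element_sqrt:
  fixes a :: "'a::cstar_algebra"
  assumes "positive_element a"
  obtains c where "positive_element c" "c * c = a" "\<And>y. y * a = a * y \<Longrightarrow> y * c = c * y"
proof -
  obtain c where c: "spectral_pos c" "c * c = unit_embed a"
    "\<And>y. y * unit_embed a = unit_embed a * y \<Longrightarrow> y * c = c * y"
    by (rule spectral_pos_sqrt[OF assms[unfolded positive_element_iff]]) blast
  have "scl c * scl c = 0"
    by (metis c(2) unit_embed_sels(2) unitization_sels(12))
  then have embed: "unit_embed (elt c) = c"
    by (simp add: unit_embed_elt)
  show ?thesis
  proof (rule that[of "elt c"])
    show "positive_element (elt c)"
      by (simp add: positive_element_iff embed c(1))
    show "elt c * elt c = a"
      by (metis c(2) embed unit_embed_hom(5) unit_embed_inject)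
    show "y * elt c = elt c * y" if "y * a = a * y" for y
      using c(3)[of "unit_embed y"] that by (metis embed unit_embed_hom(5) unit_embed_inject)
  qed
qed

lemma norm_positive_mono:
  fixes a b :: "'a::cstar_algebra"
  assumes "positive_element a" "positive_element (b - a)"
  shows "norm a \<le> norm b"
  using spectral_pos_mono[of "unit_embed a" "unit_embed b"] assms
  by (simp add: positive_element_iff unit_embed_hom)

lemma sum_star_mult_eq_0:
  fixes w :: "'i \<Rightarrow> 'a::cstar_algebra"
  assumes "finite I" "(\<Sum>i\<in>I. star (w i) * w i) = 0" "k \<in> I"
  shows "w k = 0"
proof -
  have "0 - star (w k) * w k = (\<Sum>i\<in>I - {k}. star (w i) * w i)"
    using assms by (simp add: sum.remove[of I k] eq_neg_iff_add_eq_0 minus_equation_iff)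
      (metis add.commute add_eq_0_iff)
  then have "positive_element (0 - star (w k) * w k)"
    by (simp only: positive_element_sum positive_element_star_mult)
  then have "norm (star (w k) * w k) \<le> norm (0 :: 'a)"
    by (intro norm_positive_mono positive_element_star_mult)
  then show ?thesis
    by (simp add: cstar_identity)
qed

text \<open>Conjugation of 1 - a by c, carried out in the unitization.\<close>

lemma positive_element_conj_diff:
  fixes a c :: "'a::cstar_algebra"
  assumes "star a = a" "norm a \<le> 1"
  shows "positive_element (star c * c - star c * a * c)"
proof -
  have "spectral_pos (star (unit_embed c) * (1 *\<^sub>R 1 - unit_embed a) * unit_embed c)"
    using assms by (intro spectral_pos_conj spectral_pos_diff_norm) (simp_all flip: unit_embed_hom)
  then show ?thesis
    by (simp add: positive_element_iff unit_embed_hom algebra_simps)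
qed

section \<open>The Hilbert module \<open>A\<^sup>n\<close> and the matrix algebra\<close>

definition hilbert_inner :: "('n::finite \<Rightarrow> 'a::cstar_algebra) \<Rightarrow> ('n \<Rightarrow> 'a) \<Rightarrow> 'a" where
  "hilbert_inner v w = (\<Sum>i\<in>UNIV. star (v i) * w i)"

lemma hilbert_module_norm_sq: "(hilbert_module_norm v)\<^sup>2 = norm (hilbert_inner v v)"
  by (simp add: hilbert_module_norm_def hilbert_inner_def)

lemma hilbert_module_norm_nonneg [simp]: "0 \<le> hilbert_module_norm v"
  by (simp add: hilbert_module_norm_def)

lemma positive_hilbert_inner: "positive_element (hilbert_inner v v)"
  unfolding hilbert_inner_def by (intro positive_element_sum positive_element_star_mult)

lemma star_hilbert_inner: "star (hilbert_inner v w) = hilbert_inner w v"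
  by (simp add: hilbert_inner_def star_sum star_mult)

lemma hilbert_inner_scaleR_left: "hilbert_inner (\<lambda>i. r *\<^sub>R v i) w = r *\<^sub>R hilbert_inner v w"
  by (simp add: hilbert_inner_def star_scaleR scaleR_sum_right)

lemma hilbert_inner_scaleR_right: "hilbert_inner v (\<lambda>i. r *\<^sub>R w i) = r *\<^sub>R hilbert_inner v w"
  by (simp add: hilbert_inner_def scaleR_sum_right)

lemma hilbert_inner_mult_right: "hilbert_inner v (\<lambda>i. w i * c) = hilbert_inner v w * c"
  by (simp add: hilbert_inner_def sum_distrib_right mult.assoc)

lemma hilbert_inner_mult_left: "hilbert_inner (\<lambda>i. v i * c) w = star c * hilbert_inner v w"
  by (simp add: hilbert_inner_def sum_distrib_left mult.assoc star_mult)

lemma hilbert_inner_add: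
  "hilbert_inner u (\<lambda>i. v i + w i) = hilbert_inner u v + hilbert_inner u w"
  "hilbert_inner (\<lambda>i. v i + w i) u = hilbert_inner v u + hilbert_inner w u"
  by (simp_all add: hilbert_inner_def distrib_left distrib_right star_add sum.distrib)

lemma hilbert_inner_diff:
  "hilbert_inner u (\<lambda>i. v i - w i) = hilbert_inner u v - hilbert_inner u w"
  "hilbert_inner (\<lambda>i. v i - w i) u = hilbert_inner v u - hilbert_inner w u"
  by (simp_all add: hilbert_inner_def left_diff_distrib right_diff_distrib star_diff sum_subtractf)

lemma hilbert_module_norm_scaleR:
  "hilbert_module_norm (\<lambda>i. r *\<^sub>R v i) = \<bar>r\<bar> * hilbert_module_norm v"
proof -
  have "hilbert_inner (\<lambda>i. r *\<^sub>R v i) (\<lambda>i. r *\<^sub>R v i) = r\<^sup>2 *\<^sub>R hilbert_inner v v"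
    by (simp add: hilbert_inner_scaleR_left hilbert_inner_scaleR_right power2_eq_square)
  then have "(hilbert_module_norm (\<lambda>i. r *\<^sub>R v i))\<^sup>2 = (\<bar>r\<bar> * hilbert_module_norm v)\<^sup>2"
    by (simp add: hilbert_module_norm_sq power_mult_distrib)
  then show ?thesis
    by (rule power2_eq_imp_eq) simp_all
qed

text \<open>With \<open>c = \<langle>v, w\<rangle>\<close>, positivity of \<open>\<langle>w - vc, w - vc\<rangle>\<close> gives \<open>c\<^sup>*c \<le> \<langle>w, w\<rangle>\<close>.\<close>

lemma hilbert_Cauchy_Schwarz_contraction:
  assumes "hilbert_module_norm v \<le> 1"
  shows "norm (hilbert_inner v w) \<le> hilbert_module_norm w"
proof -
  define c where "c = hilbert_inner v w"
  define a where "a = hilbert_inner v v"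
  have "norm a \<le> 1"
    using power_mono[OF assms, of 2] by (simp add: a_def hilbert_module_norm_sq)
  define z where "z = (\<lambda>i. w i - v i * c)"
  have star_c: "star c = hilbert_inner w v"
    by (simp add: c_def star_hilbert_inner)
  have "hilbert_inner z z = hilbert_inner w w - star c * c - star c * c + star c * a * c"
    unfolding z_def hilbert_inner_diff hilbert_inner_mult_left hilbert_inner_mult_right
      star_c[symmetric] c_def[symmetric] a_def[symmetric]
    by (simp add: algebra_simps)
  then have "hilbert_inner w w - star c * c = hilbert_inner z z + (star c * c - star c * a * c)"
    by simp
  moreover have "positive_element (star c * c - star c * a * c)"
    by (rule positive_element_conj_diff)
      (simp_all add: a_def star_hilbert_inner \<open>norm a \<le> 1\<close>[unfolded a_def])
  ultimately have "positive_element (hilbert_inner w w - star c * c)"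
    by (simp add: positive_element_add positive_hilbert_inner)
  then have "norm (star c * c) \<le> norm (hilbert_inner w w)"
    by (intro norm_positive_mono positive_element_star_mult)
  then have "(norm c)\<^sup>2 \<le> (hilbert_module_norm w)\<^sup>2"
    by (simp add: hilbert_module_norm_sq cstar_identity)
  then show ?thesis
    unfolding c_def by (rule power2_le_imp_le) simp
qed

lemma hilbert_Cauchy_Schwarz:
  "norm (hilbert_inner v w) \<le> hilbert_module_norm v * hilbert_module_norm w"
proof (rule field_le_epsilon)
  fix e :: real assume "0 < e"
  \<comment> \<open>Dividing v by its norm plus a small d avoids a separate treatment of norm 0; d
    is chosen so that the loss is at most e.\<close>
  define d where "d = e / (hilbert_module_norm w + 1)"
  have "0 < hilbert_module_norm w + 1"
    by (simp add: add_nonneg_pos)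
  then have "0 < d" and d: "d * hilbert_module_norm w \<le> e"
    using \<open>0 < e\<close> by (simp_all add: d_def field_simps)
  define s where "s = hilbert_module_norm v + d"
  have "0 < s"
    using \<open>0 < d\<close> by (simp add: s_def add_nonneg_pos)
  have "hilbert_module_norm (\<lambda>i. inverse s *\<^sub>R v i) \<le> 1"
    using \<open>0 < s\<close> \<open>0 < d\<close> by (simp add: hilbert_module_norm_scaleR s_def field_simps)
  then have "inverse s * norm (hilbert_inner v w) \<le> hilbert_module_norm w"
    using hilbert_Cauchy_Schwarz_contraction[of "\<lambda>i. inverse s *\<^sub>R v i" w] \<open>0 < s\<close>
    by (simp add: hilbert_inner_scaleR_left)
  then have "norm (hilbert_inner v w) \<le> s * hilbert_module_norm w"
    using \<open>0 < s\<close> by (simp add: field_simps)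
  also have "\<dots> \<le> hilbert_module_norm v * hilbert_module_norm w + e"
    using d by (simp add: s_def distrib_right)
  finally show "norm (hilbert_inner v w) \<le> hilbert_module_norm v * hilbert_module_norm w + e" .
qed

lemma hilbert_module_norm_triangle:
  "hilbert_module_norm (\<lambda>i. v i + w i) \<le> hilbert_module_norm v + hilbert_module_norm w"
proof (rule power2_le_imp_le)
  have "(hilbert_module_norm (\<lambda>i. v i + w i))\<^sup>2
      = norm ((hilbert_inner v v + hilbert_inner v w) + (hilbert_inner w v + hilbert_inner w w))"
    by (simp add: hilbert_module_norm_sq hilbert_inner_add algebra_simps)
  also have "\<dots> \<le> (norm (hilbert_inner v v) + norm (hilbert_inner v w))
      + (norm (hilbert_inner w v) + norm (hilbert_inner w w))"
    by (intro order_trans[OF norm_triangle_ineq] add_mono norm_triangle_ineq)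
  also have "\<dots> \<le> (hilbert_module_norm v + hilbert_module_norm w)\<^sup>2"
    using hilbert_Cauchy_Schwarz[of v w] hilbert_Cauchy_Schwarz[of w v]
    unfolding power2_sum hilbert_module_norm_sq mult.commute[of "hilbert_module_norm w"] mult.assoc
    by linarith
  finally show "(hilbert_module_norm (\<lambda>i. v i + w i))\<^sup>2
      \<le> (hilbert_module_norm v + hilbert_module_norm w)\<^sup>2" .
qed simp

lemma norm_le_hilbert_module_norm: "norm (v i) \<le> hilbert_module_norm v"
proof (rule power2_le_imp_le)
  have "hilbert_inner v v - star (v i) * v i = (\<Sum>j\<in>UNIV - {i}. star (v j) * v j)"
    by (simp add: hilbert_inner_def sum.remove[of UNIV i])
  then have "positive_element (hilbert_inner v v - star (v i) * v i)"
    by (simp only: positive_element_sum positive_element_star_mult)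
  then have "norm (star (v i) * v i) \<le> norm (hilbert_inner v v)"
    by (intro norm_positive_mono positive_element_star_mult)
  then show "(norm (v i))\<^sup>2 \<le> (hilbert_module_norm v)\<^sup>2"
    by (simp add: hilbert_module_norm_sq cstar_identity)
qed simp

lemma hilbert_module_norm_le_sum: "hilbert_module_norm v \<le> (\<Sum>i\<in>UNIV. norm (v i))"
proof -
  have "norm (hilbert_inner v v) \<le> (\<Sum>i\<in>UNIV. (norm (v i))\<^sup>2)"
    unfolding hilbert_inner_def by (rule order_trans[OF norm_sum]) (simp add: cstar_identity)
  then have "hilbert_module_norm v \<le> L2_set (\<lambda>i. norm (v i)) UNIV"
    by (simp add: hilbert_module_norm_def L2_set_def hilbert_inner_def)
  also have "\<dots> \<le> (\<Sum>i\<in>UNIV. norm (v i))"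
    by (rule L2_set_le_sum) simp
  finally show ?thesis .
qed

section \<open>Matrices as operators on the Hilbert module\<close>

definition matrix_apply :: "('a::cstar_algebra, 'n::finite) square_matrix \<Rightarrow> ('n \<Rightarrow> 'a) \<Rightarrow> 'n \<Rightarrow> 'a" where
  "matrix_apply x v = (\<lambda>i. \<Sum>j\<in>UNIV. entry x i j * v j)"

definition entry_sum :: "('a::cstar_algebra, 'n::finite) square_matrix \<Rightarrow> real" where
  "entry_sum x = (\<Sum>i\<in>UNIV. \<Sum>j\<in>UNIV. norm (entry x i j))"

lemma matrix_norm_altdef:
  "matrix_norm x = (SUP v\<in>{v. hilbert_module_norm v \<le> 1}. hilbert_module_norm (matrix_apply x v))"
  by (simp add: matrix_norm_def matrix_apply_def)

lemma matrix_apply_le_entry_sum: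
  "hilbert_module_norm (matrix_apply x v) \<le> entry_sum x * hilbert_module_norm v"
proof -
  have "norm (matrix_apply x v i) \<le> (\<Sum>j\<in>UNIV. norm (entry x i j) * hilbert_module_norm v)" for i
    unfolding matrix_apply_def
    by (intro sum_norm_le order_trans[OF norm_mult_ineq] mult_left_mono norm_le_hilbert_module_norm) simp
  then have "(\<Sum>i\<in>UNIV. norm (matrix_apply x v i)) \<le> entry_sum x * hilbert_module_norm v"
    unfolding entry_sum_def sum_distrib_right by (rule sum_mono)
  then show ?thesis
    using hilbert_module_norm_le_sum order_trans by blast
qed

lemma entry_sum_nonneg: "0 \<le> entry_sum x"
  by (simp add: entry_sum_def sum_nonneg)

lemma hilbert_module_norm_zero [simp]: "hilbert_module_norm (\<lambda>i. 0) = 0"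
  by (simp add: hilbert_module_norm_def)

lemma matrix_norm_le:
  assumes "0 \<le> c" "\<And>v. hilbert_module_norm (matrix_apply x v) \<le> c * hilbert_module_norm v"
  shows "matrix_norm x \<le> c"
  unfolding matrix_norm_altdef
proof (rule cSUP_least)
  show "{v. hilbert_module_norm v \<le> 1} \<noteq> {}"
    by (auto intro!: exI[of _ "\<lambda>i. 0"])
  show "hilbert_module_norm (matrix_apply x v) \<le> c" if "v \<in> {v. hilbert_module_norm v \<le> 1}" for v
    using assms(2)[of v] mult_left_mono[of "hilbert_module_norm v" 1 c] that assms(1) by simp
qed

lemma matrix_apply_scaleR: "matrix_apply x (\<lambda>i. r *\<^sub>R v i) = (\<lambda>i. r *\<^sub>R matrix_apply x v i)"
  by (simp add: matrix_apply_def scaleR_sum_right)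

lemma matrix_norm_upper:
  assumes "hilbert_module_norm v \<le> 1"
  shows "hilbert_module_norm (matrix_apply x v) \<le> matrix_norm x"
  unfolding matrix_norm_altdef
proof (rule cSUP_upper)
  show "bdd_above ((\<lambda>v. hilbert_module_norm (matrix_apply x v)) ` {v. hilbert_module_norm v \<le> 1})"
  proof (rule bdd_aboveI2)
    show "hilbert_module_norm (matrix_apply x v) \<le> entry_sum x" if "v \<in> {v. hilbert_module_norm v \<le> 1}" for v
      using matrix_apply_le_entry_sum[of x v] mult_left_mono[of "hilbert_module_norm v" 1 "entry_sum x"]
        that entry_sum_nonneg[of x] by simp
  qed
qed (use assms in simp)

lemma matrix_norm_nonneg [simp]: "0 \<le> matrix_norm x"
  using matrix_norm_upper[of "\<lambda>i. 0" x] by (simp add: matrix_apply_def)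

lemma matrix_apply_le:
  "hilbert_module_norm (matrix_apply x v) \<le> matrix_norm x * hilbert_module_norm v"
proof (cases "hilbert_module_norm v = 0")
  case True
  then show ?thesis
    using matrix_apply_le_entry_sum[of x v] by simp
next
  case False
  then have "0 < hilbert_module_norm v"
    using hilbert_module_norm_nonneg[of v] by linarith
  then show ?thesis
    using matrix_norm_upper[of "\<lambda>i. inverse (hilbert_module_norm v) *\<^sub>R v i" x]
    by (simp add: matrix_apply_scaleR hilbert_module_norm_scaleR field_simps)
qed

lemma matrix_norm_le_entry_sum: "matrix_norm x \<le> entry_sum x"
  by (rule matrix_norm_le) (simp_all add: entry_sum_nonneg matrix_apply_le_entry_sum)

lemma norm_entry_le: "norm (entry x i j) \<le> matrix_norm x"
proof (cases "entry x i j = 0")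
  case False
  let ?a = "entry x i j"
  \<comment> \<open>The test vector carries \<open>star ?a\<close> in place of the j-th unit vector,
    which need not exist without a unit.\<close>
  define v where "v = (\<lambda>k. if k = j then star ?a else 0)"
  have "(hilbert_module_norm v)\<^sup>2 = (norm ?a)\<^sup>2"
    by (simp add: hilbert_module_norm_sq hilbert_inner_def v_def if_distrib cong: if_cong)
      (simp add: norm_mult_star)
  then have v: "hilbert_module_norm v = norm ?a"
    by (rule power2_eq_imp_eq) simp_all
  have "matrix_apply x v i = ?a * star ?a"
    by (simp add: matrix_apply_def v_def if_distrib cong: if_cong)
  then have "(norm ?a)\<^sup>2 \<le> hilbert_module_norm (matrix_apply x v)"
    using norm_le_hilbert_module_norm[of "matrix_apply x v" i] by (simp add: norm_mult_star)
  also have "\<dots> \<le> matrix_norm x * norm ?a"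
    using matrix_apply_le[of x v] by (simp add: v)
  finally show ?thesis
    using False by (simp add: power2_eq_square)
qed simp

lemmas entry_simps [simp] =
  zero_square_matrix.rep_eq plus_square_matrix.rep_eq minus_square_matrix.rep_eq
  uminus_square_matrix.rep_eq times_square_matrix.rep_eq scaleC_square_matrix.rep_eq
  star_square_matrix.rep_eq

lemma matrix_norm_0 [simp]: "matrix_norm 0 = 0"
  using matrix_norm_le_entry_sum[of 0] by (intro order_antisym) (simp_all add: entry_sum_def)

lemma square_matrix_eqI: "(\<And>i j. entry x i j = entry y i j) \<Longrightarrow> x = y"
  by (simp add: entry_inject[symmetric] fun_eq_iff)

lemma matrix_apply_mult: "matrix_apply (x * y) v = matrix_apply x (matrix_apply y v)"
proof
  fix i
  have "matrix_apply (x * y) v i = (\<Sum>j\<in>UNIV. \<Sum>k\<in>UNIV. entry x i k * (entry y k j * v j))"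
    by (simp add: matrix_apply_def sum_distrib_right mult.assoc)
  also have "\<dots> = (\<Sum>k\<in>UNIV. \<Sum>j\<in>UNIV. entry x i k * (entry y k j * v j))"
    by (rule sum.swap)
  also have "\<dots> = matrix_apply x (matrix_apply y v) i"
    by (simp add: matrix_apply_def sum_distrib_left)
  finally show "matrix_apply (x * y) v i = matrix_apply x (matrix_apply y v) i" .
qed

lemma hilbert_inner_matrix_apply:
  "hilbert_inner (matrix_apply x v) w = hilbert_inner v (matrix_apply (star x) w)"
proof -
  have "hilbert_inner (matrix_apply x v) w
      = (\<Sum>i\<in>UNIV. \<Sum>j\<in>UNIV. star (v j) * (star (entry x i j) * w i))"
    by (simp add: hilbert_inner_def matrix_apply_def star_sum star_mult sum_distrib_right mult.assoc)
  also have "\<dots> = (\<Sum>j\<in>UNIV. \<Sum>i\<in>UNIV. star (v j) * (star (entry x i j) * w i))"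
    by (rule sum.swap)
  finally show ?thesis
    by (simp add: hilbert_inner_def matrix_apply_def sum_distrib_left)
qed

lemma matrix_norm_scaleC_le: "matrix_norm (c *\<^sub>C x) \<le> cmod c * matrix_norm x"
proof (rule matrix_norm_le)
  fix v
  have "matrix_apply (c *\<^sub>C x) v = (\<lambda>i. c *\<^sub>C matrix_apply x v i)"
    by (simp add: matrix_apply_def scaleC_sum mult_scaleC_left)
  moreover have "hilbert_module_norm (\<lambda>i. c *\<^sub>C w i) = cmod c * hilbert_module_norm w" for w :: "'b \<Rightarrow> 'a"
  proof -
    have "hilbert_inner (\<lambda>i. c *\<^sub>C w i) (\<lambda>i. c *\<^sub>C w i) = (c * cnj c) *\<^sub>C hilbert_inner w w"
      by (simp add: hilbert_inner_def star_scaleC mult_scaleC_left mult_scaleC_right scaleC_scaleC scaleC_sum)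
    then have "(hilbert_module_norm (\<lambda>i. c *\<^sub>C w i))\<^sup>2 = (cmod c * hilbert_module_norm w)\<^sup>2"
      by (simp add: hilbert_module_norm_sq power_mult_distrib norm_scaleC norm_mult power2_eq_square[of "cmod c"])
    then show ?thesis
      by (rule power2_eq_imp_eq) simp_all
  qed
  ultimately show "hilbert_module_norm (matrix_apply (c *\<^sub>C x) v)
      \<le> cmod c * matrix_norm x * hilbert_module_norm v"
    by (simp add: mult.assoc mult_left_mono matrix_apply_le)
qed simp

lemma matrix_norm_scaleC: "matrix_norm (c *\<^sub>C x) = cmod c * matrix_norm x"
proof (cases "c = 0")
  case True
  then show ?thesis
    by simp
next
  case False
  have "inverse c *\<^sub>C c *\<^sub>C x = x"
    using False by (simp add: scaleC_scaleC)
  then have "matrix_norm x \<le> inverse (cmod c) * matrix_norm (c *\<^sub>C x)"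
    using matrix_norm_scaleC_le[of "inverse c" "c *\<^sub>C x"] by (simp add: norm_inverse)
  then show ?thesis
    using matrix_norm_scaleC_le[of c x] False by (simp add: field_simps)
qed

lemma matrix_norm_triangle: "matrix_norm (x + y) \<le> matrix_norm x + matrix_norm y"
proof (rule matrix_norm_le)
  fix v
  have "matrix_apply (x + y) v = (\<lambda>i. matrix_apply x v i + matrix_apply y v i)"
    by (simp add: matrix_apply_def distrib_right sum.distrib)
  then show "hilbert_module_norm (matrix_apply (x + y) v)
      \<le> (matrix_norm x + matrix_norm y) * hilbert_module_norm v"
    using hilbert_module_norm_triangle[of "matrix_apply x v" "matrix_apply y v"]
      matrix_apply_le[of x v] matrix_apply_le[of y v] by (simp add: distrib_right)
qed simp

lemma matrix_norm_mult: "matrix_norm (x * y) \<le> matrix_norm x * matrix_norm y"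
proof (rule matrix_norm_le)
  fix v
  have "hilbert_module_norm (matrix_apply (x * y) v)
      \<le> matrix_norm x * hilbert_module_norm (matrix_apply y v)"
    unfolding matrix_apply_mult by (rule matrix_apply_le)
  also have "\<dots> \<le> matrix_norm x * (matrix_norm y * hilbert_module_norm v)"
    by (intro mult_left_mono matrix_apply_le) simp
  finally show "hilbert_module_norm (matrix_apply (x * y) v)
      \<le> matrix_norm x * matrix_norm y * hilbert_module_norm v"
    by (simp add: mult.assoc)
qed simp

text \<open>The adjoint relation and Cauchy-Schwarz bound the squared norm of
  \<open>matrix_apply x v\<close> through the norm of \<open>star x * x\<close>;
  \<open>cstar_identity_if\<close> supplies the reverse inequality.\<close>

lemma matrix_norm_star_mult: "matrix_norm (star x * x) = (matrix_norm x)\<^sup>2"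
proof (rule cstar_identity_if[of matrix_norm "(*)" star])
  fix x :: "('a, 'b) square_matrix"
  let ?M = "matrix_norm (star x * x)"
  have "matrix_norm x \<le> sqrt ?M"
  proof (rule matrix_norm_le)
    fix v
    have "(hilbert_module_norm (matrix_apply x v))\<^sup>2
        = norm (hilbert_inner v (matrix_apply (star x * x) v))"
      by (simp add: hilbert_module_norm_sq hilbert_inner_matrix_apply matrix_apply_mult)
    also have "\<dots> \<le> hilbert_module_norm v * (?M * hilbert_module_norm v)"
      by (rule order_trans[OF hilbert_Cauchy_Schwarz]) (intro mult_left_mono matrix_apply_le, simp)
    also have "\<dots> = (sqrt ?M * hilbert_module_norm v)\<^sup>2"
      by (simp add: power_mult_distrib power2_eq_square[of "hilbert_module_norm v"])
    finally show "hilbert_module_norm (matrix_apply x v) \<le> sqrt ?M * hilbert_module_norm v"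
      by (rule power2_le_imp_le) simp
  qed simp
  then show "(matrix_norm x)\<^sup>2 \<le> ?M"
    using power_mono[of "matrix_norm x" "sqrt ?M" 2] by simp
qed (simp_all add: matrix_norm_mult)

section \<open>Matrix algebras as C*-algebras\<close>

instantiation square_matrix :: (cstar_algebra, finite) real_normed_algebra
begin

definition scaleR_square_matrix :: "real \<Rightarrow> ('a, 'b) square_matrix \<Rightarrow> ('a, 'b) square_matrix"
  where "scaleR_square_matrix r x = complex_of_real r *\<^sub>C x"
definition norm_square_matrix :: "('a, 'b) square_matrix \<Rightarrow> real"
  where "norm_square_matrix = matrix_norm"
definition sgn_square_matrix :: "('a, 'b) square_matrix \<Rightarrow> ('a, 'b) square_matrix"
  where "sgn_square_matrix x = inverse (norm x) *\<^sub>R x"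
definition dist_square_matrix :: "('a, 'b) square_matrix \<Rightarrow> ('a, 'b) square_matrix \<Rightarrow> real"
  where "dist_square_matrix x y = norm (x - y)"
definition uniformity_square_matrix :: "(('a, 'b) square_matrix \<times> ('a, 'b) square_matrix) filter"
  where "uniformity_square_matrix = (INF e\<in>{0<..}. principal {(x, y). dist x y < e})"
definition open_square_matrix :: "('a, 'b) square_matrix set \<Rightarrow> bool"
  where "open_square_matrix U = (\<forall>x\<in>U. eventually (\<lambda>(x', y). x' = x \<longrightarrow> y \<in> U) uniformity)"

instance
proof
  fix x y :: "('a, 'b) square_matrix" and r s :: real
  show "r *\<^sub>R (x + y) = r *\<^sub>R x + r *\<^sub>R y" "(r + s) *\<^sub>R x = r *\<^sub>R x + s *\<^sub>R x"
    "r *\<^sub>R s *\<^sub>R x = (r * s) *\<^sub>R x" "1 *\<^sub>R x = x" "r *\<^sub>R x * y = r *\<^sub>R (x * y)"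
    "x * r *\<^sub>R y = r *\<^sub>R (x * y)"
    by (simp_all add: scaleR_square_matrix_def scaleC_add_right scaleC_add_left scaleC_scaleC
        mult_scaleC_left mult_scaleC_right)
  show "dist x y = norm (x - y)" "sgn x = inverse (norm x) *\<^sub>R x"
    "uniformity = (INF e\<in>{0<..}. principal {(x, y :: ('a, 'b) square_matrix). dist x y < e})"
    by (simp_all add: dist_square_matrix_def sgn_square_matrix_def uniformity_square_matrix_def)
  show "open U = (\<forall>x\<in>U. eventually (\<lambda>(x', y). x' = x \<longrightarrow> y \<in> U) uniformity)"
    for U :: "('a, 'b) square_matrix set"
    by (rule open_square_matrix_def)
  show "norm x = 0 \<longleftrightarrow> x = 0"
  proof
    assume "norm x = 0"
    then show "x = 0"
      using norm_entry_le[of x] by (intro square_matrix_eqI) (simp add: norm_square_matrix_def)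
  next
    assume "x = 0"
    then show "norm x = 0"
      by (simp add: norm_square_matrix_def)
  qed
  show "norm (x + y) \<le> norm x + norm y" "norm (r *\<^sub>R x) = \<bar>r\<bar> * norm x"
    "norm (x * y) \<le> norm x * norm y"
    by (simp_all add: norm_square_matrix_def scaleR_square_matrix_def matrix_norm_triangle
        matrix_norm_scaleC matrix_norm_mult)
qed

end

lemma bounded_linear_entry:
  "bounded_linear (\<lambda>x :: ('a::cstar_algebra, 'n::finite) square_matrix. entry x i j)"
  by (rule bounded_linear_intro[of _ 1])
    (simp_all add: norm_entry_le norm_square_matrix_def scaleR_square_matrix_def scaleR_scaleC)

lemma norm_le_entry_sum: "norm x \<le> entry_sum x"
  by (simp add: norm_square_matrix_def matrix_norm_le_entry_sum)

instance square_matrix :: (cstar_algebra, finite) cstar_algebra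
proof
  fix x :: "('a, 'b) square_matrix" and c :: complex and r :: real
  show "r *\<^sub>R x = complex_of_real r *\<^sub>C x" "norm (c *\<^sub>C x) = cmod c * norm x"
    "norm (star x * x) = (norm x)\<^sup>2"
    by (simp_all add: scaleR_square_matrix_def norm_square_matrix_def matrix_norm_scaleC
        matrix_norm_star_mult)
  show "convergent X" if "Cauchy X" for X :: "nat \<Rightarrow> ('a, 'b) square_matrix"
  proof -
    have "convergent (\<lambda>n. entry (X n) i j)" for i j
      using bounded_linear.Cauchy[OF bounded_linear_entry that] by (rule Cauchy_convergent)
    then have "\<forall>i j. \<exists>l. (\<lambda>n. entry (X n) i j) \<longlonglongrightarrow> l"
      unfolding convergent_def by blast
    then obtain l where l: "\<And>i j. (\<lambda>n. entry (X n) i j) \<longlonglongrightarrow> l i j"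
      by metis
    have "(\<lambda>n. X n - Matrix l) \<longlonglongrightarrow> 0"
    proof (rule Lim_null_comparison)
      have "(\<lambda>n. \<Sum>i\<in>UNIV. \<Sum>j\<in>UNIV. norm (entry (X n) i j - l i j)) \<longlonglongrightarrow> (\<Sum>i\<in>(UNIV::'b set). \<Sum>j\<in>(UNIV::'b set). 0)"
        by (intro tendsto_sum tendsto_norm_zero LIM_zero l)
      then show "(\<lambda>n. entry_sum (X n - Matrix l)) \<longlonglongrightarrow> 0"
        by (simp add: entry_sum_def Matrix_inverse)
    qed (simp add: norm_le_entry_sum)
    then show ?thesis
      by (intro convergentI[of _ "Matrix l"]) (rule LIM_zero_cancel)
  qed
qed

section \<open>Order zero maps\<close>

text \<open>Models W f g = \<phi>(y x f(b)) \<phi>(g(b) z y'), with functions rescaled from [-1,1]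
  to [0,1]. The aim is W(t, 1) = W(1, t). The axioms are symmetric in the two arguments, so each
  one-sided fact is also available for the flipped form.\<close>

locale zero_product_form =
  fixes W :: "(real \<Rightarrow> real) \<Rightarrow> (real \<Rightarrow> real) \<Rightarrow> 'b::real_normed_vector" and K :: real
  assumes add_left: "\<And>f f' g. continuous_on {0..1} f \<Longrightarrow> continuous_on {0..1} f' \<Longrightarrow> continuous_on {0..1} g \<Longrightarrow>
      W (\<lambda>t. f t + f' t) g = W f g + W f' g"
    and add_right: "\<And>f g g'. continuous_on {0..1} f \<Longrightarrow> continuous_on {0..1} g \<Longrightarrow> continuous_on {0..1} g' \<Longrightarrow>
      W f (\<lambda>t. g t + g' t) = W f g + W f g'"
    and scale_left: "\<And>f g r. continuous_on {0..1} f \<Longrightarrow> continuous_on {0..1} g \<Longrightarrow>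
      W (\<lambda>t. r * f t) g = r *\<^sub>R W f g"
    and scale_right: "\<And>f g r. continuous_on {0..1} f \<Longrightarrow> continuous_on {0..1} g \<Longrightarrow>
      W f (\<lambda>t. r * g t) = r *\<^sub>R W f g"
    and bound: "\<And>f g. continuous_on {0..1} f \<Longrightarrow> continuous_on {0..1} g \<Longrightarrow>
      (\<And>t. t \<in> {0..1} \<Longrightarrow> \<bar>f t\<bar> \<le> 1) \<Longrightarrow> (\<And>t. t \<in> {0..1} \<Longrightarrow> \<bar>g t\<bar> \<le> 1) \<Longrightarrow> norm (W f g) \<le> K"
    and zero: "\<And>f g. continuous_on {0..1} f \<Longrightarrow> continuous_on {0..1} g \<Longrightarrow>
      (\<And>t. t \<in> {0..1} \<Longrightarrow> f t * g t = 0) \<Longrightarrow> W f g = 0"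
begin

lemma zero_product_form_flip: "zero_product_form (\<lambda>f g. W g f) K"
  by unfold_locales
    (auto intro: add_left add_right scale_left scale_right bound zero simp: mult.commute)

lemma diff_left:
  assumes "continuous_on {0..1} f" "continuous_on {0..1} f'" "continuous_on {0..1} g"
  shows "W (\<lambda>t. f t - f' t) g = W f g - W f' g"
proof -
  have "continuous_on {0..1} (\<lambda>t. - 1 * f' t)"
    by (intro continuous_intros assms)
  from add_left[OF assms(1) this assms(3)] show ?thesis
    by (simp add: scale_left[OF assms(2,3), of "- 1", simplified])
qed

lemma cong_left:
  assumes "continuous_on {0..1} f" "continuous_on {0..1} f'" "continuous_on {0..1} g"
    and "\<And>t. t \<in> {0..1} \<Longrightarrow> f t * g t = f' t * g t"
  shows "W f g = W f' g"
proof -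
  have "W (\<lambda>t. f t - f' t) g = 0"
    using assms by (intro zero continuous_intros) (auto simp: left_diff_distrib)
  then show ?thesis
    using assms by (simp add: diff_left)
qed

lemma sum_left:
  assumes "\<And>i :: nat. i < m \<Longrightarrow> continuous_on {0..1} (f i)" "continuous_on {0..1} g"
  shows "W (\<lambda>t. \<Sum>i<m. f i t) g = (\<Sum>i<m. W (f i) g)"
  using assms(1)
proof (induction m)
  case 0
  show ?case
    using scale_left[of "\<lambda>_. 0" g 0] assms(2) by simp
next
  case (Suc m)
  then have "W (\<lambda>t. (\<Sum>i<m. f i t) + f m t) g = W (\<lambda>t. \<Sum>i<m. f i t) g + W (f m) g"
    using assms(2) by (intro add_left continuous_intros) auto
  with Suc show ?case
    by simp
qed

end

section \<open>Ramps and tents\<close>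

definition ramp :: "real \<Rightarrow> real \<Rightarrow> real \<Rightarrow> real" where
  "ramp n s t = max 0 (min 1 (n * t - s))"

text \<open>For n > 0 this is the hat of height 1 at s/n with support [(s - 1)/n, (s + 1)/n];
  \<open>ramp n s\<close> climbs from 0 to 1 on [s/n, (s + 1)/n].\<close>

definition tent :: "real \<Rightarrow> real \<Rightarrow> real \<Rightarrow> real" where
  "tent n s t = ramp n (s - 1) t - ramp n s t"

lemma continuous_on_ramp [continuous_intros]: "continuous_on S (ramp n s)"
  unfolding ramp_def by (intro continuous_intros)

lemma continuous_on_tent [continuous_intros]: "continuous_on S (tent n s)"
  unfolding tent_def by (intro continuous_intros)

lemma tent_mult_eq_0: "2 \<le> \<bar>s - s'\<bar> \<Longrightarrow> tent n s t * tent n s' t = 0"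
  by (auto simp: tent_def ramp_def max_def min_def split: if_splits)

lemma tent_nonneg: "0 \<le> tent n s t"
  by (auto simp: tent_def ramp_def)

lemma sum_ramp: "(\<Sum>j<m. ramp n (real j) t) = max 0 (min (real m) (n * t))"
  by (induction m) (auto simp: ramp_def)

text \<open>Replacing the subtracted ramp at 3 i + r by the smaller ramp at 3 i + r + 2 makes the
  sum telescope.\<close>

lemma sum_tent_le: "(\<Sum>i<m. tent n (real (3 * i) + r) t) \<le> 1"
proof -
  have "(\<Sum>i<m. tent n (real (3 * i) + r) t)
      \<le> (\<Sum>i<m. ramp n (real (3 * i) + r - 1) t - ramp n (real (3 * Suc i) + r - 1) t)"
    by (rule sum_mono) (auto simp: tent_def ramp_def)
  also have "\<dots> = ramp n (real (3 * 0) + r - 1) t - ramp n (real (3 * m) + r - 1) t"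
    by (rule sum_lessThan_telescope')
  also have "\<dots> \<le> 1"
    by (simp add: ramp_def)
  finally show ?thesis .
qed

lemma sum_tripling:
  "(\<Sum>j<3 * m. h j) = (\<Sum>i<m. h (3 * i) + h (3 * i + 1) + h (3 * i + 2 :: nat) :: 'b::comm_monoid_add)"
  by (induction m) (simp_all add: add.assoc eval_nat_numeral)

context zero_product_form
begin

text \<open>Tents of the same residue class modulo 3 are orthogonal to the neighbours of all others, so
  the diagonal sum is one value of \<open>W\<close> and is bounded independently of \<open>m\<close>.\<close>

lemma norm_tent_sum_le:
  assumes "\<bar>d\<bar> \<le> 1"
  shows "norm (\<Sum>i<m. W (tent n (real (3 * i) + r + d)) (tent n (real (3 * i) + r))) \<le> K"
proof -
  let ?f = "\<lambda>i. tent n (real (3 * i) + r + d)" and ?g = "\<lambda>i. tent n (real (3 * i) + r)"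
  interpret flip: zero_product_form "\<lambda>f g. W g f" K
    by (rule zero_product_form_flip)
  have "W (\<lambda>t. \<Sum>i<m. ?f i t) (\<lambda>t. \<Sum>j<m. ?g j t) = (\<Sum>i<m. W (?f i) (\<lambda>t. \<Sum>j<m. ?g j t))"
    by (intro sum_left continuous_intros)
  also have "\<dots> = (\<Sum>i<m. \<Sum>j<m. W (?f i) (?g j))"
    by (intro sum.cong refl flip.sum_left continuous_intros)
  also have "\<dots> = (\<Sum>i<m. \<Sum>j<m. if j = i then W (?f i) (?g i) else 0)"
  proof (intro sum.cong refl)
    fix i j
    show "W (?f i) (?g j) = (if j = i then W (?f i) (?g i) else 0)"
    proof (cases "j = i")
      case False
      then have "1 \<le> \<bar>real i - real j\<bar>"
        by linarith
      \<comment> \<open>Distinct centres with spacing 3 keep distance at least 2 after a shift by d,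
        just enough for disjoint tents.\<close>
      then have "2 \<le> \<bar>(real (3 * i) + r + d) - (real (3 * j) + r)\<bar>"
        using assms by simp
      then have "W (?f i) (?g j) = 0"
        by (intro zero continuous_intros tent_mult_eq_0)
      with False show ?thesis
        by simp
    qed simp
  qed
  also have "\<dots> = (\<Sum>i<m. W (?f i) (?g i))"
    by simp
  finally have "(\<Sum>i<m. W (?f i) (?g i)) = W (\<lambda>t. \<Sum>i<m. ?f i t) (\<lambda>t. \<Sum>j<m. ?g j t)" ..
  moreover have "\<bar>\<Sum>i<m. tent n (real (3 * i) + s) t\<bar> \<le> 1" for s t
    using sum_tent_le[of n s t m] sum_nonneg[of "{..<m}" "\<lambda>i. tent n (real (3 * i) + s) t"]
    by (simp add: tent_nonneg)
  then have "norm (W (\<lambda>t. \<Sum>i<m. ?f i t) (\<lambda>t. \<Sum>j<m. ?g j t)) \<le> K"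
    by (intro bound continuous_intros) (simp_all only: add.assoc)
  ultimately show ?thesis
    by simp
qed

text \<open>Where \<open>ramp n s\<close> is nonzero, \<open>ramp n (s - 1)\<close> is 1, so the
  constant may be replaced by ramp plus tent. Where \<open>tent n s\<close> is nonzero,
  \<open>ramp n (s + 1)\<close> vanishes, so there \<open>ramp n s\<close> equals
  \<open>tent n (s + 1)\<close>. The only asymmetric contribution pairs neighbouring tents.\<close>

lemma ramp_left: "W (ramp n s) (\<lambda>_. 1) = W (ramp n s) (ramp n s) + W (tent n (s + 1)) (tent n s)"
proof -
  interpret flip: zero_product_form "\<lambda>f g. W g f" K
    by (rule zero_product_form_flip)
  have "W (ramp n s) (\<lambda>_. 1) = W (ramp n s) (ramp n (s - 1))"
    by (rule flip.cong_left) (auto intro!: continuous_intros simp: ramp_def)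
  also have "\<dots> = W (ramp n s) (\<lambda>t. ramp n s t + tent n s t)"
    by (simp add: tent_def)
  also have "\<dots> = W (ramp n s) (ramp n s) + W (ramp n s) (tent n s)"
    by (intro add_right continuous_intros)
  also have "W (ramp n s) (tent n s) = W (tent n (s + 1)) (tent n s)"
  proof (rule cong_left)
    show "ramp n s t * tent n s t = tent n (s + 1) t * tent n s t" for t
      by (auto simp: tent_def ramp_def max_def min_def)
  qed (intro continuous_intros)+
  finally show ?thesis .
qed

text \<open>With n = 3 m, n t is a sum of ramps on [0,1]. By \<open>ramp_left\<close>, n W(t, 1) and
  n W(1, t) are the same diagonal sum plus a sum over neighbouring tents, which splits into three
  residue classes of norm at most K each. Thus n times the defect D has norm at most 6 K for every
  m, and D = 0.\<close>

lemma id_commute: "W (\<lambda>t. t) (\<lambda>_. 1) = W (\<lambda>_. 1) (\<lambda>t. t)"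
proof -
  interpret flip: zero_product_form "\<lambda>f g. W g f" K
    by (rule zero_product_form_flip)
  define D where "D = W (\<lambda>t. t) (\<lambda>_. 1) - W (\<lambda>_. 1) (\<lambda>t. t)"
  have "real (3 * m) * norm D \<le> 6 * K" for m
  proof -
    define n where "n = real (3 * m)"
    have n_sum: "n * t = (\<Sum>j<3 * m. ramp n (real j) t)" if "t \<in> {0..1}" for t
      using that mult_left_mono[of t 1 n] by (simp add: sum_ramp n_def)
    have expand: "n *\<^sub>R V (\<lambda>t. t) (\<lambda>_. 1)
        = (\<Sum>j<3 * m. V (ramp n (real j)) (ramp n (real j))) + (\<Sum>j<3 * m. V (tent n (real j + 1)) (tent n (real j)))"
      if "zero_product_form V K" for V
    proof -
      interpret V: zero_product_form V K
        by fact
      have "n *\<^sub>R V (\<lambda>t. t) (\<lambda>_. 1) = V (\<lambda>t. n * t) (\<lambda>_. 1)"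
        by (intro V.scale_left[symmetric] continuous_intros)
      also have "\<dots> = V (\<lambda>t. \<Sum>j<3 * m. ramp n (real j) t) (\<lambda>_. 1)"
        by (rule V.cong_left) (auto intro!: continuous_intros simp: n_sum)
      also have "\<dots> = (\<Sum>j<3 * m. V (ramp n (real j)) (\<lambda>_. 1))"
        by (intro V.sum_left continuous_intros)
      finally show ?thesis
        by (simp add: V.ramp_left sum.distrib)
    qed
    have le: "norm (\<Sum>j<3 * m. V (tent n (real j + 1)) (tent n (real j))) \<le> 3 * K"
      if "zero_product_form V K" for V
    proof -
      interpret V: zero_product_form V K
        by fact
      have "norm (\<Sum>i<m. V (tent n (real (3 * i) + r + 1)) (tent n (real (3 * i) + r))) \<le> K" for r
        by (rule V.norm_tent_sum_le) simp
      from this[of 0] this[of 1] this[of 2] show ?thesis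
        unfolding sum_tripling sum.distrib
        by (intro order_trans[OF norm_triangle_ineq] order_trans[OF add_mono[OF norm_triangle_ineq order_refl]])
          (simp add: add.commute add.left_commute)
    qed
    have "n *\<^sub>R D = (\<Sum>j<3 * m. W (tent n (real j + 1)) (tent n (real j)))
        - (\<Sum>j<3 * m. W (tent n (real j)) (tent n (real j + 1)))"
      unfolding D_def scaleR_diff_right
      using expand[OF zero_product_form_axioms] expand[OF zero_product_form_flip] by simp
    then have "norm (n *\<^sub>R D) \<le> 3 * K + 3 * K"
      using le[OF zero_product_form_axioms] le[OF zero_product_form_flip]
      by (metis (no_types, lifting) add_mono norm_triangle_le_diff)
    then show ?thesis
      by (simp add: n_def)
  qed
  then have bounded: "real m * (3 * norm D) \<le> 6 * K" for m
    by (simp add: mult.commute mult.left_commute)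
  have "norm D = 0"
  proof (rule ccontr)
    assume "norm D \<noteq> 0"
    then have "0 < 3 * norm D"
      by simp
    then obtain m where "6 * K < real m * (3 * norm D)"
      using reals_Archimedean3 by blast
    with bounded[of m] show False
      by simp
  qed
  then show ?thesis
    by (simp add: D_def)
qed

end

section \<open>The unitization acting on its ideal; approximate units\<close>

lemma hermitian_contraction_embed: "hermitian_contraction (unit_embed b) \<longleftrightarrow> hermitian_contraction b"
  by (simp add: hermitian_contraction_def flip: unit_embed_hom)

text \<open>x f(b) lies in the original algebra although f(b) need not; \<phi> can only be applied
  to such products.\<close>

definition act_right :: "'a::cstar_algebra \<Rightarrow> 'a unitization \<Rightarrow> 'a" where
  "act_right x u = elt (unit_embed x * u)"

definition act_left :: "'a::cstar_algebra unitization \<Rightarrow> 'a \<Rightarrow> 'a" where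
  "act_left u x = elt (u * unit_embed x)"

lemma unit_embed_act [simp]:
  "unit_embed (act_right x u) = unit_embed x * u" "unit_embed (act_left u x) = u * unit_embed x"
  unfolding act_right_def act_left_def by (rule unit_embed_elt; simp)+

lemma norm_act_le:
  "norm (act_right x u) \<le> norm x * norm u" "norm (act_left u x) \<le> norm u * norm x"
  using norm_mult_ineq[of "unit_embed x" u] norm_mult_ineq[of u "unit_embed x"]
  by (simp_all flip: unit_embed_act)

lemma act_simps:
  "act_right x (u + v) = act_right x u + act_right x v"
  "act_left (u + v) x = act_left u x + act_left v x"
  "act_right x (r *\<^sub>R u) = r *\<^sub>R act_right x u" "act_left (r *\<^sub>R u) x = r *\<^sub>R act_left u x"
  "act_right x (unit_embed y) = x * y" "act_left (unit_embed y) x = y * x"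
  "act_right x 1 = x" "act_left 1 x = x"
  by (rule unit_embed_inject[THEN iffD1]; simp add: unit_embed_hom distrib_left distrib_right)+

lemma mult_act_right: "y * act_right x u = act_right (y * x) u"
  and act_left_mult: "act_left u x * y = act_left u (x * y)"
  by (rule unit_embed_inject[THEN iffD1]; simp add: unit_embed_hom mult.assoc)+

lemma act_right_act_left_eq_0:
  assumes "u * v = 0"
  shows "act_right x u * act_left v y = 0"
proof (rule unit_embed_inject[THEN iffD1])
  have "unit_embed (act_right x u * act_left v y) = unit_embed x * (u * v) * unit_embed y"
    by (simp add: unit_embed_hom mult.assoc)
  then show "unit_embed (act_right x u * act_left v y) = unit_embed 0"
    by (simp add: assms unit_embed_hom)
qed

text \<open>The y n are functions of a multiple a of \<open>star x * x\<close>, so the sequence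
  depends on x and commutes with whatever commutes with \<open>star x * x\<close>.\<close>

lemma approximate_unit:
  fixes x :: "'a::cstar_algebra"
  obtains y where "(\<lambda>n. x * y n) \<longlonglongrightarrow> x" "\<And>n. star (y n) = y n"
    "\<And>n z. z * (star x * x) = star x * x * z \<Longrightarrow> z * y n = y n * z"
proof -
  define s where "s = inverse (norm x + 1)"
  have "0 < norm x + 1"
    by (simp add: add_nonneg_pos)
  then have "0 < s" and s: "s * (norm x + 1) = 1"
    by (simp_all add: s_def)
  define x' where "x' = s *\<^sub>R x"
  have "norm x' \<le> 1"
    using s \<open>0 < s\<close> by (simp add: x'_def distrib_left)
  define a where "a = star x' * x'"
  have a_eq: "a = (s * s) *\<^sub>R (star x * x)"
    by (simp add: a_def x'_def star_scaleR)
  have "norm a \<le> 1"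
    using \<open>norm x' \<le> 1\<close> by (simp add: a_def cstar_identity power_le_one)
  then have a: "hermitian_contraction (unit_embed a)"
    unfolding hermitian_contraction_embed by (simp add: hermitian_contraction_def a_def star_mult)
  \<comment> \<open>f n vanishes at 0, which keeps y n in the original algebra, and is 1 for |t| >=
    1/(n+1); elsewhere the smallness of |t| makes t (1 - f n t)^2 small.\<close>
  define f where "f n t = min 1 (real (Suc n) * \<bar>t\<bar>)" for n t
  have f: "continuous_on S (f n)" for S n
    unfolding f_def by (intro continuous_intros)
  define F where "F n = cfc (unit_embed a) (f n)" for n
  have embed: "unit_embed (elt (F n)) = F n" for n
    by (rule unit_embed_elt) (simp add: F_def scl_cfc[OF a f] f_def)
  define y where "y n = elt (F n)" for n
  have star_F: "star (F n) = F n" for n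
    unfolding F_def by (rule cfc_star[OF a f])
  have small: "(norm (x' - x' * y n))\<^sup>2 \<le> inverse (real (Suc n))" for n
  proof -
    let ?g = "\<lambda>t. 1 - f n t"
    have g: "continuous_on S ?g" for S
      by (intro continuous_intros f)
    have one_minus: "1 - F n = cfc (unit_embed a) ?g"
      using cfc_diff[OF a _ f, of "\<lambda>_. 1"] cfc_const[OF a, of 1] by (simp add: F_def)
    have "unit_embed (x' - x' * y n) = unit_embed x' * (1 - F n)"
      by (simp add: unit_embed_hom y_def embed right_diff_distrib)
    then have "star (unit_embed (x' - x' * y n)) * unit_embed (x' - x' * y n)
        = (1 - F n) * (unit_embed a * (1 - F n))"
      by (simp add: star_mult star_diff star_F a_def unit_embed_hom mult.assoc)
    also have "\<dots> = cfc (unit_embed a) (\<lambda>t. ?g t * (t * ?g t))"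
      unfolding one_minus
      using cfc_mult[OF a g continuous_on_mult[OF continuous_on_id g]] cfc_mult[OF a continuous_on_id g]
      by (simp add: cfc_id[OF a])
    finally have "(norm (x' - x' * y n))\<^sup>2 = norm (cfc (unit_embed a) (\<lambda>t. ?g t * (t * ?g t)))"
      by (metis cstar_identity norm_unit_embed)
    also have "\<dots> \<le> inverse (real (Suc n))"
    proof (rule cfc_norm_le[OF a])
      fix t :: real
      show "\<bar>?g t * (t * ?g t)\<bar> \<le> inverse (real (Suc n))"
      proof (cases "1 \<le> real (Suc n) * \<bar>t\<bar>")
        case True
        then show ?thesis
          by (simp add: f_def)
      next
        case False
        then have "\<bar>t\<bar> \<le> inverse (real (Suc n))"
          by (simp add: field_simps)
        have "0 \<le> f n t" "f n t \<le> 1"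
          by (simp_all add: f_def)
        then have "\<bar>?g t\<bar> \<le> 1"
          by simp
        have "\<bar>?g t\<bar> * \<bar>?g t\<bar> \<le> 1"
          using mult_mono[OF \<open>\<bar>?g t\<bar> \<le> 1\<close> \<open>\<bar>?g t\<bar> \<le> 1\<close>] by simp
        then have "\<bar>t\<bar> * (\<bar>?g t\<bar> * \<bar>?g t\<bar>) \<le> \<bar>t\<bar> * 1"
          by (rule mult_left_mono) simp
        with \<open>\<bar>t\<bar> \<le> inverse (real (Suc n))\<close> show ?thesis
          by (simp only: abs_mult mult.left_commute[of "\<bar>?g t\<bar>"])
      qed
    qed (intro continuous_intros f)
    finally show ?thesis .
  qed
  have "(\<lambda>n. x' - x' * y n) \<longlonglongrightarrow> 0"
  proof (rule Lim_null_comparison)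
    show "\<forall>\<^sub>F n in sequentially. norm (x' - x' * y n) \<le> sqrt (inverse (real (Suc n)))"
      using small by (intro always_eventually allI real_le_rsqrt)
    show "(\<lambda>n. sqrt (inverse (real (Suc n)))) \<longlonglongrightarrow> 0"
      using tendsto_real_sqrt[OF LIMSEQ_inverse_real_of_nat] by simp
  qed
  then have "(\<lambda>n. inverse s *\<^sub>R (x' - x' * y n)) \<longlonglongrightarrow> inverse s *\<^sub>R 0"
    by (intro tendsto_intros)
  moreover have "inverse s *\<^sub>R (x' - x' * y n) = x - x * y n" for n
    using \<open>0 < s\<close> by (simp add: x'_def scaleR_diff_right)
  ultimately have "(\<lambda>n. x - (x - x * y n)) \<longlonglongrightarrow> x - 0"
    by (intro tendsto_intros) simp
  then have lim: "(\<lambda>n. x * y n) \<longlonglongrightarrow> x"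
    by simp
  have embed_y: "unit_embed (y n) = F n" for n
    by (simp only: y_def embed)
  have "star (y n) = y n" for n
    by (rule unit_embed_inject[THEN iffD1]) (simp add: unit_embed_hom embed_y star_F)
  moreover have "z * y n = y n * z" if "z * (star x * x) = star x * x * z" for z n
  proof -
    have "z * a = a * z"
      using that by (simp add: a_eq)
    then have "unit_embed z * unit_embed a = unit_embed a * unit_embed z"
      by (simp flip: unit_embed_hom)
    then have "unit_embed z * F n = F n * unit_embed z"
      unfolding F_def by (rule cfc_commute[OF a f])
    then have "unit_embed (z * y n) = unit_embed (y n * z)"
      by (simp only: unit_embed_hom embed_y)
    then show ?thesis
      by simp
  qed
  ultimately show ?thesis
    by (rule that[OF lim])
qed

lemma approximate_unit_left:
  fixes x :: "'a::cstar_algebra"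
  obtains y where "(\<lambda>n. y n * x) \<longlonglongrightarrow> x"
proof -
  obtain y where "(\<lambda>n. star x * y n) \<longlonglongrightarrow> star x"
    by (rule approximate_unit)
  then have "(\<lambda>n. star (star x * y n)) \<longlonglongrightarrow> star (star x)"
    by (rule tendsto_star)
  then show ?thesis
    using that by (simp add: star_mult)
qed

lemma self_adjoint_span_induct:
  fixes b :: "'a::cstar_algebra"
  assumes self_adjoint: "\<And>b. star b = b \<Longrightarrow> P b"
    and add: "\<And>b c. P b \<Longrightarrow> P c \<Longrightarrow> P (b + c)" and scale: "\<And>b c. P b \<Longrightarrow> P (c *\<^sub>C b)"
  shows "P b"
proof -
  have "P ((1 / 2) *\<^sub>C (b + star b))" "P (\<i> *\<^sub>C (1 / 2) *\<^sub>C \<i> *\<^sub>C (star b - b))"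
    by (intro scale[of "_ + _"] scale self_adjoint;
        simp add: star_add star_diff star_scaleC scaleC_diff_right add.commute)+
  then have "P ((1 / 2) *\<^sub>C (b + star b) + \<i> *\<^sub>C (1 / 2) *\<^sub>C \<i> *\<^sub>C (star b - b))"
    by (rule add)
  also have "(1 / 2) *\<^sub>C (b + star b) + \<i> *\<^sub>C (1 / 2) *\<^sub>C \<i> *\<^sub>C (star b - b)
      = ((1 / 2) *\<^sub>C b + (1 / 2) *\<^sub>C b)"
    by (simp add: scaleC_scaleC scaleC_add_right scaleC_diff_right)
  also have "\<dots> = b"
    by (simp flip: scaleC_add_left)
  finally show ?thesis .
qed

section \<open>Order zero maps and the identity that moves factors\<close>

locale cpc_order_zero =
  fixes \<phi> :: "'a::cstar_algebra \<Rightarrow> 'b::cstar_algebra"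
  assumes cp: "completely_positive \<phi>" and contr: "contractive \<phi>" and oz: "order_zero \<phi>"
begin

lemma add: "\<phi> (x + y) = \<phi> x + \<phi> y" and scaleC: "\<phi> (c *\<^sub>C x) = c *\<^sub>C \<phi> x"
  using cp by (simp_all add: completely_positive_def Vector_Spaces.linear_iff)

lemma bounded_linear: "bounded_linear \<phi>"
  using contr by (intro bounded_linear_intro[of _ 1])
    (simp_all add: add scaleC scaleR_scaleC contractive_def)

lemmas tendsto = bounded_linear.tendsto[OF bounded_linear]

text \<open>The matrix of the products \<open>star (v i) * v j\<close> is positive, being built from
  the single row v. Complete positivity then represents the images as inner products of the columns
  of w.\<close>

lemma gram:
  fixes n :: nat and v :: "nat \<Rightarrow> 'a"
  obtains w :: "nat \<Rightarrow> nat \<Rightarrow> 'b" where "\<And>i j. i < n \<Longrightarrow> j < n \<Longrightarrow> \<phi> (star (v i) * v j) = (\<Sum>k<n. star (w k i) * w k j)"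
proof -
  have "matrix_positive n (\<lambda>i j. star (v i) * v j)"
  proof (cases "n = 0")
    case False
    then have "(\<Sum>k<n. star (if k
        = 0 then v i else 0) * (if k = 0 then v j else 0)) = star (v i) * v j" for i j
      by (simp add: sum.remove[of "{..<n}" 0])
    then show ?thesis
      unfolding matrix_positive_def by (intro exI[of _ "\<lambda>k i. if k = 0 then v i else 0"]) simp
  qed (simp add: matrix_positive_def)
  then have "matrix_positive n (\<lambda>i j. \<phi> (star (v i) * v j))"
    using cp by (simp add: completely_positive_def)
  then show ?thesis
    using that unfolding matrix_positive_def by blast
qed

lemma positive: "positive_element x \<Longrightarrow> positive_element (\<phi> x)"
proof -
  assume "positive_element x"
  then obtain y where "x = star y * y"
    by (auto simp: positive_element_def)
  moreover obtain w where "\<And>i j. i < Suc 0 \<Longrightarrow> j < Suc 0 \<Longrightarrow>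
      \<phi> (star y * y) = (\<Sum>k<Suc 0. star (w k i) * w k j)"
    by (rule gram[of "Suc 0" "\<lambda>_. y"]) blast
  ultimately have "\<phi> x = star (w 0 0) * w 0 0"
    by (simp add: lessThan_Suc)
  then show ?thesis
    by (simp add: positive_element_star_mult)
qed

lemma star_mult: "star (\<phi> (star x * y)) = \<phi> (star y * x)"
proof -
  define v :: "nat \<Rightarrow> 'a" where "v i = (if i = 0 then x else y)" for i
  obtain w where w: "\<And>i j. i < 2 \<Longrightarrow> j < 2 \<Longrightarrow> \<phi> (star (v i) * v j) = (\<Sum>k<2::nat. star (w k i) * w k j)"
    by (rule gram[of 2 v]) blast
  show ?thesis
    using w[of 0 1] w[of 1 0] by (simp add: v_def star_sum complex_star_algebra_class.star_mult)
qed

text \<open>Products come first, from the hermitian 2 by 2 Gram matrix in \<open>star_mult\<close>;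
  an approximate unit removes the second factor.\<close>

lemma star: "\<phi> (star x) = star (\<phi> x)"
proof -
  obtain y where y: "(\<lambda>n. x * y n) \<longlonglongrightarrow> x"
    by (rule approximate_unit)
  have "(\<lambda>n. \<phi> (x * y n)) \<longlonglongrightarrow> \<phi> x"
    by (intro tendsto y)
  moreover have "\<phi> (x * y n) = star (\<phi> (star (x * y n)))" for n
    using star_mult[of "y n" "star x"] by (simp add: complex_star_algebra_class.star_mult)
  then have "(\<lambda>n. \<phi> (x * y n)) \<longlonglongrightarrow> star (\<phi> (star x))"
    by (auto intro!: tendsto_star tendsto y)
  ultimately have "\<phi> x = star (\<phi> (star x))"
    by (rule LIMSEQ_unique)
  then show ?thesis
    by simp
qed

text \<open>\<phi>(star x * x) and \<phi>(y x) are Gram entries of the pair x, star y. If the first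
  annihilates c, a sum of positive elements vanishes, so each \<open>w k 0 * c\<close> is 0; and
  \<phi>(y x) c is a combination of these.\<close>

lemma annihilate:
  assumes "\<phi> (star x * x) * c = 0"
  shows "\<phi> (y * x) * c = 0"
proof -
  define v :: "nat \<Rightarrow> 'a" where "v i = (if i = 0 then x else star y)" for i
  obtain w where w: "\<And>i j. i < 2 \<Longrightarrow> j < 2 \<Longrightarrow> \<phi> (star (v i) * v j) = (\<Sum>k<2::nat. star (w k i) * w k j)"
    by (rule gram[of 2 v]) blast
  have "(\<Sum>k<2. star (w k 0 * c) * (w k 0 * c)) = star c * (\<phi> (star x * x) * c)"
    using w[of 0 0]
    by (simp add: v_def sum_distrib_left sum_distrib_right complex_star_algebra_class.star_mult mult.assoc)
  then have "(\<Sum>k<2. star (w k 0 * c) * (w k 0 * c)) = 0"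
    by (simp add: assms)
  then have "w k 0 * c = 0" if "k < 2" for k
    using sum_star_mult_eq_0[of "{..<2}" "\<lambda>k. w k 0 * c" k] that by simp
  moreover have "\<phi> (y * x) * c = (\<Sum>k<2. star (w k 1) * (w k 0 * c))"
    using w[of 1 0] by (simp add: v_def sum_distrib_right mult.assoc)
  ultimately show ?thesis
    by simp
qed

lemma zero_product:
  assumes "x * z = 0"
  shows "\<phi> (y * x) * \<phi> (z * y') = 0"
proof -
  have "star x * x * (z * star z) = 0"
    by (metis assms mult.assoc mult_zero_left mult_zero_right)
  moreover have "z * star z * (star x * x) = z * star (x * z) * x"
    by (simp add: complex_star_algebra_class.star_mult mult.assoc)
  then have "z * star z * (star x * x) = 0"
    by (simp add: assms)
  ultimately have "cstar_orthogonal (star x * x) (z * star z)"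
    by (simp add: cstar_orthogonal_def complex_star_algebra_class.star_mult)
  moreover have "positive_element (star x * x)" "positive_element (z * star z)"
    using positive_element_star_mult[of x] positive_element_star_mult[of "star z"] by simp_all
  ultimately have "\<phi> (star x * x) * \<phi> (z * star z) = 0"
    using oz by (simp add: order_zero_def cstar_orthogonal_def)
  then have "\<phi> (y * x) * \<phi> (z * star z) = 0"
    by (rule annihilate)
  \<comment> \<open>Taking adjoints brings the right factor to the left, where
    \<open>annihilate\<close> applies once more.\<close>
  then have "star (\<phi> (y * x) * \<phi> (z * star z)) = 0"
    by simp
  then have "\<phi> (star (star z) * star z) * \<phi> (star (y * x)) = 0"
    by (simp add: complex_star_algebra_class.star_mult flip: star)
  then have "\<phi> (star y' * star z) * \<phi> (star (y * x)) = 0"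
    by (rule annihilate)
  then have "star (\<phi> (star y' * star z) * \<phi> (star (y * x))) = 0"
    by simp
  then show ?thesis
    by (simp add: complex_star_algebra_class.star_mult flip: star)
qed

lemma balanced_hermitian_contraction:
  assumes b: "hermitian_contraction b"
  shows "\<phi> (y * x * b) * \<phi> (z * y') = \<phi> (y * x) * \<phi> (b * z * y')"
proof -
  \<comment> \<open>The affine bijection from [-1,1], on which \<open>cfc\<close> works, to [0,1],
    on which the form W is set up.\<close>
  let ?a = "\<lambda>s :: real. (s + 1) / 2"
  define c where "c f = cfc (unit_embed b) (\<lambda>s. f (?a s))" for f
  have b': "hermitian_contraction (unit_embed b)"
    using b by (simp add: hermitian_contraction_embed)
  have cont: "continuous_on {-1..1} (\<lambda>s. f (?a s))" if "continuous_on {0..1} f" for f :: "real \<Rightarrow> real"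
    by (rule continuous_on_compose2[OF that]) (auto intro!: continuous_intros)
  define W where "W f g = \<phi> (act_right (y * x) (c f)) * \<phi> (act_left (c g) (z * y'))" for f g
  have c_add: "c (\<lambda>t. f t + g t) = c f + c g" if "continuous_on {0..1} f" "continuous_on {0..1} g" for f g
    unfolding c_def by (intro cfc_add[OF b'] cont that)
  have c_scale: "c (\<lambda>t. r * f t) = r *\<^sub>R c f" if "continuous_on {0..1} f" for f r
    unfolding c_def by (intro cfc_scale[OF b'] cont that)
  interpret \<phi>: bounded_linear \<phi>
    by (rule bounded_linear)
  interpret zero_product_form W "norm (y * x) * norm (z * y')"
  proof
    fix f f' g :: "real \<Rightarrow> real" and r :: real
    assume f: "continuous_on {0..1} f" and g: "continuous_on {0..1} g"
    show "W (\<lambda>t. r * f t) g = r *\<^sub>R W f g" "W f (\<lambda>t. r * g t) = r *\<^sub>R W f g"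
      using f g by (simp_all add: W_def c_scale act_simps \<phi>.scaleR)
    show "norm (W f g) \<le> norm (y * x) * norm (z * y')"
      if "\<And>t. t \<in> {0..1} \<Longrightarrow> \<bar>f t\<bar> \<le> 1" "\<And>t. t \<in> {0..1} \<Longrightarrow> \<bar>g t\<bar> \<le> 1"
    proof -
      have "norm (c h) \<le> 1" if "continuous_on {0..1} h" "\<And>t. t \<in> {0..1} \<Longrightarrow> \<bar>h t\<bar> \<le> 1" for h
        unfolding c_def by (intro cfc_norm_le[OF b'] cont that) auto
      then have c: "norm (c f) \<le> 1" "norm (c g) \<le> 1"
        using f g that by blast+
      have "norm (\<phi> w) \<le> norm w" for w
        using contr by (simp add: contractive_def)
      then have "norm (W f g) \<le> norm (act_right (y * x) (c f)) * norm (act_left (c g) (z * y'))"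
        unfolding W_def by (intro order_trans[OF norm_mult_ineq] mult_mono) auto
      also have "\<dots> \<le> (norm (y * x) * norm (c f)) * (norm (c g) * norm (z * y'))"
        by (intro mult_mono norm_act_le) auto
      also have "\<dots> \<le> (norm (y * x) * 1) * (1 * norm (z * y'))"
        by (intro mult_mono c) auto
      finally show ?thesis
        by simp
    qed
    show "W f g = 0" if "\<And>t. t \<in> {0..1} \<Longrightarrow> f t * g t = 0"
    proof -
      have "c f * c g = cfc (unit_embed b) (\<lambda>s. f (?a s) * g (?a s))"
        unfolding c_def by (intro cfc_mult[OF b', symmetric] cont f g)
      also have "\<dots> = cfc (unit_embed b) (\<lambda>_. 0)"
        using that by (intro cfc_cong[OF b'] continuous_intros cont f g) simp
      finally have "c f * c g = 0"
        by (simp add: cfc_const[OF b'])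
      then have "\<phi> (y * act_right x (c f)) * \<phi> (act_left (c g) z * y') = 0"
        by (intro zero_product act_right_act_left_eq_0)
      then show ?thesis
        by (simp add: W_def mult_act_right act_left_mult)
    qed
    assume f': "continuous_on {0..1} f'"
    show "W (\<lambda>t. f t + f' t) g = W f g + W f' g" "W g (\<lambda>t. f t + f' t) = W g f + W g f'"
      using f f' by (simp_all add: W_def c_add act_simps distrib_left distrib_right \<phi>.add)
  qed
  have "c (\<lambda>t. t) = (1 / 2 :: real) *\<^sub>R (unit_embed b + 1)"
    unfolding c_def
  proof (rule cfc_poly[OF b'])
    show "poly_calc (unit_embed b) ?a ((1 / 2 :: real) *\<^sub>R (unit_embed b + 1))"
      using poly_calc_scale[OF poly_calc.add[OF poly_calc.id poly_calc.const], of "unit_embed b" "1 / 2" 1]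
      by simp
  qed
  moreover have "c (\<lambda>_. 1) = 1"
    by (simp add: c_def cfc_const[OF b'])
  \<comment> \<open>\<open>id_commute\<close> concerns (b + 1)/2; the constant part contributes the
    same term to both sides and cancels.\<close>
  ultimately have "(1 / 2 :: real) *\<^sub>R (\<phi> (y * x * b) * \<phi> (z * y') + \<phi> (y * x) * \<phi> (z * y'))
      = (1 / 2 :: real) *\<^sub>R (\<phi> (y * x) * \<phi> (b * (z * y')) + \<phi> (y * x) * \<phi> (z * y'))"
    using id_commute
    by (simp add: W_def act_simps distrib_left distrib_right \<phi>.add \<phi>.scaleR)
  then show ?thesis
    by (simp add: mult.assoc)
qed

text \<open>Linearity extends the identity from hermitian contractions to all b. Approximate units
  then absorb the outer factors y and y', which were there to make \<open>zero_product\<close>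
  applicable.\<close>

lemma balanced: "\<phi> (x * b) * \<phi> z = \<phi> x * \<phi> (b * z)"
proof -
  interpret \<phi>: bounded_linear \<phi>
    by (rule bounded_linear)
  define P where "P b \<longleftrightarrow> (\<forall>x y z y'. \<phi> (y * x * b) * \<phi> (z * y') = \<phi> (y * x) * \<phi> (b * z * y'))" for b
  have "P b"
  proof (rule self_adjoint_span_induct)
    fix b :: 'a assume "star b = b"
    define r where "r = norm b + 1"
    have "0 < r"
      by (simp add: r_def add_nonneg_pos)
    have "hermitian_contraction (inverse r *\<^sub>R b)"
      using \<open>star b = b\<close> \<open>0 < r\<close>
      by (simp add: hermitian_contraction_def star_scaleR r_def field_simps)
    from balanced_hermitian_contraction[OF this] show "P b"
      using \<open>0 < r\<close> by (simp add: P_def \<phi>.scaleR)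
  qed (simp_all add: P_def \<phi>.add scaleC distrib_left distrib_right mult_scaleC_left mult_scaleC_right)
  obtain y where y: "(\<lambda>n. x * y n) \<longlonglongrightarrow> x"
    by (rule approximate_unit)
  obtain w where w: "(\<lambda>n. w n * z) \<longlonglongrightarrow> z"
    by (rule approximate_unit_left)
  have "(\<lambda>n. \<phi> (x * y n * b) * \<phi> (w n * z)) \<longlonglongrightarrow> \<phi> (x * b) * \<phi> z"
    by (intro tendsto_mult tendsto y w tendsto_const)
  moreover have "(\<lambda>n. \<phi> (x * y n) * \<phi> (b * (w n * z))) \<longlonglongrightarrow> \<phi> x * \<phi> (b * z)"
    by (intro tendsto_mult tendsto y w tendsto_const)
  moreover have "\<phi> (x * y n * b) * \<phi> (w n * z) = \<phi> (x * y n) * \<phi> (b * (w n * z))" for n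
    using \<open>P b\<close> by (simp add: P_def mult.assoc)
  ultimately show ?thesis
    using LIMSEQ_unique by simp
qed

end

section \<open>Pulling back traces\<close>

text \<open>A cut-off of |t|^(-1/2), bounded by n + 1. The absolute value serves the negative half
  of the interval on which \<open>cfc\<close> works.\<close>

definition inverse_sqrt_approx :: "nat \<Rightarrow> real \<Rightarrow> real" where
  "inverse_sqrt_approx n t = inverse (max (sqrt \<bar>t\<bar>) (inverse (real (Suc n))))"

lemma continuous_on_inverse_sqrt_approx [continuous_intros]:
  "continuous_on S (inverse_sqrt_approx n)"
proof -
  have "0 < max (sqrt \<bar>t\<bar>) (inverse (real (Suc n)))" for t
    by (simp add: less_max_iff_disj)
  then have "max (sqrt \<bar>t\<bar>) (inverse (real (Suc n))) \<noteq> 0" for t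
    by (metis less_irrefl)
  then show ?thesis
    unfolding inverse_sqrt_approx_def by (intro continuous_intros) auto
qed

lemma inverse_sqrt_approx:
  shows "0 \<le> \<bar>t\<bar> * inverse_sqrt_approx n t" "\<bar>t\<bar> * inverse_sqrt_approx n t \<le> sqrt \<bar>t\<bar>"
    and "sqrt \<bar>t\<bar> - \<bar>t\<bar> * inverse_sqrt_approx n t \<le> inverse (real (Suc n))"
proof -
  define e where "e = inverse (real (Suc n))"
  have "0 < e"
    by (simp add: e_def)
  define s where "s = sqrt \<bar>t\<bar>"
  have s: "0 \<le> s" "\<bar>t\<bar> = s * s"
    by (simp_all add: s_def)
  have eq: "\<bar>t\<bar> * inverse_sqrt_approx n t = s * s * inverse (max s e)"
    by (simp add: inverse_sqrt_approx_def e_def s_def)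
  have "0 \<le> s * s * inverse (max s e)" "s * s * inverse (max s e) \<le> s \<and> s - s * s * inverse (max s e) \<le> e"
  proof -
    show "0 \<le> s * s * inverse (max s e)"
      using s by (simp add: le_max_iff_disj)
    show "s * s * inverse (max s e) \<le> s \<and> s - s * s * inverse (max s e) \<le> e"
    proof (cases "s \<le> e")
      case True
      then have "s * (s * inverse e) \<le> s * 1"
        using s \<open>0 < e\<close> by (intro mult_left_mono) (simp_all add: field_simps)
      moreover have "0 \<le> s * (s * inverse e)"
        using s \<open>0 < e\<close> by simp
      ultimately show ?thesis
        using True by (simp add: max_absorb2 mult.assoc)
    next
      case False
      then have "0 < s"
        using \<open>0 < e\<close> by simp
      then have "s * s * inverse s = s" "max s e = s"
        using False by simp_all
      then show ?thesis
        using \<open>0 < e\<close> by (simp only: order_refl diff_self) simp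
    qed
  qed
  then show "0 \<le> \<bar>t\<bar> * inverse_sqrt_approx n t" "\<bar>t\<bar> * inverse_sqrt_approx n t \<le> sqrt \<bar>t\<bar>"
    "sqrt \<bar>t\<bar> - \<bar>t\<bar> * inverse_sqrt_approx n t \<le> inverse (real (Suc n))"
    unfolding eq by (simp_all add: e_def s_def)
qed

lemma cfc_sandwich:
  assumes b: "hermitian_contraction b" and f: "continuous_on {-1..1} f"
  shows "cfc b f * (b * b) * cfc b f = cfc b (\<lambda>t. (t * f t)\<^sup>2)"
proof -
  have "cfc b f * (b * b) * cfc b f = (cfc b f * b) * (b * cfc b f)"
    by (simp add: mult.assoc)
  also have "\<dots> = cfc b (\<lambda>t. (f t * t) * (t * f t))"
    using cfc_mult[OF b continuous_on_mult[OF f continuous_on_id] continuous_on_mult[OF continuous_on_id f]]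
      cfc_mult[OF b f continuous_on_id] cfc_mult[OF b continuous_on_id f]
    by (simp add: cfc_id[OF b])
  finally show ?thesis
    by (simp add: power2_eq_square mult.commute)
qed

text \<open>Positivity enters as b = c^2: the absolute value at b becomes |t^2| = t^2 at c.\<close>

lemma cfc_abs_eq:
  assumes "spectral_pos b" "norm b \<le> 1"
  shows "cfc b (\<lambda>t. \<bar>t\<bar>) = b"
proof -
  obtain c where c: "spectral_pos c" "c * c = b"
    by (rule spectral_pos_sqrt[OF assms(1)]) blast
  have "(norm c)\<^sup>2 \<le> 1\<^sup>2"
    using cstar_identity[of c] c assms(2) by (simp add: spectral_pos_star)
  then have "norm c \<le> 1"
    by (rule power2_le_imp_le) simp
  then have hc: "hermitian_contraction c"
    using c(1) by (simp add: hermitian_contraction_def spectral_pos_star)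
  have sq: "poly_calc c (\<lambda>t. t * t) b"
    unfolding c(2)[symmetric] by (intro poly_calc.intros)
  have "cfc b (\<lambda>t. \<bar>t\<bar>) = cfc c (\<lambda>t. \<bar>t * t\<bar>)"
    by (rule cfc_compose(2)[OF hc _ sq]) (use square_range in \<open>auto intro!: continuous_intros\<close>)
  also have "\<dots> = b"
    using cfc_poly[OF hc sq] by simp
  finally show ?thesis .
qed

text \<open>With p = |t| r_n(t) and s = sqrt |t|, p^2 - s^2 = (p - s)(p + s), where p lies within
  1/(n+1) of s and both are at most 1.\<close>

lemma sandwich_inverse_sqrt_tendsto:
  assumes "spectral_pos b" "norm b \<le> 1"
  shows "(\<lambda>n. cfc b (inverse_sqrt_approx n) * (b * b) * cfc b (inverse_sqrt_approx n)) \<longlonglongrightarrow> b"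
proof -
  have b: "hermitian_contraction b"
    using assms by (simp add: hermitian_contraction_def spectral_pos_star)
  have "norm (cfc b (\<lambda>t. (t * inverse_sqrt_approx n t)\<^sup>2) - b) \<le> 2 * inverse (real (Suc n))" for n
  proof -
    have "cfc b (\<lambda>t. (t * inverse_sqrt_approx n t)\<^sup>2) - b
        = cfc b (\<lambda>t. (t * inverse_sqrt_approx n t)\<^sup>2 - \<bar>t\<bar>)"
      by (subst cfc_diff[OF b]) (auto intro!: continuous_intros simp: cfc_abs_eq[OF assms])
    also have "norm \<dots> \<le> 2 * inverse (real (Suc n))"
    proof (rule cfc_norm_le[OF b])
      fix t :: real assume t: "t \<in> {-1..1}"
      define p where "p = \<bar>t\<bar> * inverse_sqrt_approx n t"
      define s where "s = sqrt \<bar>t\<bar>"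
      have p: "0 \<le> p" "p \<le> s" "s - p \<le> inverse (real (Suc n))" "s \<le> 1"
        using inverse_sqrt_approx[of t n] t by (auto simp: p_def s_def)
      have "(t * inverse_sqrt_approx n t)\<^sup>2 = p\<^sup>2" "\<bar>t\<bar> = s\<^sup>2"
        by (simp_all add: p_def s_def power_mult_distrib)
      then have "\<bar>(t * inverse_sqrt_approx n t)\<^sup>2 - \<bar>t\<bar>\<bar> = \<bar>(s - p) * (s + p)\<bar>"
        by (simp add: power2_eq_square algebra_simps)
      also have "\<dots> = (s - p) * (s + p)"
        using p by simp
      also have "\<dots> \<le> inverse (real (Suc n)) * 2"
        using p by (intro mult_mono) auto
      finally show "\<bar>(t * inverse_sqrt_approx n t)\<^sup>2 - \<bar>t\<bar>\<bar> \<le> 2 * inverse (real (Suc n))"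
        by simp
    qed (intro continuous_intros)
    finally show ?thesis .
  qed
  then have "(\<lambda>n. cfc b (\<lambda>t. (t * inverse_sqrt_approx n t)\<^sup>2) - b) \<longlonglongrightarrow> 0"
    by (intro Lim_null_comparison[OF always_eventually tendsto_mult_right_zero[OF LIMSEQ_inverse_real_of_nat]]) auto
  then show ?thesis
    unfolding cfc_sandwich[OF b continuous_on_inverse_sqrt_approx] by (rule LIM_zero_cancel)
qed

text \<open>The approximations diverge at 0, but after multiplication by |t| both are close to sqrt
  |t|. This makes the sequence in \<open>trace_factor_contraction\<close> Cauchy.\<close>

lemma norm_sandwich_inverse_sqrt_diff_le:
  assumes b: "hermitian_contraction b"
  defines "r \<equiv> \<lambda>n. cfc b (inverse_sqrt_approx n)"
  shows "norm ((r m - r n) * (b * b) * (r m - r n)) \<le> (inverse (real (Suc m)) + inverse (real (Suc n)))\<^sup>2"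
proof -
  let ?d = "\<lambda>t. inverse_sqrt_approx m t - inverse_sqrt_approx n t"
  have d: "continuous_on {-1..1} ?d"
    by (intro continuous_intros)
  have "r m - r n = cfc b ?d"
    unfolding r_def by (intro cfc_diff[OF b, symmetric] continuous_intros)
  then have "(r m - r n) * (b * b) * (r m - r n) = cfc b (\<lambda>t. (t * ?d t)\<^sup>2)"
    by (simp add: cfc_sandwich[OF b d])
  also have "norm \<dots> \<le> (inverse (real (Suc m)) + inverse (real (Suc n)))\<^sup>2"
  proof (rule cfc_norm_le[OF b])
    fix t :: real
    have "\<bar>t * ?d t\<bar> = \<bar>\<bar>t\<bar> * inverse_sqrt_approx m t - \<bar>t\<bar> * inverse_sqrt_approx n t\<bar>"
      by (simp add: abs_mult flip: right_diff_distrib)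
    also have "\<dots> \<le> inverse (real (Suc m)) + inverse (real (Suc n))"
      using inverse_sqrt_approx[of t m] inverse_sqrt_approx[of t n] by linarith
    finally have "\<bar>t * ?d t\<bar>\<^sup>2 \<le> (inverse (real (Suc m)) + inverse (real (Suc n)))\<^sup>2"
      by (rule power_mono) simp
    then show "\<bar>(t * ?d t)\<^sup>2\<bar> \<le> (inverse (real (Suc m)) + inverse (real (Suc n)))\<^sup>2"
      by simp
  qed (intro continuous_intros)
  finally show ?thesis .
qed

text \<open>What the trace argument uses of \<phi>. The amplification to matrices has these
  properties as well, whereas its contractivity and order zero property would need separate proofs;
  one argument thus serves both.\<close>

locale balanced_map =
  fixes \<psi> :: "'a::cstar_algebra \<Rightarrow> 'b::cstar_algebra"
  assumes bounded_linear: "bounded_linear \<psi>"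
    and scaleC: "\<psi> (c *\<^sub>C x) = c *\<^sub>C \<psi> x"
    and star: "\<psi> (star x) = star (\<psi> x)"
    and positive: "positive_element x \<Longrightarrow> positive_element (\<psi> x)"
    and balanced: "\<psi> (x * y) * \<psi> z = \<psi> x * \<psi> (y * z)"
begin

interpretation \<psi>: bounded_linear \<psi>
  by (rule bounded_linear)

lemma trace_factor_contraction:
  assumes "norm (\<psi> (star x * x)) \<le> 1" "norm (\<psi> (x * star x)) \<le> 1"
  obtains v where "star v * v = \<psi> (star x * x)" "v * star v = \<psi> (x * star x)"
proof -
  define \<beta> where "\<beta> = \<psi> (star x * x)"
  define \<gamma> where "\<gamma> = \<psi> (x * star x)"
  have pos: "positive_element \<beta>" "positive_element \<gamma>"
    using positive positive_element_star_mult[of x] positive_element_star_mult[of "star x"]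
    by (simp_all add: \<beta>_def \<gamma>_def)
  then have b: "spectral_pos (unit_embed \<beta>)" "norm (unit_embed \<beta>) \<le> 1"
    and g: "spectral_pos (unit_embed \<gamma>)" "norm (unit_embed \<gamma>) \<le> 1"
    using assms by (simp_all add: positive_element_iff \<beta>_def \<gamma>_def)
  then have hb: "hermitian_contraction (unit_embed \<beta>)" and hg: "hermitian_contraction (unit_embed \<gamma>)"
    by (simp_all add: hermitian_contraction_def spectral_pos_star del: norm_unit_embed)
  obtain m where m: "positive_element m" "m * m = star x * x"
    by (rule positive_element_sqrt[OF positive_element_star_mult[of x]]) blast
  have star_m: "star m = m"
    by (rule positive_element_star[OF m(1)])
  define s where "s = \<psi> (x * m)"
  have star_s: "star s = \<psi> (m * star x)"
    by (simp add: s_def star_mult star_m flip: star)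
  have ss: "star s * s = \<beta> * \<beta>"
  proof -
    have "star s * s = \<psi> m * \<psi> (star x * x * m)"
      unfolding star_s unfolding s_def by (simp only: balanced mult.assoc)
    also have "\<dots> = \<psi> m * \<psi> (m * (m * m))"
      by (simp add: mult.assoc flip: m(2))
    finally show ?thesis
      by (simp add: \<beta>_def m(2) flip: balanced)
  qed
  have ss': "s * star s = \<gamma> * \<gamma>"
  proof -
    have "s * star s = \<psi> x * \<psi> (m * m * star x)"
      unfolding star_s unfolding s_def by (simp only: balanced mult.assoc)
    also have "\<dots> = \<psi> x * \<psi> (star x * (x * star x))"
      by (simp add: m(2) mult.assoc)
    finally show ?thesis
      by (simp add: \<gamma>_def flip: balanced)
  qed
  \<comment> \<open>This relation turns s r_n(\<beta>) into r_n(\<gamma>) s, so that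
    \<open>v n * star (v n)\<close> can be computed from \<open>s * star s\<close> in terms of
    \<gamma>.\<close>
  have "s * \<beta> = \<gamma> * s"
  proof -
    have "s * \<beta> = \<psi> x * \<psi> (m * (m * m))"
      by (simp add: s_def \<beta>_def balanced flip: m(2))
    also have "m * (m * m) = star x * (x * m)"
      by (metis m(2) mult.assoc)
    finally show ?thesis
      by (simp add: s_def \<gamma>_def flip: balanced)
  qed
  then have intertwine: "unit_embed s * unit_embed \<beta> = unit_embed \<gamma> * unit_embed s"
    by (simp flip: unit_embed_hom)
  define R where "R n = cfc (unit_embed \<beta>) (inverse_sqrt_approx n)" for n
  define R' where "R' n = cfc (unit_embed \<gamma>) (inverse_sqrt_approx n)" for n
  have sR: "unit_embed s * R n = R' n * unit_embed s" for n
    unfolding R_def R'_def by (intro cfc_intertwine[OF hb hg _ intertwine] continuous_intros)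
  have star_R: "star (R n) = R n" "star (R' n) = R' n" for n
    unfolding R_def R'_def by (intro cfc_star[OF hb] cfc_star[OF hg] continuous_intros)+
  \<comment> \<open>r_n does not vanish at 0, so R n lies in the unitization only; its product with
    s is back in the algebra.\<close>
  define v where "v n = act_right s (R n)" for n
  have vv: "unit_embed (star (v n) * v n) = R n * (unit_embed \<beta> * unit_embed \<beta>) * R n" for n
  proof -
    have "unit_embed (star (v n) * v n) = R n * unit_embed (star s * s) * R n"
      by (simp add: unit_embed_hom v_def star_mult star_R mult.assoc)
    then show ?thesis
      by (simp add: ss unit_embed_hom)
  qed
  have vv': "unit_embed (v n * star (v n)) = R' n * (unit_embed \<gamma> * unit_embed \<gamma>) * R' n" for n
  proof -
    have "unit_embed (v n * star (v n)) = R' n * unit_embed s * star (R' n * unit_embed s)"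
      by (simp only: unit_embed_hom v_def unit_embed_act sR)
    also have "\<dots> = R' n * unit_embed (s * star s) * R' n"
      by (simp add: unit_embed_hom star_mult star_R mult.assoc)
    finally show ?thesis
      by (simp add: ss' unit_embed_hom)
  qed
  have v_diff: "norm (v n - v k) \<le> inverse (real (Suc n)) + inverse (real (Suc k))" for n k
  proof (rule power2_le_imp_le)
    have diff: "unit_embed (v n - v k) = unit_embed s * (R n - R k)"
      by (simp add: unit_embed_hom v_def right_diff_distrib)
    have "unit_embed (star (v n - v k) * (v n - v k))
        = (R n - R k) * unit_embed (star s * s) * (R n - R k)"
      unfolding unit_embed_hom(5,6) diff by (simp add: star_mult star_diff star_R mult.assoc)
    then have "(norm (v n - v k))\<^sup>2
        = norm ((R n - R k) * (unit_embed \<beta> * unit_embed \<beta>) * (R n - R k))"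
      by (metis cstar_identity norm_unit_embed ss unit_embed_hom(5))
    then show "(norm (v n - v k))\<^sup>2 \<le> (inverse (real (Suc n)) + inverse (real (Suc k)))\<^sup>2"
      using norm_sandwich_inverse_sqrt_diff_le[OF hb, of n k] by (simp only: R_def)
  qed simp
  have "Cauchy v"
  proof (rule CauchyI)
    fix e :: real assume "0 < e"
    obtain N where N: "inverse (real (Suc N)) < e / 2"
      using reals_Archimedean[of "e / 2"] \<open>0 < e\<close> by auto
    have "norm (v n - v k) < e" if "N \<le> n" "N \<le> k" for n k
    proof -
      have "inverse (real (Suc n)) \<le> inverse (real (Suc N))" "inverse (real (Suc k)) \<le> inverse (real (Suc N))"
        using that by (auto intro!: le_imp_inverse_le)
      then show ?thesis
        using v_diff[of n k] N by linarith
    qed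
    then show "\<exists>N. \<forall>n\<ge>N. \<forall>k\<ge>N. norm (v n - v k) < e"
      by blast
  qed
  then obtain w where w: "v \<longlonglongrightarrow> w"
    unfolding Cauchy_convergent_iff convergent_def by blast
  have unembed: "y \<longlonglongrightarrow> z" if "(\<lambda>n. unit_embed (y n)) \<longlonglongrightarrow> unit_embed z" for y and z :: 'b
  proof -
    have "(\<lambda>n. norm (unit_embed (y n) - unit_embed z)) \<longlonglongrightarrow> 0"
      using that by (intro tendsto_norm_zero LIM_zero)
    then have "(\<lambda>n. norm (y n - z)) \<longlonglongrightarrow> 0"
      by (simp flip: unit_embed_hom)
    then show ?thesis
      by (rule LIM_zero_cancel[OF tendsto_norm_zero_cancel])
  qed
  show ?thesis
  proof (rule that[of w])
    have "(\<lambda>n. star (v n) * v n) \<longlonglongrightarrow> \<beta>"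
      using sandwich_inverse_sqrt_tendsto[OF b] by (intro unembed) (simp only: vv R_def)
    moreover have "(\<lambda>n. star (v n) * v n) \<longlonglongrightarrow> star w * w"
      by (intro tendsto_intros w)
    ultimately show "star w * w = \<psi> (star x * x)"
      unfolding \<beta>_def[symmetric] by (rule LIMSEQ_unique[rotated])
    have "(\<lambda>n. v n * star (v n)) \<longlonglongrightarrow> \<gamma>"
      using sandwich_inverse_sqrt_tendsto[OF g] by (intro unembed) (simp only: vv' R'_def)
    moreover have "(\<lambda>n. v n * star (v n)) \<longlonglongrightarrow> w * star w"
      by (intro tendsto_intros w)
    ultimately show "w * star w = \<psi> (x * star x)"
      unfolding \<gamma>_def[symmetric] by (rule LIMSEQ_unique[rotated])
  qed
qed

lemma trace_factor:
  obtains v where "star v * v = \<psi> (star x * x)" "v * star v = \<psi> (x * star x)"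
proof -
  define r where "r = sqrt (norm (\<psi> (star x * x)) + norm (\<psi> (x * star x)) + 1)"
  have "0 < r" and r: "r * r = norm (\<psi> (star x * x)) + norm (\<psi> (x * star x)) + 1"
    by (simp_all add: r_def add_nonneg_pos)
  define y where "y = inverse r *\<^sub>R x"
  have y: "\<psi> (star y * y) = inverse (r * r) *\<^sub>R \<psi> (star x * x)"
    "\<psi> (y * star y) = inverse (r * r) *\<^sub>R \<psi> (x * star x)"
    by (simp_all add: y_def star_scaleR \<psi>.scaleR)
  have "norm (\<psi> (star y * y)) \<le> inverse (r * r) * (r * r)" "norm (\<psi> (y * star y)) \<le> inverse (r * r) * (r * r)"
    unfolding y norm_scaleR by (intro mult_mono; simp add: r)+
  moreover have "inverse (r * r) * (r * r) = 1"
    using \<open>0 < r\<close> by (intro left_inverse) simp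
  ultimately have "norm (\<psi> (star y * y)) \<le> 1" "norm (\<psi> (y * star y)) \<le> 1"
    by simp_all
  then obtain v where "star v * v = \<psi> (star y * y)" "v * star v = \<psi> (y * star y)"
    by (rule trace_factor_contraction)
  moreover have "r * (r * (inverse r * inverse r)) = 1"
    using \<open>0 < r\<close> by (simp add: field_simps)
  ultimately show ?thesis
    by (intro that[of "r *\<^sub>R v"]) (simp_all add: y star_scaleR)
qed

text \<open>The u n supply the third factor on which \<open>balanced\<close> acts: \<psi>(x u)
  \<psi>(y) = \<psi>(x) \<psi>(u y) = \<psi>(x) \<psi>(y u) = \<psi>(x y) \<psi>(u), and the last is
  \<psi>(y x) \<psi>(u) = \<psi>(y) \<psi>(x u). Here u commutes with y because y commutes with
  \<open>star x * x\<close>.\<close>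

lemma commute:
  assumes "x * y = y * x" "star x * y = y * star x" "x * star x = star x * x"
  shows "\<psi> x * \<psi> y = \<psi> y * \<psi> x"
proof -
  obtain u where u: "(\<lambda>n. x * u n) \<longlonglongrightarrow> x"
    "\<And>n z. z * (star x * x) = star x * x * z \<Longrightarrow> z * u n = u n * z"
    by (rule approximate_unit) blast
  have "y * (star x * x) = star x * x * y" "x * (star x * x) = star x * x * x"
    using assms by (metis mult.assoc)+
  then have yu: "y * u n = u n * y" and xu: "x * u n = u n * x" for n
    using u(2) by blast+
  have "\<psi> (x * u n) * \<psi> y = \<psi> y * \<psi> (x * u n)" for n
    by (metis assms(1) balanced yu)
  moreover have "(\<lambda>n. \<psi> (x * u n) * \<psi> y) \<longlonglongrightarrow> \<psi> x * \<psi> y" "(\<lambda>n. \<psi> y * \<psi> (x * u n)) \<longlonglongrightarrow> \<psi> y * \<psi> x"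
    by (intro tendsto_intros \<psi>.tendsto u)+
  ultimately show ?thesis
    using LIMSEQ_unique by simp
qed

text \<open>The image of a commutative algebra generates a commutative \<open>C\<close>*-algebra: its bicommutant.\<close>

lemma commutative_cstar_subalgebra_image:
  assumes C: "cstar_subalgebra norm C" "\<forall>x\<in>C. \<forall>y\<in>C. x * y = y * x"
  obtains D where "cstar_subalgebra norm D" "\<forall>x\<in>D. \<forall>y\<in>D. x * y = y * x" "\<psi> ` C \<subseteq> D"
proof -
  have star_C: "x \<in> C \<Longrightarrow> star x \<in> C" for x
    using C(1) by (simp add: cstar_subalgebra_def)
  define S where "S = {y. \<forall>z\<in>\<psi> ` C. y * z = z * y}"
  define D where "D = {d. \<forall>y\<in>S. d * y = y * d}"
  have sub: "\<psi> ` C \<subseteq> D"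
    by (auto simp: D_def S_def)
  have "\<psi> ` C \<subseteq> S"
    using C(2) star_C by (auto simp: S_def intro!: commute)
  \<comment> \<open>The image commutes with itself, so S contains it and the commutant D of S lies
    inside S; hence D is commutative.\<close>
  then have "D \<subseteq> S"
    by (auto simp: D_def S_def)
  have star_S: "star y \<in> S" if "y \<in> S" for y
    unfolding S_def
  proof (intro CollectI ballI)
    fix z assume "z \<in> \<psi> ` C"
    then have "star z \<in> \<psi> ` C"
      using star_C by (auto simp flip: star)
    then have "y * star z = star z * y"
      using that unfolding S_def by blast
    then have "star (y * star z) = star (star z * y)"
      by (rule arg_cong)
    then show "star y * z = z * star y"
      by (simp add: star_mult)
  qed
  have "D = (\<Inter>y\<in>S. {d. d * y = y * d})"
    by (auto simp: D_def)
  then have "closed D"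
    by (auto intro!: closed_INT closed_Collect_eq continuous_intros)
  have "cstar_subalgebra norm D"
    unfolding cstar_subalgebra_def
  proof (intro conjI ballI allI impI)
    show "star d \<in> D" if "d \<in> D" for d
      unfolding D_def
    proof (intro CollectI ballI)
      fix y assume "y \<in> S"
      then have "star (d * star y) = star (star y * d)"
        using that star_S by (simp add: D_def)
      then show "star d * y = y * star d"
        by (simp add: star_mult)
    qed
    show "x * y \<in> D" if "x \<in> D" "y \<in> D" for x y
      using that unfolding D_def by (simp add: mult.assoc) (simp flip: mult.assoc)
    show "l \<in> D" if "\<forall>e>0. \<exists>x\<in>D. norm (x - l) < e" for l
    proof -
      have "l \<in> closure D"
        using that by (simp add: closure_approachable dist_norm)
      then show ?thesis
        by (simp add: closure_closed \<open>closed D\<close>)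
    qed
  qed (auto simp: D_def distrib_left distrib_right mult_scaleC_left mult_scaleC_right)
  moreover have "\<forall>x\<in>D. \<forall>y\<in>D. x * y = y * x"
    using \<open>D \<subseteq> S\<close> by (auto simp: D_def)
  ultimately show ?thesis
    using that sub by blast
qed

lemma quasitrace_comp:
  assumes "quasitrace norm \<tau>"
  shows "quasitrace norm (\<tau> \<circ> \<psi>)"
  unfolding quasitrace_def
proof (intro conjI allI impI)
  fix x :: 'a
  obtain v where "star v * v = \<psi> (star x * x)" "v * star v = \<psi> (x * star x)"
    by (rule trace_factor)
  then show "(\<tau> \<circ> \<psi>) (star x * x) = (\<tau> \<circ> \<psi>) (x * star x)" "(\<tau> \<circ> \<psi>) (star x * x) \<in> \<real>\<^sub>\<ge>\<^sub>0"
    using assms unfolding quasitrace_def comp_def by metis+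
next
  fix a b :: 'a assume "self_adjoint a" "self_adjoint b"
  then have "self_adjoint (\<psi> a)" "self_adjoint (\<psi> b)"
    by (simp_all add: self_adjoint_def flip: star)
  then show "(\<tau> \<circ> \<psi>) (a + \<i> *\<^sub>C b) = (\<tau> \<circ> \<psi>) a + \<i> * (\<tau> \<circ> \<psi>) b"
    using assms by (simp add: quasitrace_def \<psi>.add scaleC)
next
  fix C :: "'a set" assume "cstar_subalgebra norm C" "\<forall>x\<in>C. \<forall>y\<in>C. x * y = y * x"
  then obtain D where "cstar_subalgebra norm D" "\<forall>x\<in>D. \<forall>y\<in>D. x * y = y * x" "\<psi> ` C \<subseteq> D"
    by (rule commutative_cstar_subalgebra_image)
  moreover from this have "\<forall>x\<in>D. \<forall>y\<in>D. \<tau> (x + y) = \<tau> x + \<tau> y" "\<forall>c. \<forall>x\<in>D. \<tau> (c *\<^sub>C x) = c * \<tau> x"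
    using assms unfolding quasitrace_def by blast+
  ultimately show "\<forall>x\<in>C. \<forall>y\<in>C. (\<tau> \<circ> \<psi>) (x + y) = (\<tau> \<circ> \<psi>) x + (\<tau> \<circ> \<psi>) y"
    "\<forall>x\<in>C. (\<tau> \<circ> \<psi>) (c *\<^sub>C x) = c * (\<tau> \<circ> \<psi>) x" for c
    by (auto simp: \<psi>.add scaleC image_subset_iff)
qed

text \<open>\<open>trace_factor\<close> yields only L(star x * x) = L(x * star x). Polarization with
  x + y gives the sum, and with x + i y the difference, of the two relations needed for general
  products.\<close>

lemma positive_tracial_functional_comp:
  assumes "positive_tracial_functional \<tau>"
  shows "positive_tracial_functional (\<tau> \<circ> \<psi>)"
proof -
  define L where "L x = \<tau> (\<psi> x)" for x
  have \<tau>: "\<tau> (x + y) = \<tau> x + \<tau> y" "\<tau> (c *\<^sub>C x) = c * \<tau> x" "\<tau> (x * y) = \<tau> (y * x)" for x y c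
    using assms by (simp_all add: positive_tracial_functional_def Vector_Spaces.linear_iff)
  have L: "L (x + y) = L x + L y" "L (c *\<^sub>C x) = c * L x" for x y c
    by (simp_all add: L_def \<tau> \<psi>.add scaleC)
  have L_diff: "L (x - y) = L x - L y" for x y
    using L(1)[of x "- y"] L(2)[of "- 1" y] by simp
  have square: "L (star x * x) = L (x * star x)" for x
    by (rule trace_factor[of x]) (metis L_def \<tau>(3))
  have "L (star x * y) = L (y * star x)" for x y
  proof -
    have "L (star x * y) + L (star y * x) = L (x * star y) + L (y * star x)"
      using square[of "x + y"] square[of x] square[of y]
      by (simp add: star_add distrib_left distrib_right L) (simp add: add.commute)
    moreover have "\<i> * L (star x * y) - \<i> * L (star y * x)
        = \<i> * L (y * star x) - \<i> * L (x * star y)"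
      using square[of "x + \<i> *\<^sub>C y"] square[of x] square[of y]
      by (simp add: star_add star_scaleC distrib_left distrib_right L L_diff mult_scaleC_left mult_scaleC_right
          scaleC_scaleC algebra_simps)
    then have "\<i> * (L (star x * y) - L (star y * x)) = \<i> * (L (y * star x) - L (x * star y))"
      by (simp add: right_diff_distrib)
    then have "L (star x * y) - L (star y * x) = L (y * star x) - L (x * star y)"
      by simp
    ultimately show ?thesis
      by algebra
  qed
  from this[of "star x" for x] have "L (x * y) = L (y * x)" for x y
    by simp
  moreover have "Vector_Spaces.linear (*\<^sub>C) (*) (\<tau> \<circ> \<psi>)"
    using assms L by (simp add: positive_tracial_functional_def Vector_Spaces.linear_iff L_def
        vector_space_def scaleC_add_left scaleC_add_right scaleC_scaleC)
  ultimately show ?thesis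
    using assms positive by (simp add: positive_tracial_functional_def L_def)
qed

end

section \<open>Amplification to matrices\<close>

definition amplify :: "('a \<Rightarrow> 'b) \<Rightarrow> ('a, 'n) square_matrix \<Rightarrow> ('b, 'n) square_matrix" where
  "amplify f x = Matrix (\<lambda>i j. f (entry x i j))"

lemma entry_amplify [simp]: "entry (amplify f x) i j = f (entry x i j)"
  by (simp add: amplify_def Matrix_inverse)

context cpc_order_zero
begin

lemma balanced_map: "balanced_map \<phi>"
  by (rule balanced_map.intro) (fact bounded_linear scaleC star positive balanced)+

text \<open>\<open>completely_positive\<close> speaks of matrices indexed by naturals below n; the
  bijection h with the finite index type transports the factorization in both directions.\<close>

lemma amplify_positive:
  fixes x :: "('a, 'n::finite) square_matrix"
  assumes "positive_element x"
  shows "positive_element (amplify \<phi> x)"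
proof -
  obtain y where x: "x = star y * y"
    using assms by (auto simp: positive_element_def)
  define n where "n = CARD('n)"
  obtain h :: "nat \<Rightarrow> 'n" where h: "bij_betw h {..<n} UNIV"
    using ex_bij_betw_nat_finite[of "UNIV :: 'n set"] by (auto simp: n_def atLeast0LessThan)
  define h' where "h' = the_inv_into {..<n} h"
  have h': "bij_betw h' UNIV {..<n}" "h (h' i) = i" "h' i < n" for i
    using h f_the_inv_into_f_bij_betw[OF h] bij_betw_the_inv_into[OF h]
    by (auto simp: h'_def dest: bij_betwE)
  have "matrix_positive n (\<lambda>i j. entry x (h i) (h j))"
    unfolding matrix_positive_def
    by (intro exI[of _ "\<lambda>k i. entry y (h k) (h i)"])
      (simp add: x sum.reindex_bij_betw[OF h, of "\<lambda>k. star (entry y k (h i)) * entry y k (h j)" for i j])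
  then have "matrix_positive n (\<lambda>i j. \<phi> (entry x (h i) (h j)))"
    using cp by (simp add: completely_positive_def)
  then obtain w where w: "\<And>i j. i < n \<Longrightarrow> j < n \<Longrightarrow>
      \<phi> (entry x (h i) (h j)) = (\<Sum>k<n. star (w k i) * w k j)"
    unfolding matrix_positive_def by blast
  define z where "z = Matrix (\<lambda>i j. w (h' i) (h' j))"
  have "amplify \<phi> x = star z * z"
  proof (rule square_matrix_eqI)
    fix i j
    have "entry (star z * z) i j = (\<Sum>k\<in>UNIV. star (w (h' k) (h' i)) * w (h' k) (h' j))"
      by (simp add: z_def Matrix_inverse)
    also have "\<dots> = (\<Sum>k<n. star (w k (h' i)) * w k (h' j))"
      by (rule sum.reindex_bij_betw[OF h'(1)])
    also have "\<dots> = \<phi> (entry x i j)"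
      using w[of "h' i" "h' j"] by (simp add: h')
    finally show "entry (amplify \<phi> x) i j = entry (star z * z) i j"
      by simp
  qed
  then show ?thesis
    by (simp only: positive_element_star_mult)
qed

text \<open>Each summand of an entry of the product is an instance of \<open>balanced\<close> for
  \<phi>. Since \<open>balanced_map\<close> asks for boundedness, the crude constant from summing
  all entries, the square of the number of indices, is enough.\<close>

lemma balanced_map_amplify: "balanced_map (amplify \<phi> :: ('a, 'n::finite) square_matrix \<Rightarrow> _)"
proof (rule balanced_map.intro)
  fix x y z :: "('a, 'n) square_matrix" and c :: complex
  interpret \<phi>: bounded_linear \<phi>
    by (rule bounded_linear)
  show "amplify \<phi> (c *\<^sub>C x) = c *\<^sub>C amplify \<phi> x" "amplify \<phi> (star x) = star (amplify \<phi> x)"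
    by (rule square_matrix_eqI; simp add: scaleC star)+
  show "positive_element (amplify \<phi> x)" if "positive_element x"
    using that by (rule amplify_positive)
  show "amplify \<phi> (x * y) * amplify \<phi> z = amplify \<phi> x * amplify \<phi> (y * z)"
  proof (rule square_matrix_eqI)
    fix i j
    have "entry (amplify \<phi> (x * y) * amplify \<phi> z) i j
        = (\<Sum>k\<in>UNIV. \<Sum>l\<in>UNIV. \<phi> (entry x i l * entry y l k) * \<phi> (entry z k j))"
      by (simp add: \<phi>.sum sum_distrib_right)
    also have "\<dots> = (\<Sum>l\<in>UNIV. \<Sum>k\<in>UNIV. \<phi> (entry x i l * entry y l k) * \<phi> (entry z k j))"
      by (rule sum.swap)
    finally show "entry (amplify \<phi> (x * y) * amplify \<phi> z) i j
        = entry (amplify \<phi> x * amplify \<phi> (y * z)) i j"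
      by (simp add: \<phi>.sum sum_distrib_left balanced)
  qed
  show "bounded_linear (amplify \<phi> :: ('a, 'n) square_matrix \<Rightarrow> _)"
  proof (rule bounded_linear_intro)
    show "amplify \<phi> (x + y) = amplify \<phi> x + amplify \<phi> y" for x y :: "('a, 'n) square_matrix"
      by (rule square_matrix_eqI) (simp add: \<phi>.add)
    show "amplify \<phi> (r *\<^sub>R x) = r *\<^sub>R amplify \<phi> x" for r and x :: "('a, 'n) square_matrix"
      by (rule square_matrix_eqI) (simp add: scaleR_square_matrix_def scaleC)
    fix x :: "('a, 'n) square_matrix"
    have "norm (\<phi> (entry x i j)) \<le> norm x" for i j
      using contr norm_entry_le[of x i j]
      by (auto simp: contractive_def norm_square_matrix_def intro: order_trans)
    then have "entry_sum (amplify \<phi> x) \<le> (\<Sum>i\<in>(UNIV :: 'n set). \<Sum>j\<in>(UNIV :: 'n set). norm x)"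
      unfolding entry_sum_def by (intro sum_mono) simp
    then show "norm (amplify \<phi> x) \<le> norm x * (real CARD('n) * real CARD('n))"
      using norm_le_entry_sum[of "amplify \<phi> x"] by (simp add: mult.commute mult.left_commute)
  qed
qed

lemma two_quasitrace_comp:
  assumes "two_quasitrace \<tau>"
  shows "two_quasitrace (\<tau> \<circ> \<phi>)"
proof -
  interpret \<phi>: bounded_linear \<phi>
    by (rule bounded_linear)
  obtain \<tau>\<^sub>2 :: "('b, 2) square_matrix \<Rightarrow> complex" where
    \<tau>: "quasitrace norm \<tau>" "quasitrace matrix_norm \<tau>\<^sub>2" "\<And>x. \<tau>\<^sub>2 (tensor_e11 x) = \<tau> x"
    using assms by (auto simp: two_quasitrace_def)
  have "quasitrace matrix_norm (\<tau>\<^sub>2 \<circ> amplify \<phi>)"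
    using balanced_map.quasitrace_comp[OF balanced_map_amplify] \<tau>(2)
    by (simp only: norm_square_matrix_def)
  moreover have "amplify \<phi> (tensor_e11 x) = tensor_e11 (\<phi> x)" for x
    by (rule square_matrix_eqI) (simp add: tensor_e11_def Matrix_inverse \<phi>.zero)
  ultimately show ?thesis
    unfolding two_quasitrace_def using balanced_map.quasitrace_comp[OF balanced_map \<tau>(1)] \<tau>(3)
    by (intro conjI exI[of _ "\<tau>\<^sub>2 \<circ> amplify \<phi>"]) auto
qed

end

theorem corollary3p4:
  fixes \<phi> :: "'a::cstar_algebra \<Rightarrow> 'b::cstar_algebra"
  assumes "completely_positive \<phi>" and "contractive \<phi>" and "order_zero \<phi>"
  shows "(\<forall>\<tau> :: 'b \<Rightarrow> complex.
            positive_tracial_functional \<tau> \<longrightarrow> positive_tracial_functional (\<tau> \<circ> \<phi>)) \<and>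
         (\<forall>\<tau> :: 'b \<Rightarrow> complex. two_quasitrace \<tau> \<longrightarrow> two_quasitrace (\<tau> \<circ> \<phi>))"
proof -
  interpret cpc_order_zero \<phi>
    by unfold_locales (fact assms)+
  show ?thesis
    using balanced_map.positive_tracial_functional_comp[OF balanced_map] two_quasitrace_comp
    by blast
qed

end
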